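(* Let $\mathcal{R}$ be the class of all matroids that are either binary or can be obtained from a binary matroid by relaxing a circuit-hyperplane. Then the set of excluded minors for $\mathcal{R}$ is $$\{U_{2,5},\ U_{3,5},\ K,\ K^*,\ R_6,\ U_{2,4}\oplus U_{1,1},\ U_{2,4}\oplus U_{0,1}\}\cup\mathcal{D}.$$
   Context: Relaxation: if $H$ is a circuit and a hyperplane (a circuit-hyperplane) of a matroid $M$, the matroid on $E(M)$ whose bases are the bases of $M$ together with $H$ is said to be obtained from $M$ by relaxing $H$. $\mathcal{D}$ denotes the collection of all matroids obtained from a connected binary matroid $M$ having two disjoint circuit-hyperplanes $X,Y$ with $X\cup Y=E(M)$ by relaxing both $X$ and $Y$ (i.e. the matroid on $E(M)$ whose bases are the bases of $M$ together with $X$ and $Y$). $U_{m,n}$ is the uniform matroid of rank $m$ on $n$ elements. $K$ is the seven-element rank-2 matroid obtained from $U_{2,4}$ by adding one new element in parallel to each of three of its four elements; $K^*$ is its dual. $R_6$ is the six-element rank-3 matroid whose non-spanning circuits are exactly two disjoint triangles; equivalently $R_6\cong U_{2,4}\oplus_2 U_{2,4}$. *)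

theory Defs
  imports Main
begin

text \<open>A matroid is represented by its ground set and its family of independent sets.\<close>
type_synonym 'a matroid = "'a set \<times> 'a set set"

definition matroid :: "'a matroid \<Rightarrow> bool" where
  "matroid M \<longleftrightarrow> finite (fst M) \<and> (\<forall>I\<in>snd M. I \<subseteq> fst M) \<and> {} \<in> snd M
     \<and> (\<forall>I J. J \<in> snd M \<and> I \<subseteq> J \<longrightarrow> I \<in> snd M)
     \<and> (\<forall>I J. I \<in> snd M \<and> J \<in> snd M \<and> card I < card J \<longrightarrow> (\<exists>e\<in>J - I. insert e I \<in> snd M))"

definition bases :: "'a matroid \<Rightarrow> 'a set set" where
  "bases M = {B. B \<in> snd M \<and> (\<forall>I\<in>snd M. B \<subseteq> I \<longrightarrow> I = B)}"

definition of_bases :: "'a set \<Rightarrow> 'a set set \<Rightarrow> 'a matroid" where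
  "of_bases E \<B> = (E, {I. \<exists>B\<in>\<B>. I \<subseteq> B})"

definition rank :: "'a matroid \<Rightarrow> 'a set \<Rightarrow> nat" where
  "rank M X = Max {card I | I. I \<in> snd M \<and> I \<subseteq> X}"

definition circuit :: "'a matroid \<Rightarrow> 'a set \<Rightarrow> bool" where
  "circuit M C \<longleftrightarrow> C \<subseteq> fst M \<and> C \<notin> snd M \<and> (\<forall>D. D \<subset> C \<longrightarrow> D \<in> snd M)"

definition flat :: "'a matroid \<Rightarrow> 'a set \<Rightarrow> bool" where
  "flat M F \<longleftrightarrow> F \<subseteq> fst M \<and> (\<forall>e\<in>fst M - F. rank M (insert e F) > rank M F)"

definition hyperplane :: "'a matroid \<Rightarrow> 'a set \<Rightarrow> bool" where
  "hyperplane M H \<longleftrightarrow> flat M H \<and> rank M H + 1 = rank M (fst M)"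

definition connected :: "'a matroid \<Rightarrow> bool" where
  "connected M \<longleftrightarrow> (\<forall>x\<in>fst M. \<forall>y\<in>fst M. x \<noteq> y \<longrightarrow> (\<exists>C. circuit M C \<and> x \<in> C \<and> y \<in> C))"

definition dual :: "'a matroid \<Rightarrow> 'a matroid" where
  "dual M = of_bases (fst M) {fst M - B | B. B \<in> bases M}"

definition delete :: "'a matroid \<Rightarrow> 'a set \<Rightarrow> 'a matroid" where
  "delete M D = (fst M - D, {I \<in> snd M. I \<inter> D = {}})"

definition contract :: "'a matroid \<Rightarrow> 'a set \<Rightarrow> 'a matroid" where
  "contract M C = dual (delete (dual M) C)"

definition proper_minor :: "'a matroid \<Rightarrow> 'a matroid \<Rightarrow> bool" where
  "proper_minor N M \<longleftrightarrow> (\<exists>C D. C \<subseteq> fst M \<and> D \<subseteq> fst M \<and> C \<inter> D = {} \<and> C \<union> D \<noteq> {}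
       \<and> N = delete (contract M C) D)"

definition iso :: "'a matroid \<Rightarrow> 'b matroid \<Rightarrow> bool" where
  "iso M N \<longleftrightarrow> (\<exists>f. bij_betw f (fst M) (fst N) \<and>
       (\<forall>X. X \<subseteq> fst M \<longrightarrow> (X \<in> snd M \<longleftrightarrow> f ` X \<in> snd N)))"

text \<open>Binary = representable over GF(2): there is a GF(2)-matrix (columns indexed by the
  ground set, rows by nat) such that a subset is independent iff its columns are linearly
  independent over GF(2), i.e. no nonempty subfamily of columns sums to zero mod 2.\<close>
definition binary :: "'a matroid \<Rightarrow> bool" where
  "binary M \<longleftrightarrow> matroid M \<and> (\<exists>A :: 'a \<Rightarrow> nat \<Rightarrow> bool. \<forall>X. X \<subseteq> fst M \<longrightarrow>
      (X \<in> snd M \<longleftrightarrow> (\<forall>Y. Y \<subseteq> X \<and> Y \<noteq> {} \<longrightarrow> (\<exists>i. odd (card {y\<in>Y. A y i})))))"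

definition relax :: "'a matroid \<Rightarrow> 'a set set \<Rightarrow> 'a matroid" where
  "relax M Hs = of_bases (fst M) (bases M \<union> Hs)"

definition circuit_hyperplane :: "'a matroid \<Rightarrow> 'a set \<Rightarrow> bool" where
  "circuit_hyperplane M H \<longleftrightarrow> circuit M H \<and> hyperplane M H"

definition in_R :: "'a matroid \<Rightarrow> bool" where
  "in_R M \<longleftrightarrow> binary M \<or> (\<exists>M0 H. binary M0 \<and> circuit_hyperplane M0 H \<and> M = relax M0 {H})"

definition excluded_minor_R :: "'a matroid \<Rightarrow> bool" where
  "excluded_minor_R M \<longleftrightarrow> matroid M \<and> \<not> in_R M \<and> (\<forall>N. proper_minor N M \<longrightarrow> in_R N)"

definition in_D :: "'a matroid \<Rightarrow> bool" where
  "in_D M \<longleftrightarrow> (\<exists>M0 X Y. binary M0 \<and> connected M0 \<and>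
      circuit_hyperplane M0 X \<and> circuit_hyperplane M0 Y \<and> X \<inter> Y = {} \<and> X \<union> Y = fst M0 \<and>
      M = relax M0 {X, Y})"

definition U :: "nat \<Rightarrow> nat \<Rightarrow> nat matroid" where
  "U m n = ({0..<n}, {X. X \<subseteq> {0..<n} \<and> card X \<le> m})"

definition dsum :: "'a matroid \<Rightarrow> 'b matroid \<Rightarrow> ('a + 'b) matroid" where
  "dsum M N = (fst M <+> fst N,
     {X. X \<subseteq> fst M <+> fst N \<and> Inl -` X \<in> snd M \<and> Inr -` X \<in> snd N})"

text \<open>K: U_{2,4} on {0,1,2,3} with 4, 5, 6 added in parallel to 0, 1, 2 respectively.\<close>
definition K :: "nat matroid" where
  "K = ({0..<7}, {X. X \<subseteq> {0..<7} \<and> card X \<le> 2 \<and>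
        \<not> {0,4} \<subseteq> X \<and> \<not> {1,5} \<subseteq> X \<and> \<not> {2,6} \<subseteq> X})"

definition R6 :: "nat matroid" where
  "R6 = ({0..<6}, {X. X \<subseteq> {0..<6} \<and> card X \<le> 3 \<and> X \<noteq> {0,1,2} \<and> X \<noteq> {3,4,5}})"

end

theory Submission
  imports Defs
begin

text \<open>A matroid is binary iff it has no \<open>U\<^sub>2\<^sub>,\<^sub>4\<close>-minor, and such a minor is a pair \<open>S\<close>, \<open>T\<close>, with four points in
  \<open>T\<close>, such that \<open>S\<close> together with any two points of \<open>T\<close> is a basis. Relaxing a circuit-hyperplane \<open>H\<close> amounts to
  adding a \<^emph>\<open>free\<close> basis: one all of whose neighbours \<open>H - h + e\<close> are bases. Hence a nonbinary matroid lies in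
  the class iff some free basis is one of the six bases of every \<open>U\<^sub>2\<^sub>,\<^sub>4\<close>-minor.

  If none of the seven small matroids is a minor, then relative to \<open>(S, T)\<close> every element outside
  \<open>S \<union> T\<close> is parallel to exactly one point of \<open>T\<close>, every element of \<open>S\<close> is in series with exactly one,
  the two sets of labels are disjoint and have at most two elements each, and some free basis passes through
  \<open>(S, T)\<close>. Around a free basis \<open>H\<close> the \<open>U\<^sub>2\<^sub>,\<^sub>4\<close>-minors are the bases at distance two, and these form the
  \<open>2 \<times> 2\<close> minors of a matrix over \<open>GF(2)\<close>. In an excluded minor two free bases \<open>H\<close>, \<open>G\<close> that lie on different
  \<open>U\<^sub>2\<^sub>,\<^sub>4\<close>-minors must be complementary, and every \<open>U\<^sub>2\<^sub>,\<^sub>4\<close>-minor uses \<open>H\<close> or \<open>G\<close>; so tightening both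
  gives a connected binary matroid.\<close>

section \<open>Base families\<close>

text \<open>Families of bases are the working language because freeness, tightening and relaxing
  concern one base and its neighbours, and because duality is then complementation: an argument
  about deletion or a parallel element yields its dual about contraction or a series element. The
  obstacle is that minimality provides free bases of smaller matroids only, while a free base of the
  whole matroid is needed. That base comes from a local analysis: a well chosen candidate through
  \<open>(S, T)\<close> fails to be free only because of one series and one parallel element
  together, and if all candidates fail, a forbidden small minor appears. Minimality then serves for
  comparison. The free base of the deletion of \<open>e\<close> lies on all lines avoiding
  \<open>e\<close>; comparing it with a free base \<open>H\<close> on one such line shows that
  \<open>H\<close> lies on all of them, and dually for lines that contract \<open>e\<close>. Hence a
  line missing \<open>H\<close> contracts no element of \<open>H\<close> and deletes none outside
  \<open>H\<close>, which is why the second free base is the complement.\<close>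

locale base_family =
  fixes E :: "'a set" and \<B> :: "'a set set"
  assumes fin: "finite E"
    and sub: "B \<in> \<B> \<Longrightarrow> B \<subseteq> E"
    and ne: "\<B> \<noteq> {}"
    and exch: "B1 \<in> \<B> \<Longrightarrow> B2 \<in> \<B> \<Longrightarrow> x \<in> B1 - B2 \<Longrightarrow>
      \<exists>y\<in>B2 - B1. insert y (B1 - {x}) \<in> \<B>"
begin

lemma finB: "B \<in> \<B> \<Longrightarrow> finite B"
  using fin sub finite_subset by blast

text \<open>Each exchange moves \<open>B1\<close> one step towards \<open>B2\<close> without
  changing its size; once \<open>B1\<close> lies inside \<open>B2\<close> the inequality is
  plain.\<close>

lemma card_le: "B1 \<in> \<B> \<Longrightarrow> B2 \<in> \<B> \<Longrightarrow> card B1 \<le> card B2"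
proof (induction "card (B1 - B2)" arbitrary: B1 rule: less_induct)
  case less
  show ?case
  proof (cases "B1 \<subseteq> B2")
    case True
    then show ?thesis using finB less.prems card_mono by blast
  next
    case False
    then obtain x where x: "x \<in> B1 - B2" by blast
    then obtain y where y: "y \<in> B2 - B1" "insert y (B1 - {x}) \<in> \<B>"
      using exch less.prems by blast
    have f: "finite B1" using finB less.prems by blast
    have "insert y (B1 - {x}) - B2 = (B1 - B2) - {x}" using x y by auto
    then have "card (insert y (B1 - {x}) - B2) < card (B1 - B2)"
      using x f by (metis card_Diff1_less finite_Diff)
    then have "card (insert y (B1 - {x})) \<le> card B2" using less y(2) by blast
    moreover have "card (insert y (B1 - {x})) = card B1" using x y f
      by (metis DiffD1 DiffD2 card.remove card_insert_disjoint finite_Diff insert_Diff insert_iff)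
    ultimately show ?thesis by simp
  qed
qed

definition rk :: nat where "rk = card (SOME B. B \<in> \<B>)"

lemma cardB: "B \<in> \<B> \<Longrightarrow> card B = rk"
  unfolding rk_def by (metis card_le le_antisym someI)

lemma base_subset_eq: "B1 \<in> \<B> \<Longrightarrow> B2 \<in> \<B> \<Longrightarrow> B1 \<subseteq> B2 \<Longrightarrow> B1 = B2"
  using cardB finB card_subset_eq by metis

text \<open>Walk from \<open>B2\<close> towards \<open>B1\<close> by exchanges that keep
  \<open>y\<close> and \<open>B1 \<inter> B2\<close>. When \<open>y\<close> is the only element
  outside \<open>B1\<close>, the current base is \<open>B1\<close> with one element replaced by
  \<open>y\<close>, and that element is not in \<open>B2\<close> because the intersection was
  kept.\<close>

lemma exch_dual:
  assumes "B1 \<in> \<B>" "B2 \<in> \<B>" "y \<in> B2 - B1"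
  shows "\<exists>x\<in>B1 - B2. insert y (B1 - {x}) \<in> \<B>"
proof -
  have main: "\<exists>x\<in>B1 - B2. insert y (B1 - {x}) \<in> \<B>"
    if "B3 \<in> \<B>" "y \<in> B3" "B1 \<inter> B2 \<subseteq> B3" for B3
    using that
  proof (induction "card (B3 - B1)" arbitrary: B3 rule: less_induct)
    case less
    have f: "finite B3" "finite B1" using finB less.prems assms by blast+
    show ?case
    proof (cases "B3 - B1 = {y}")
      case True
      have c: "card B3 = card B1" using cardB less.prems assms by metis
      have "card (B1 - B3) = card (B3 - B1)"
        using c f by (metis add_right_cancel card_Diff_subset_Int Int_commute finite_Int)
      then have "card (B1 - B3) = 1" using True by simp
      then obtain x where x: "B1 - B3 = {x}" using card_1_singletonE by blast
      have "insert y (B1 - {x}) = B3" using x True by auto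
      moreover have "x \<in> B1 - B2" using x less.prems by auto
      ultimately show ?thesis using less.prems by blast
    next
      case False
      have "y \<in> B3 - B1" using less.prems assms by auto
      then obtain z where z: "z \<in> B3 - B1" "z \<noteq> y" using False by blast
      then obtain w where w: "w \<in> B1 - B3" "insert w (B3 - {z}) \<in> \<B>"
        using exch less.prems assms by blast
      have "insert w (B3 - {z}) - B1 = (B3 - B1) - {z}" using w by auto
      then have "card (insert w (B3 - {z}) - B1) < card (B3 - B1)"
        using z f by (metis card_Diff1_less finite_Diff)
      moreover have "y \<in> insert w (B3 - {z})" "B1 \<inter> B2 \<subseteq> insert w (B3 - {z})"
        using less.prems z by auto
      ultimately show ?thesis using less.hyps w(2) by blast
    qed
  qed
  show ?thesis using main[of B2] assms by auto
qed

text \<open>Transitivity of parallelism in the rank-two contraction of \<open>S\<close>: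
  \<open>w\<close> shows that \<open>y\<close> is no loop, so \<open>y\<close> is parallel to
  \<open>x\<close> and pairs with every \<open>z\<close> that \<open>x\<close> pairs with.\<close>

lemma line_exchange:
  assumes r: "card S + 2 = rk"
    and xz: "insert x (insert z S) \<in> \<B>" and yx: "insert y (insert x S) \<notin> \<B>"
    and yw: "insert y (insert w S) \<in> \<B>"
  shows "insert y (insert z S) \<in> \<B>"
proof -
  have fS: "finite S" using finB[OF xz] by simp
  have c: "card (insert y (insert w S)) = card S + 2" using cardB[OF yw] r by simp
  have d: "y \<notin> S" "w \<notin> S" "y \<noteq> w"
    using c fS by (auto simp: card_insert_if split: if_splits)
  have wx: "w \<noteq> x" using yw yx by auto
  show ?thesis
  proof (cases "w = z \<or> y = z \<or> y = x")
    case True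
    then show ?thesis using xz yx yw by (metis insert_commute)
  next
    case False
    then have "w \<in> insert y (insert w S) - insert x (insert z S)" using d wx by auto
    then obtain v where v: "v \<in> insert x (insert z S) - insert y (insert w S)"
      "insert v (insert y (insert w S) - {w}) \<in> \<B>" using exch yw xz by blast
    have "insert y (insert w S) - {w} = insert y S" using d by auto
    then have "insert y (insert v S) \<in> \<B>" using v(2) by (simp add: insert_commute)
    moreover have "v = x \<or> v = z" using v by auto
    ultimately show ?thesis using yx by auto
  qed
qed

text \<open>An element of the base that is neither in \<open>I\<close> nor in \<open>B2\<close> can
  be traded for one of \<open>B2\<close>; this is the augmentation of an independent set from a
  given base.\<close>

lemma extend_from_base:
  assumes "I \<subseteq> B1" "B1 \<in> \<B>" "B2 \<in> \<B>"
  shows "\<exists>B\<in>\<B>. I \<subseteq> B \<and> B \<subseteq> I \<union> B2"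
  using assms
proof (induction "card (B1 - (I \<union> B2))" arbitrary: B1 rule: less_induct)
  case less
  show ?case
  proof (cases "B1 - (I \<union> B2) = {}")
    case False
    then obtain x where x: "x \<in> B1" "x \<notin> I" "x \<notin> B2" by blast
    then obtain y where y: "y \<in> B2 - B1" "insert y (B1 - {x}) \<in> \<B>"
      using exch less.prems by blast
    have "insert y (B1 - {x}) - (I \<union> B2) = (B1 - (I \<union> B2)) - {x}" using y by auto
    moreover have "finite B1" using finB less.prems by blast
    ultimately have "card (insert y (B1 - {x}) - (I \<union> B2)) < card (B1 - (I \<union> B2))"
      using x by (metis DiffI UnE card_Diff1_less finite_Diff)
    moreover have "I \<subseteq> insert y (B1 - {x})" using x less.prems by auto
    ultimately show ?thesis using less y(2) by blast
  qed (use less.prems in blast)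
qed

end

definition dfam :: "'a set \<Rightarrow> 'a set set \<Rightarrow> 'a set set" where
  "dfam E \<B> = {E - B | B. B \<in> \<B>}"

text \<open>\<open>wit \<B> S T\<close>: contracting \<open>S\<close> and deleting the rest leaves \<open>U\<^sub>2\<^sub>,\<^sub>4\<close> on \<open>T\<close>.\<close>

definition wit :: "'a set set \<Rightarrow> 'a set \<Rightarrow> 'a set \<Rightarrow> bool" where
  "wit \<B> S T \<longleftrightarrow> card T = 4 \<and> S \<inter> T = {} \<and>
     (\<forall>x\<in>T. \<forall>y\<in>T. x \<noteq> y \<longrightarrow> insert x (insert y S) \<in> \<B>)"

text \<open>No cardinality is asked for: when \<open>H\<close> has the size of a base, the rank
  forces it to be \<open>S\<close> with exactly two points of \<open>T\<close>
  (\<open>through_base\<close>).\<close>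

definition through :: "'a set \<Rightarrow> 'a set \<Rightarrow> 'a set \<Rightarrow> bool" where
  "through H S T \<longleftrightarrow> S \<subseteq> H \<and> H \<subseteq> S \<union> T"

definition free_base :: "'a set \<Rightarrow> 'a set set \<Rightarrow> 'a set \<Rightarrow> bool" where
  "free_base E \<B> H \<longleftrightarrow> H \<in> \<B> \<and> (\<forall>h\<in>H. \<forall>e\<in>E - H. insert e (H - {h}) \<in> \<B>)"

text \<open>The counterpart of \<open>in_R\<close> for bases. The binary case is a separate disjunct
  because a binary matroid may have no free base at all.\<close>

definition good :: "'a set \<Rightarrow> 'a set set \<Rightarrow> bool" where
  "good E \<B> \<longleftrightarrow> (\<forall>S T. \<not> wit \<B> S T) \<or>
     (\<exists>H. free_base E \<B> H \<and> (\<forall>S T. wit \<B> S T \<longrightarrow> through H S T))"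

lemma card4E:
  assumes "card T = 4"
  obtains a b c d where "T = {a,b,c,d}" "distinct [a,b,c,d]"
proof -
  have "finite T" using assms card.infinite by fastforce
  then obtain xs where xs: "set xs = T" "distinct xs"
    using finite_distinct_list by blast
  have "length xs = 4" using xs assms distinct_card by metis
  then obtain a b c d where "xs = [a,b,c,d]"
    by (auto simp: numeral_eq_Suc length_Suc_conv)
  then show ?thesis using that xs by auto
qed

lemma witI:
  assumes "distinct [a,b,c,d]" "S \<inter> {a,b,c,d} = {}"
    "insert a (insert b S) \<in> \<B>" "insert a (insert c S) \<in> \<B>" "insert a (insert d S) \<in> \<B>"
    "insert b (insert c S) \<in> \<B>" "insert b (insert d S) \<in> \<B>" "insert c (insert d S) \<in> \<B>"
  shows "wit \<B> S {a,b,c,d}"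
proof -
  have "insert y (insert x S) \<in> \<B>" if "insert x (insert y S) \<in> \<B>" for x y
    using that by (simp add: insert_commute)
  then show ?thesis unfolding wit_def using assms by auto
qed

lemma witD: "wit \<B> S T \<Longrightarrow> x \<in> T \<Longrightarrow> y \<in> T \<Longrightarrow> x \<noteq> y \<Longrightarrow> insert x (insert y S) \<in> \<B>"
  unfolding wit_def by blast

section \<open>Duality, tightening and relaxing for base families\<close>

context base_family begin

lemma dual_mem: "X \<subseteq> E \<Longrightarrow> X \<in> dfam E \<B> \<longleftrightarrow> E - X \<in> \<B>"
  unfolding dfam_def using sub by (auto simp: double_diff)

lemma dfam_dfam: "dfam E (dfam E \<B>) = \<B>"
  unfolding dfam_def using sub by (auto simp: double_diff)

lemma dual_family: "base_family E (dfam E \<B>)"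
proof
  show "finite E" by (rule fin)
  show "\<And>B. B \<in> dfam E \<B> \<Longrightarrow> B \<subseteq> E" by (auto simp: dfam_def)
  show "dfam E \<B> \<noteq> {}" using ne by (auto simp: dfam_def)
  fix B1 B2 x assume a: "B1 \<in> dfam E \<B>" "B2 \<in> dfam E \<B>" "x \<in> B1 - B2"
  then obtain C1 C2 where c: "C1 \<in> \<B>" "B1 = E - C1" "C2 \<in> \<B>" "B2 = E - C2"
    by (auto simp: dfam_def)
  have "x \<in> C2 - C1" using a c by auto
  then obtain y where y: "y \<in> C1 - C2" "insert x (C1 - {y}) \<in> \<B>"
    using exch_dual c by blast
  have "E - insert x (C1 - {y}) = insert y (B1 - {x})" using c y sub a by auto
  then have "insert y (B1 - {x}) \<in> dfam E \<B>" using y unfolding dfam_def by blast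
  moreover have "y \<in> B2 - B1" using y c sub by auto
  ultimately show "\<exists>y\<in>B2 - B1. insert y (B1 - {x}) \<in> dfam E \<B>" by blast
qed

lemma wit_sub: "wit \<B> S T \<Longrightarrow> S \<subseteq> E \<and> T \<subseteq> E"
proof -
  assume w: "wit \<B> S T"
  then obtain a b c d where t: "T = {a,b,c,d}" "distinct [a,b,c,d]"
    using card4E unfolding wit_def by metis
  have "insert a (insert b S) \<in> \<B>" "insert c (insert d S) \<in> \<B>" using w t by (auto intro: witD)
  then show ?thesis using sub t by blast
qed

lemma wit_card: "wit \<B> S T \<Longrightarrow> card S + 2 = rk" "wit \<B> S T \<Longrightarrow> finite S" "wit \<B> S T \<Longrightarrow> finite T"
proof -
  assume w: "wit \<B> S T"
  then obtain a b c d where t: "T = {a,b,c,d}" "distinct [a,b,c,d]"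
    using card4E unfolding wit_def by metis
  have "insert a (insert b S) \<in> \<B>" using w t by (auto intro: witD)
  moreover have "a \<notin> S" "b \<notin> S" using w t unfolding wit_def by auto
  moreover show "finite S" using wit_sub[OF w] fin finite_subset by blast
  ultimately show "card S + 2 = rk" using t(2) cardB by fastforce
  show "finite T" using t by simp
qed

text \<open>\<open>U\<^sub>2\<^sub>,\<^sub>4\<close> is self-dual: the complement of two points of
  \<open>T\<close> with the deleted set is the other two points with \<open>S\<close>.\<close>

lemma wit_dual: "wit \<B> S T \<Longrightarrow> wit (dfam E \<B>) (E - S - T) T"
proof -
  assume w: "wit \<B> S T"
  then obtain a b c d where t: "T = {a,b,c,d}" "distinct [a,b,c,d]"
    using card4E unfolding wit_def by metis
  have s: "S \<subseteq> E" "T \<subseteq> E" "S \<inter> T = {}" using wit_sub[OF w] w unfolding wit_def by auto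
  have k: "insert p (insert q (E - S - T)) \<in> dfam E \<B>"
    if "{p,q,u,v} = T" "distinct [p,q,u,v]" for p q u v
  proof -
    have "E - insert p (insert q (E - S - T)) = insert u (insert v S)"
      using that s by auto
    moreover have "insert u (insert v S) \<in> \<B>" using w that by (auto intro!: witD)
    moreover have "insert p (insert q (E - S - T)) \<subseteq> E" using that s by auto
    ultimately show ?thesis using dual_mem by simp
  qed
  show ?thesis unfolding t(1)
    using k[of a b c d] k[of a c b d] k[of a d b c] k[of b c a d] k[of b d a c] k[of c d a b] t
    by (intro witI) auto
qed

lemma dual_witE:
  assumes "wit (dfam E \<B>) S T"
  shows "wit \<B> (E - S - T) T" "S \<subseteq> E" "T \<subseteq> E" "S \<inter> T = {}"
  using base_family.wit_dual[OF dual_family assms] base_family.wit_sub[OF dual_family assms] assms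
  by (auto simp: dfam_dfam wit_def)

lemma through_dual:
  "H \<subseteq> E \<Longrightarrow> S \<subseteq> E \<Longrightarrow> T \<subseteq> E \<Longrightarrow> S \<inter> T = {} \<Longrightarrow> through (E - H) (E - S - T) T \<longleftrightarrow> through H S T"
  unfolding through_def by auto

lemma free_dual: "free_base E \<B> H \<Longrightarrow> free_base E (dfam E \<B>) (E - H)"
  unfolding free_base_def
proof (intro conjI ballI; elim conjE)
  assume "H \<in> \<B>" then show "E - H \<in> dfam E \<B>" by (auto simp: dfam_def)
next
  fix h e assume a: "h \<in> E - H" "e \<in> E - (E - H)" "H \<in> \<B>" "\<forall>h\<in>H. \<forall>e\<in>E - H. insert e (H - {h}) \<in> \<B>"
  then have "insert h (H - {e}) \<in> \<B>" by auto
  moreover have "E - insert e (E - H - {h}) = insert h (H - {e})" using a sub by auto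
  moreover have "insert e (E - H - {h}) \<subseteq> E" using a by auto
  ultimately show "insert e (E - H - {h}) \<in> dfam E \<B>" using dual_mem by simp
qed

lemma good_dual: "good E \<B> \<Longrightarrow> good E (dfam E \<B>)"
proof -
  assume g: "good E \<B>"
  show ?thesis
  proof (cases "\<forall>S T. \<not> wit \<B> S T")
    case True
    then show ?thesis unfolding good_def using dual_witE(1) by blast
  next
    case False
    then obtain H where H: "free_base E \<B> H" "\<And>S T. wit \<B> S T \<Longrightarrow> through H S T"
      using g unfolding good_def by blast
    have "through (E - H) S T" if "wit (dfam E \<B>) S T" for S T
    proof -
      have "H \<subseteq> E" using H sub unfolding free_base_def by auto
      then show ?thesis
      using H(2)[OF dual_witE(1)[OF that]] dual_witE(2-4)[OF that] unfolding through_def by auto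
    qed
    then show ?thesis unfolding good_def using free_dual H by blast
  qed
qed

lemma good_dual_iff: "good E (dfam E \<B>) \<longleftrightarrow> good E \<B>"
  using good_dual base_family.good_dual[OF dual_family] by (auto simp: dfam_dfam)

text \<open>If an exchange in \<open>B1\<close> lands on the removed \<open>H = B1 - x + y\<close>,
  bring in instead any \<open>z\<close> of \<open>B2\<close> outside \<open>H\<close>: by freeness
  \<open>H - y + z\<close> is a base, and it equals \<open>B1 - x + z\<close>.\<close>

lemma tighten:
  assumes H: "free_base E \<B> H" and ne2: "\<B> - {H} \<noteq> {}"
  shows "base_family E (\<B> - {H})"
proof
  show "finite E" by (rule fin)
  show "\<And>B. B \<in> \<B> - {H} \<Longrightarrow> B \<subseteq> E" using sub by blast
  show "\<B> - {H} \<noteq> {}" by (rule ne2)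
  fix B1 B2 x assume a: "B1 \<in> \<B> - {H}" "B2 \<in> \<B> - {H}" "x \<in> B1 - B2"
  then obtain y where y: "y \<in> B2 - B1" "insert y (B1 - {x}) \<in> \<B>" using exch by blast
  show "\<exists>y\<in>B2 - B1. insert y (B1 - {x}) \<in> \<B> - {H}"
  proof (cases "insert y (B1 - {x}) = H")
    case False then show ?thesis using y by blast
  next
    case True
    have HB: "H \<in> \<B>" using H unfolding free_base_def by blast
    have "\<not> B2 \<subseteq> H" using base_subset_eq[of B2 H] a HB by blast
    then obtain z where z: "z \<in> B2" "z \<notin> H" by blast
    have zB: "z \<notin> B1" using z True a by auto
    have "insert z (H - {y}) = insert z (B1 - {x})" using True y by auto
    moreover have "insert z (H - {y}) \<in> \<B>" using H z True a(2) sub unfolding free_base_def by blast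
    moreover have "insert z (B1 - {x}) \<noteq> H" using z by auto
    ultimately show ?thesis using z zB by auto
  qed
qed

text \<open>Exchanges out of \<open>H\<close> are the assumption itself. For exchanges towards
  \<open>H\<close>, either one step reaches \<open>H\<close>, or a neighbour of \<open>H\<close> can
  stand in for it.\<close>

lemma relaxing:
  assumes H: "H \<subseteq> E" "H \<noteq> {}" "E - H \<noteq> {}" "\<And>h e. h \<in> H \<Longrightarrow> e \<in> E - H \<Longrightarrow> insert e (H - {h}) \<in> \<B>"
  shows "base_family E (insert H \<B>)"
proof
  show "finite E" by (rule fin)
  show "\<And>B. B \<in> insert H \<B> \<Longrightarrow> B \<subseteq> E" using sub H by blast
  show "insert H \<B> \<noteq> {}" by simp
  obtain h0 e0 where he: "h0 \<in> H" "e0 \<in> E - H" using H by blast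
  have fH: "finite H" using H fin finite_subset by blast
  have cH: "card H = rk" using cardB[OF H(4)[OF he]] he fH
    by (metis DiffD2 card.remove card_insert_disjoint finite_Diff insert_Diff insert_iff)
  fix B1 B2 x assume a: "B1 \<in> insert H \<B>" "B2 \<in> insert H \<B>" "x \<in> B1 - B2"
  have cc: "card B1 = rk" "card B2 = rk" "finite B1" "finite B2"
    using a cH cardB finB fH by auto
  show "\<exists>y\<in>B2 - B1. insert y (B1 - {x}) \<in> insert H \<B>"
  proof (cases "B1 = H")
    case True
    have "\<not> B2 \<subseteq> H" using a True cc cH card_subset_eq[OF fH, of B2] by auto
    then obtain y where "y \<in> B2 - H" by blast
    then show ?thesis using a True H(4)[of x y] sub by auto
  next
    case False
    then have B1: "B1 \<in> \<B>" using a by blast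
    show ?thesis
    proof (cases "B2 = H")
      case False then show ?thesis using a B1 exch by blast
    next
      case True
      have "card (B1 - H) = card (H - B1)"
        using cc cH fH by (metis add_right_cancel card_Diff_subset_Int Int_commute finite_Int)
      show ?thesis
      proof (cases "B1 - H = {x}")
        case True
        then have "card (H - B1) = 1" using \<open>card (B1 - H) = card (H - B1)\<close> by simp
        then obtain y where y: "H - B1 = {y}" using card_1_singletonE by blast
        have "insert y (B1 - {x}) = H" using y True by auto
        then show ?thesis using y \<open>B2 = H\<close> by blast
      next
        case False
        then obtain e where e: "e \<in> B1 - H" "e \<noteq> x" using a \<open>B2 = H\<close> by blast
        have "card {e,x} \<le> card (B1 - H)" using e a \<open>B2 = H\<close> cc by (intro card_mono) auto
        then have "card (H - B1) \<ge> 2" using e \<open>card (B1 - H) = card (H - B1)\<close> by simp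
        then have "H - B1 \<noteq> {}" by (metis card.empty not_numeral_le_zero)
        then obtain h where h: "h \<in> H - B1" by blast
        have "e \<in> E - H" using e B1 sub by auto
        \<comment> \<open>The neighbour takes its new element \<open>e\<close> from
          \<open>B1\<close>, so exchanging against it still brings in an element of
          \<open>H\<close>; \<open>e\<close> differs from \<open>x\<close>, so \<open>x\<close> may
          be removed.\<close>
        then have "insert e (H - {h}) \<in> \<B>" using H(4) h by blast
        moreover have "x \<in> B1 - insert e (H - {h})" using a e \<open>B2 = H\<close> by auto
        ultimately obtain y where "y \<in> insert e (H - {h}) - B1" "insert y (B1 - {x}) \<in> \<B>"
          using exch B1 by blast
        then show ?thesis using e \<open>B2 = H\<close> by blast
      qed
    qed
  qed
qed

end

section \<open>Matroids and their base families\<close>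

lemma matroidD:
  assumes "matroid M"
  shows "finite (fst M)" "\<And>I. I \<in> snd M \<Longrightarrow> I \<subseteq> fst M" "\<And>I. I \<in> snd M \<Longrightarrow> finite I" "{} \<in> snd M"
    "\<And>I J. J \<in> snd M \<Longrightarrow> I \<subseteq> J \<Longrightarrow> I \<in> snd M"
    "\<And>I J. I \<in> snd M \<Longrightarrow> J \<in> snd M \<Longrightarrow> card I < card J \<Longrightarrow> \<exists>e\<in>J - I. insert e I \<in> snd M"
proof -
  show a: "finite (fst M)" "\<And>I. I \<in> snd M \<Longrightarrow> I \<subseteq> fst M" using assms unfolding matroid_def by simp_all
  show "\<And>I. I \<in> snd M \<Longrightarrow> finite I" using a finite_subset by metis
  show "{} \<in> snd M" using assms unfolding matroid_def by simp
  show "\<And>I J. J \<in> snd M \<Longrightarrow> I \<subseteq> J \<Longrightarrow> I \<in> snd M" using assms unfolding matroid_def by metis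
  show "\<And>I J. I \<in> snd M \<Longrightarrow> J \<in> snd M \<Longrightarrow> card I < card J \<Longrightarrow> \<exists>e\<in>J - I. insert e I \<in> snd M"
    using assms unfolding matroid_def by metis
qed

lemma basesD: "B \<in> bases M \<Longrightarrow> B \<in> snd M" "B \<in> bases M \<Longrightarrow> I \<in> snd M \<Longrightarrow> B \<subseteq> I \<Longrightarrow> I = B"
  unfolding bases_def by blast+

lemma matroid_extend:
  assumes m: "matroid M" and I: "I \<in> snd M"
  shows "\<exists>B\<in>bases M. I \<subseteq> B"
  using I
proof (induction "card (fst M) - card I" arbitrary: I rule: less_induct)
  case less
  show ?case
  proof (cases "I \<in> bases M")
    case False
    then obtain J where J: "J \<in> snd M" "I \<subset> J" using less.prems unfolding bases_def by blast
    have f: "finite (fst M)" "J \<subseteq> fst M" using matroidD[OF m] J by auto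
    then have "card I < card J" "card J \<le> card (fst M)"
      using J by (auto intro: psubset_card_mono card_mono finite_subset)
    then have "\<exists>B\<in>bases M. J \<subseteq> B" using less J by (metis diff_less_mono2 order_less_le_trans)
    then show ?thesis using J by blast
  qed blast
qed

lemma bases_card_eq:
  assumes m: "matroid M" and I: "I \<in> snd M" and B: "B \<in> bases M"
  shows "card I \<le> card B" "card I = card B \<Longrightarrow> I \<in> bases M"
proof -
  have le: "card I \<le> card B" if t: "I \<in> snd M" "B \<in> bases M" for I B
  proof (rule ccontr)
    assume "\<not> ?thesis"
    then have "card B < card I" by simp
    then obtain e where "e \<in> I - B" "insert e B \<in> snd M"
      using matroidD(6)[OF m basesD(1)[OF t(2)] t(1)] by blast
    then show False using t basesD(2)[of B M "insert e B"] by blast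
  qed
  show "card I \<le> card B" using le I B by blast
  assume c: "card I = card B"
  obtain B' where B': "B' \<in> bases M" "I \<subseteq> B'" using matroid_extend m I by blast
  have "B' \<in> snd M" using B' basesD(1) by blast
  then have "card B' \<le> card I" using le B c by simp
  moreover have "finite B'" using \<open>B' \<in> snd M\<close> matroidD(3)[OF m] by blast
  ultimately have "I = B'" using B' card_seteq[of B' I] by blast
  then show "I \<in> bases M" using B' by blast
qed

lemma matroid_indep_iff: "matroid M \<Longrightarrow> I \<in> snd M \<longleftrightarrow> (\<exists>B\<in>bases M. I \<subseteq> B)"
proof -
  assume m: "matroid M"
  show ?thesis using matroid_extend[OF m] matroidD(5)[OF m] basesD(1) by blast
qed

lemma matroid_base_family: "matroid M \<Longrightarrow> base_family (fst M) (bases M)"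
proof
  assume m: "matroid M"
  show "finite (fst M)" by (rule matroidD(1)[OF m])
  show s: "\<And>B. B \<in> bases M \<Longrightarrow> B \<subseteq> fst M" using matroidD(2)[OF m] basesD(1) by blast
  show "bases M \<noteq> {}" using matroid_extend[OF m matroidD(4)[OF m]] by blast
  fix B1 B2 x assume a: "B1 \<in> bases M" "B2 \<in> bases M" "x \<in> B1 - B2"
  have i: "B1 \<in> snd M" "B2 \<in> snd M" using a basesD(1) by blast+
  have f: "finite B1" using i matroidD(3)[OF m] by blast
  have "B1 - {x} \<in> snd M" using i matroidD(5)[OF m] by blast
  moreover have "card (B1 - {x}) < card B2"
    using bases_card_eq(1)[OF m i(1) a(2)] a f by (metis DiffD1 card_Diff1_less order_less_le_trans)
  ultimately obtain y where y: "y \<in> B2 - (B1 - {x})" "insert y (B1 - {x}) \<in> snd M"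
    using matroidD(6)[OF m] i by blast
  have "y \<in> B2 - B1" using y a by auto
  moreover have "card (insert y (B1 - {x})) = card B1" using calculation a f
    by (metis DiffD1 DiffD2 card.remove card_insert_disjoint finite_Diff insert_Diff insert_iff)
  ultimately show "\<exists>y\<in>B2 - B1. insert y (B1 - {x}) \<in> bases M"
    using bases_card_eq(2)[OF m y(2) a(1)] by blast
qed

lemma of_bases_fst [simp]: "fst (of_bases E \<B>) = E"
  by (simp add: of_bases_def)

lemma matroid_of_bases: "matroid M \<Longrightarrow> of_bases (fst M) (bases M) = M"
  by (intro prod_eqI) (auto simp: of_bases_def matroid_indep_iff, blast)

lemma of_bases_matroid:
  assumes "base_family E \<B>"
  shows "matroid (of_bases E \<B>)" "bases (of_bases E \<B>) = \<B>"
proof -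
  interpret base_family E \<B> by fact
  have aug0: "\<exists>e\<in>J - I. \<exists>B\<in>\<B>. insert e I \<subseteq> B"
    if a: "I \<subseteq> B1" "B1 \<in> \<B>" "J \<subseteq> B2" "B2 \<in> \<B>" "card I < card J" for I J B1 B2
  proof -
    obtain B where B: "B \<in> \<B>" "I \<subseteq> B" "B \<subseteq> I \<union> B2" using extend_from_base[OF a(1,2,4)] by blast
    have f: "finite B" "finite B2" using finB B a by auto
    have "finite I" "finite J" using B a f finite_subset by blast+
    then have "card (B - I) = rk - card I" "card (B2 - J) = rk - card J"
      using card_Diff_subset[of I B] card_Diff_subset[of J B2] cardB[of B] cardB[of B2] B a by auto
    moreover have "card J \<le> rk" using card_mono[OF f(2), of J] cardB[of B2] a by auto
    \<comment> \<open>\<open>B - I\<close> lies in \<open>B2\<close> and is larger than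
      \<open>B2 - J\<close>, so it contains an element of \<open>J\<close>.\<close>
    ultimately have "card (B2 - J) < card (B - I)" using a by auto
    then have "\<not> B - I \<subseteq> B2 - J" using card_mono[of "B2 - J" "B - I"] f by auto
    then obtain e where "e \<in> B - I" "e \<in> J" using B by blast
    then show ?thesis using B by blast
  qed
  have aug: "\<exists>e\<in>J - I. insert e I \<in> {I. \<exists>B\<in>\<B>. I \<subseteq> B}"
    if ij: "I \<in> {I. \<exists>B\<in>\<B>. I \<subseteq> B} \<and> J \<in> {I. \<exists>B\<in>\<B>. I \<subseteq> B} \<and> card I < card J" for I J
  proof -
    obtain B1 B2 where "I \<subseteq> B1" "B1 \<in> \<B>" "J \<subseteq> B2" "B2 \<in> \<B>" "card I < card J" using ij by auto
    from aug0[OF this] show ?thesis by auto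
  qed
  have "\<exists>B. B \<in> \<B>" using ne by blast
  then show "matroid (of_bases E \<B>)"
    unfolding matroid_def of_bases_def fst_conv snd_conv
    using sub by (intro conjI allI impI ballI fin aug) (simp_all, blast+)
  show "bases (of_bases E \<B>) = \<B>"
  proof (intro equalityI subsetI)
    fix B assume "B \<in> bases (of_bases E \<B>)"
    then have b: "\<exists>B'\<in>\<B>. B \<subseteq> B'" "\<And>I B'. B' \<in> \<B> \<Longrightarrow> I \<subseteq> B' \<Longrightarrow> B \<subseteq> I \<Longrightarrow> I = B"
      unfolding bases_def of_bases_def by auto
    then obtain B' where "B' \<in> \<B>" "B \<subseteq> B'" by blast
    then have "B' = B" using b(2)[of B' B'] by blast
    then show "B \<in> \<B>" using \<open>B' \<in> \<B>\<close> by simp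
  next
    fix B assume B: "B \<in> \<B>"
    have "I = B" if "B' \<in> \<B>" "I \<subseteq> B'" "B \<subseteq> I" for I B'
      using base_subset_eq[OF B that(1)] that by blast
    then show "B \<in> bases (of_bases E \<B>)"
      unfolding bases_def of_bases_def using B by auto
  qed
qed

lemma dual_of_bases: "matroid M \<Longrightarrow> dual M = of_bases (fst M) (dfam (fst M) (bases M))"
  by (simp add: dual_def dfam_def)

lemma dual_facts:
  assumes "matroid M"
  shows "matroid (dual M)" "bases (dual M) = dfam (fst M) (bases M)" "fst (dual M) = fst M"
  using of_bases_matroid[OF base_family.dual_family[OF matroid_base_family[OF assms]]]
    dual_of_bases[OF assms] by auto

lemma dual_dual: "matroid M \<Longrightarrow> dual (dual M) = M"
  using dual_facts[of M] dual_of_bases[of "dual M"] matroid_of_bases[of M]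
    base_family.dfam_dfam[OF matroid_base_family[of M]] by simp

lemma delete_matroid:
  assumes "matroid M" shows "matroid (delete M D)"
proof -
  have "\<exists>e\<in>J - I. insert e I \<in> snd M \<and> insert e I \<inter> D = {}"
    if "I \<in> snd M" "J \<in> snd M" "I \<inter> D = {}" "J \<inter> D = {}" "card I < card J" for I J
    using matroidD(6)[OF assms that(1,2,5)] that by blast
  then show ?thesis
    unfolding matroid_def delete_def using matroidD(1-5)[OF assms]
    by (intro conjI) (simp_all, blast, blast)
qed

text \<open>A base disjoint from \<open>D\<close> guarantees that the deletion keeps the
  rank.\<close>

lemma bases_delete:
  assumes m: "matroid M" and B: "B \<in> bases M" "B \<inter> D = {}"
  shows "bases (delete M D) = {B \<in> bases M. B \<inter> D = {}}"
proof -
  have "B \<in> snd (delete M D)" using B unfolding delete_def bases_def by auto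
  show ?thesis
  proof safe
    fix C assume C: "C \<in> bases (delete M D)"
    then have c: "C \<in> snd M" "C \<inter> D = {}" unfolding bases_def delete_def by auto
    have "card B \<le> card C"
      using bases_card_eq(1)[OF delete_matroid[OF m] \<open>B \<in> snd (delete M D)\<close> C] .
    then show "C \<in> bases M" using bases_card_eq[OF m c(1) B(1)] by simp
    fix x assume "x \<in> C" "x \<in> D" then show "x \<in> {}" using c by auto
  next
    fix C assume "C \<in> bases M" "C \<inter> D = {}"
    then show "C \<in> bases (delete M D)" unfolding bases_def delete_def by auto
  qed
qed

text \<open>The one-element case outside \<open>bases_delete\<close>: every base loses
  \<open>e\<close>, exactly as if \<open>e\<close> were contracted.\<close>

lemma bases_delete_coloop:
  assumes m: "matroid M" and e: "\<And>B. B \<in> bases M \<Longrightarrow> e \<in> B"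
  shows "bases (delete M {e}) = {B - {e} |B. B \<in> bases M}"
proof -
  have i: "C \<in> snd (delete M {e}) \<longleftrightarrow> (\<exists>B\<in>bases M. C \<subseteq> B - {e})" for C
    using matroid_indep_iff[OF m] by (auto simp: delete_def)
  have eq: "B = B'" if "B \<in> bases M" "B' \<in> bases M" "B - {e} \<subseteq> B' - {e}" for B B'
    using base_family.base_subset_eq[OF matroid_base_family[OF m] that(1,2)] that e by blast
  show ?thesis
  proof (intro equalityI subsetI)
    fix C assume C: "C \<in> bases (delete M {e})"
    then obtain B where B: "B \<in> bases M" "C \<subseteq> B - {e}" using i[of C] basesD(1)[OF C] by blast
    have "B - {e} \<in> snd (delete M {e})" using i[of "B - {e}"] B(1) by blast
    then have "B - {e} = C" using basesD(2)[OF C _ B(2)] by blast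
    then show "C \<in> {B - {e} |B. B \<in> bases M}" using B by blast
  next
    fix C assume "C \<in> {B - {e} |B. B \<in> bases M}"
    then obtain B where B: "B \<in> bases M" "C = B - {e}" by blast
    have "I = C" if ic: "I \<in> snd (delete M {e})" "C \<subseteq> I" for I
    proof -
      obtain B' where "B' \<in> bases M" "I \<subseteq> B' - {e}" using ic(1) i[of I] by blast
      then show ?thesis using eq[of B B'] B ic(2) by blast
    qed
    then show "C \<in> bases (delete M {e})" unfolding bases_def using i[of C] B by blast
  qed
qed

lemma contract_matroid: "matroid M \<Longrightarrow> matroid (contract M C)"
  unfolding contract_def by (simp add: dual_facts delete_matroid)

lemma delete_fst [simp]: "fst (delete M D) = fst M - D" by (simp add: delete_def)

lemma contract_fst [simp]: "matroid M \<Longrightarrow> fst (contract M C) = fst M - C"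
  unfolding contract_def by (simp add: dual_facts delete_matroid)

lemma bases_contract:
  assumes m: "matroid M" and B: "B \<in> bases M" "e \<in> B"
  shows "bases (contract M {e}) = {B - {e} |B. B \<in> bases M \<and> e \<in> B}"
proof -
  interpret base_family "fst M" "bases M" by (rule matroid_base_family[OF m])
  have dm: "matroid (dual M)" using dual_facts[OF m] by simp
  have "fst M - B \<in> bases (dual M)" using B dual_facts[OF m] by (auto simp: dfam_def)
  then have bd: "bases (delete (dual M) {e}) = {B \<in> bases (dual M). B \<inter> {e} = {}}"
    using bases_delete[OF dm] B by auto
  have "bases (contract M {e}) = dfam (fst M - {e}) {B \<in> dfam (fst M) (bases M). e \<notin> B}"
    unfolding contract_def using dual_facts[OF delete_matroid[OF dm]] bd dual_facts[OF m] by simp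
  also have "\<dots> = {B - {e} |B. B \<in> bases M \<and> e \<in> B}"
  proof -
    have eq: "fst M - {e} - (fst M - B') = B' - {e}" if "B' \<in> bases M" for B' using sub[OF that] by auto
    have "e \<in> fst M" using B sub by auto
    show ?thesis
    proof (intro equalityI subsetI)
      fix X assume "X \<in> dfam (fst M - {e}) {B \<in> dfam (fst M) (bases M). e \<notin> B}"
      then obtain B' where "B' \<in> bases M" "e \<notin> fst M - B'" "X = fst M - {e} - (fst M - B')"
        by (auto simp: dfam_def)
      then show "X \<in> {B - {e} |B. B \<in> bases M \<and> e \<in> B}" using eq \<open>e \<in> fst M\<close> by blast
    next
      fix X assume "X \<in> {B - {e} |B. B \<in> bases M \<and> e \<in> B}"
      then obtain B' where "B' \<in> bases M" "e \<in> B'" "X = fst M - {e} - (fst M - B')" using eq by blast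
      then show "X \<in> dfam (fst M - {e}) {B \<in> dfam (fst M) (bases M). e \<notin> B}"
        unfolding dfam_def by blast
    qed
  qed
  finally show ?thesis .
qed

section \<open>Binary matroids\<close>

text \<open>The sum over GF(2) of the columns indexed by \<open>Y\<close>, given by its support, so
  that addition of vectors becomes the symmetric difference \<open>sdiff\<close>.\<close>

definition vsum :: "('a \<Rightarrow> nat \<Rightarrow> bool) \<Rightarrow> 'a set \<Rightarrow> nat set" where
  "vsum A Y = {i. odd (card {y\<in>Y. A y i})}"

definition matrix_indep :: "('a \<Rightarrow> nat \<Rightarrow> bool) \<Rightarrow> 'a set \<Rightarrow> 'a set set" where
  "matrix_indep A E = {X. X \<subseteq> E \<and> (\<forall>Y. Y \<subseteq> X \<and> Y \<noteq> {} \<longrightarrow> vsum A Y \<noteq> {})}"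

definition sdiff :: "'a set \<Rightarrow> 'a set \<Rightarrow> 'a set" where
  "sdiff X Y = (X - Y) \<union> (Y - X)"

lemma vsum_sdiff:
  assumes "finite X" "finite Y"
  shows "vsum A (sdiff X Y) = sdiff (vsum A X) (vsum A Y)"
proof -
  have "odd (card {y \<in> sdiff X Y. A y i}) \<longleftrightarrow> odd (card {y\<in>X. A y i}) \<noteq> odd (card {y\<in>Y. A y i})" for i
  proof -
    let ?P = "{y\<in>X. A y i}" and ?Q = "{y\<in>Y. A y i}"
    have f: "finite ?P" "finite ?Q" using assms by auto
    have "{y \<in> sdiff X Y. A y i} = (?P - ?Q) \<union> (?Q - ?P)" by (auto simp: sdiff_def)
    moreover have "card ((?P - ?Q) \<union> (?Q - ?P)) = card (?P - ?Q) + card (?Q - ?P)"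
      using f by (intro card_Un_disjoint) auto
    moreover have "card ?P = card (?P - ?Q) + card (?P \<inter> ?Q)"
      using card_Int_Diff[OF f(1), of ?Q] by simp
    moreover have "card ?Q = card (?Q - ?P) + card (?P \<inter> ?Q)"
      using card_Int_Diff[OF f(2), of ?P] by (simp add: Int_commute)
    ultimately show ?thesis by presburger
  qed
  then show ?thesis unfolding vsum_def sdiff_def by auto
qed

text \<open>Two subsets with the same sum differ by a set of sum zero. In this form independence can
  be counted, which is how augmentation is proved.\<close>

lemma matrix_indep_inj:
  assumes "finite E"
  shows "X \<in> matrix_indep A E \<longleftrightarrow> X \<subseteq> E \<and> inj_on (vsum A) (Pow X)"
proof (cases "X \<subseteq> E")
  case True
  have f: "finite X" using True assms finite_subset by blast
  have e: "vsum A {} = {}" by (simp add: vsum_def)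
  show ?thesis
  proof
    assume X: "X \<in> matrix_indep A E"
    have "Y = Z" if yz: "Y \<subseteq> X" "Z \<subseteq> X" "vsum A Y = vsum A Z" for Y Z
    proof (rule ccontr)
      assume "Y \<noteq> Z"
      then have "sdiff Y Z \<noteq> {}" by (auto simp: sdiff_def)
      moreover have "sdiff Y Z \<subseteq> X" using yz by (auto simp: sdiff_def)
      ultimately have "vsum A (sdiff Y Z) \<noteq> {}" using X by (auto simp: matrix_indep_def)
      moreover have "vsum A (sdiff Y Z) = sdiff (vsum A Y) (vsum A Z)"
        using yz f finite_subset by (intro vsum_sdiff) blast+
      ultimately show False using yz by (auto simp: sdiff_def)
    qed
    then show "X \<subseteq> E \<and> inj_on (vsum A) (Pow X)" using True by (auto simp: inj_on_def)
  next
    assume X: "X \<subseteq> E \<and> inj_on (vsum A) (Pow X)"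
    have "vsum A Y \<noteq> {}" if "Y \<subseteq> X" "Y \<noteq> {}" for Y
    proof
      assume "vsum A Y = {}"
      then have "vsum A Y = vsum A {}" using e by simp
      then show False using X that by (metis PowI empty_subsetI inj_on_def)
    qed
    then show "X \<in> matrix_indep A E" using True by (auto simp: matrix_indep_def)
  qed
qed (auto simp: matrix_indep_def)

text \<open>If no element of \<open>J\<close> extends \<open>I\<close>, every column of
  \<open>J\<close>, hence every subset sum of \<open>J\<close>, is a subset sum of \<open>I\<close>.
  The sums of \<open>J\<close> are distinct, so \<open>2 ^ card J\<close> is at most
  \<open>2 ^ card I\<close>.\<close>

lemma matrix_indep_matroid:
  assumes fE: "finite E"
  shows "matroid (E, matrix_indep A E)"
  unfolding matroid_def fst_conv snd_conv
proof (intro conjI ballI allI impI)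
  show "finite E" by fact
  show "\<And>I. I \<in> matrix_indep A E \<Longrightarrow> I \<subseteq> E" "{} \<in> matrix_indep A E" by (auto simp: matrix_indep_def)
  show "\<And>I J. J \<in> matrix_indep A E \<and> I \<subseteq> J \<Longrightarrow> I \<in> matrix_indep A E" unfolding matrix_indep_def by blast
  fix I J assume a: "I \<in> matrix_indep A E \<and> J \<in> matrix_indep A E \<and> card I < card J"
  have fI: "finite I" "finite J" using a fE finite_subset unfolding matrix_indep_def by blast+
  show "\<exists>e\<in>J - I. insert e I \<in> matrix_indep A E"
  proof (rule ccontr)
    assume n: "\<not> ?thesis"
    let ?sp = "vsum A ` Pow I"
    have one: "vsum A {e} \<in> ?sp" if e: "e \<in> J" for e
    proof (cases "e \<in> I")
      case False
      then have "insert e I \<notin> matrix_indep A E" using n e by blast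
      moreover have "insert e I \<subseteq> E" using a e unfolding matrix_indep_def by blast
      ultimately obtain Y where Y: "Y \<subseteq> insert e I" "Y \<noteq> {}" "vsum A Y = {}" unfolding matrix_indep_def by blast
      have "e \<in> Y" using Y a unfolding matrix_indep_def by blast
      then have "Y = sdiff {e} (Y - {e})" by (auto simp: sdiff_def)
      moreover have "finite (Y - {e})" using Y fI finite_subset by blast
      ultimately have "sdiff (vsum A {e}) (vsum A (Y - {e})) = {}" using vsum_sdiff[of "{e}" "Y - {e}" A] Y by simp
      then have "vsum A {e} = vsum A (Y - {e})" by (auto simp: sdiff_def)
      moreover have "Y - {e} \<in> Pow I" using Y by blast
      ultimately show ?thesis by blast
    qed blast
    have all: "vsum A Y \<in> ?sp" if "Y \<subseteq> J" for Y
    proof -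
      have "finite Y" using that fI finite_subset by blast
      then show ?thesis using that
      proof induction
        case empty then show ?case by blast
      next
        case (insert y F)
        obtain P Q where p: "P \<subseteq> I" "vsum A F = vsum A P" "Q \<subseteq> I" "vsum A {y} = vsum A Q"
          using insert one[of y] by auto
        have fp: "finite P" "finite Q" using p fI finite_subset by blast+
        have "insert y F = sdiff {y} F" using insert by (auto simp: sdiff_def)
        then have "vsum A (insert y F) = sdiff (vsum A Q) (vsum A P)" using p insert vsum_sdiff[of "{y}" F A] by simp
        also have "\<dots> = vsum A (sdiff Q P)" using fp by (simp add: vsum_sdiff)
        finally show ?case using p by (auto simp: sdiff_def)
      qed
    qed
    have "card (Pow J) = card (vsum A ` Pow J)"
      using a matrix_indep_inj[OF fE, of J A] by (simp add: card_image)
    also have "\<dots> \<le> card ?sp" using all fI by (intro card_mono) auto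
    also have "\<dots> \<le> card (Pow I)" using fI by (intro card_image_le) auto
    finally have "2 ^ card J \<le> (2::nat) ^ card I" using fI by (simp add: card_Pow)
    then show False using a by simp
  qed
qed

text \<open>By rank, \<open>S + a + b + c\<close> and \<open>S + a + b + d\<close> are dependent,
  and their zero sums use all of \<open>a, b, c\<close> and all of \<open>a, b, d\<close>. Over
  GF(2) adding both cancels \<open>a\<close> and \<open>b\<close>, leaving a nonempty zero sum
  inside the base \<open>S + c + d\<close>.\<close>

lemma matrix_indep_no_wit:
  assumes fE: "finite E"
  shows "\<not> wit (bases (E, matrix_indep A E)) S T"
proof
  let ?M = "(E, matrix_indep A E)"
  assume w: "wit (bases ?M) S T"
  have m: "matroid ?M" by (rule matrix_indep_matroid[OF fE])
  interpret base_family E "bases ?M" using matroid_base_family[OF m] by simp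
  obtain a b c d where t: "T = {a,b,c,d}" "distinct [a,b,c,d]"
    using w card4E unfolding wit_def by metis
  have st: "S \<inter> T = {}" using w unfolding wit_def by blast
  have ind: "insert x (insert y S) \<in> matrix_indep A E" if "x \<in> T" "y \<in> T" "x \<noteq> y" for x y
    using basesD(1)[OF witD[OF w that]] by simp
  have cf: "card S + 2 = rk" "finite S" using wit_card[OF w] by auto
  have ex: "\<exists>Y. Y \<subseteq> insert a (insert b (insert x S)) \<and> a \<in> Y \<and> b \<in> Y \<and> x \<in> Y \<and> vsum A Y = {}"
    if x: "x \<in> {c,d}" for x
  proof -
    let ?X = "insert a (insert b (insert x S))"
    have "card ?X = card S + 3" using x t st cf by auto
    then have "?X \<notin> snd ?M" using bases_card_eq(1)[OF m, of ?X] cardB cf ne by fastforce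
    moreover have "?X \<subseteq> E" using wit_sub[OF w] t x by auto
    ultimately obtain Y where Y: "Y \<subseteq> ?X" "Y \<noteq> {}" "vsum A Y = {}" unfolding matrix_indep_def by auto
    have i: "insert a (insert b S) \<in> matrix_indep A E" "insert a (insert x S) \<in> matrix_indep A E" "insert b (insert x S) \<in> matrix_indep A E"
      using ind t x by auto
    have "x \<in> Y" using i(1) Y unfolding matrix_indep_def by blast
    moreover have "b \<in> Y" using i(2) Y unfolding matrix_indep_def by blast
    moreover have "a \<in> Y" using i(3) Y unfolding matrix_indep_def by blast
    ultimately show ?thesis using Y by blast
  qed
  obtain Y where Y: "Y \<subseteq> insert a (insert b (insert c S))" "a \<in> Y" "b \<in> Y" "c \<in> Y" "vsum A Y = {}"
    using ex[of c] by auto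
  obtain Z where Z: "Z \<subseteq> insert a (insert b (insert d S))" "a \<in> Z" "b \<in> Z" "d \<in> Z" "vsum A Z = {}"
    using ex[of d] by auto
  have "finite Y" "finite Z" using Y Z cf finite_subset by (metis finite_insert)+
  then have "vsum A (sdiff Y Z) = {}" using Y Z by (simp add: vsum_sdiff) (simp add: sdiff_def)
  moreover have "sdiff Y Z \<subseteq> insert c (insert d S)" using Y Z by (auto simp: sdiff_def)
  moreover have "c \<in> sdiff Y Z" using Y Z t st by (auto simp: sdiff_def)
  moreover have "insert c (insert d S) \<in> matrix_indep A E" using ind t by auto
  ultimately show False unfolding matrix_indep_def by blast
qed

text \<open>Equality of the two families within distance one of \<open>B\<close>, that is, equality
  of all fundamental circuits with respect to \<open>B\<close>.\<close>

definition agree :: "'a set \<Rightarrow> 'a set set \<Rightarrow> 'a set set \<Rightarrow> 'a set \<Rightarrow> bool" where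
  "agree E \<B> \<N> B \<longleftrightarrow> B \<in> \<B> \<and> B \<in> \<N> \<and>
    (\<forall>b\<in>B. \<forall>y\<in>E - B. insert y (B - {b}) \<in> \<B> \<longleftrightarrow> insert y (B - {b}) \<in> \<N>)"

lemma agree_sym: "agree E \<B> \<N> B \<longleftrightarrow> agree E \<N> \<B> B"
  unfolding agree_def by blast

lemma card_diff_eq: "finite X \<Longrightarrow> finite Y \<Longrightarrow> card X = card Y \<Longrightarrow> card (X - Y) = card (Y - X)"
  by (metis add_right_cancel card_Diff_subset_Int Int_commute finite_Int)

text \<open>Write \<open>B = S + u + v\<close> and \<open>X = S + p + q\<close>. If \<open>X\<close>
  were not in \<open>\<N>\<close>, then \<open>p\<close> and \<open>q\<close> would pair with the
  same points among \<open>u, v\<close> in \<open>\<N>\<close>, whereas exchange in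
  \<open>\<B>\<close> gives each of \<open>p, q, u, v\<close> a partner on the other side. Both
  families agree on these four pairs, so all four are bases and \<open>u, v, p, q\<close> is a
  four-point line of \<open>\<B>\<close>.\<close>

lemma agree_distance_two:
  assumes "base_family E \<B>" "base_family E \<N>" and nw: "\<And>S T. \<not> wit \<B> S T"
    and ag: "agree E \<B> \<N> B" and X: "X \<in> \<B>" "card (X - B) \<le> 2"
  shows "X \<in> \<N>"
proof -
  interpret b: base_family E \<B> by fact
  interpret n: base_family E \<N> by fact
  have B: "B \<in> \<B>" "B \<in> \<N>" using ag unfolding agree_def by auto
  have f: "finite X" "finite B" "card X = card B" using b.finB X B b.cardB by auto
  have c: "card (X - B) = card (B - X)" using card_diff_eq f by blast
  consider "card (X - B) = 0" | "card (X - B) = 1" | "card (X - B) = 2" using X(2) by linarith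
  then show ?thesis
  proof cases
    case 1
    then have "X \<subseteq> B" using f by simp
    then show ?thesis using b.base_subset_eq X B by blast
  next
    case 2
    then obtain y where y: "X - B = {y}" using card_1_singletonE by blast
    obtain z where z: "B - X = {z}" using 2 c card_1_singletonE by metis
    have "X = insert y (B - {z})" using y z by auto
    moreover have "y \<in> E - B" "z \<in> B" using y z b.sub X by auto
    ultimately show ?thesis using ag X unfolding agree_def by blast
  next
    case 3
    obtain p q where cd: "X - B = {p,q}" "p \<noteq> q" using 3 card_2_iff by metis
    obtain u v where ab: "B - X = {u,v}" "u \<noteq> v" using 3 c card_2_iff by metis
    define S where "S = B \<inter> X"
    have Beq: "B = insert u (insert v S)" and Xeq: "X = insert p (insert q S)" using cd ab S_def by auto
    have ns: "u \<notin> S" "v \<notin> S" "p \<notin> S" "q \<notin> S" using S_def ab cd by auto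
    have dist: "distinct [u,v,p,q]" using ab cd by auto
    have cS: "card S + 2 = b.rk" using b.cardB[OF B(1)] f ns dist unfolding Beq by simp
    have cSn: "card S + 2 = n.rk" using n.cardB[OF B(2)] f ns dist unfolding Beq by simp
    have E: "p \<in> E - B" "q \<in> E - B" using cd X b.sub by auto
    have "B - {u} = insert v S" "B - {v} = insert u S" using Beq ns dist by auto
    then have n4: "insert p (insert v S) \<in> \<B> \<longleftrightarrow> insert p (insert v S) \<in> \<N>"
      "insert q (insert v S) \<in> \<B> \<longleftrightarrow> insert q (insert v S) \<in> \<N>"
      "insert p (insert u S) \<in> \<B> \<longleftrightarrow> insert p (insert u S) \<in> \<N>"
      "insert q (insert u S) \<in> \<B> \<longleftrightarrow> insert q (insert u S) \<in> \<N>"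
      using ag E Beq unfolding agree_def by (metis insertI1 insertI2)+
    have uv: "insert u (insert v S) \<in> \<B>" "insert v (insert u S) \<in> \<B>" using B Beq by (auto simp: insert_commute)
    have pq: "insert p (insert q S) \<in> \<B>" "insert q (insert p S) \<in> \<B>" using X Xeq by (auto simp: insert_commute)
    have sy: "insert x (insert y S) = insert y (insert x S)" for x y by auto
    show ?thesis
    proof (rule ccontr)
      assume "X \<notin> \<N>"
      then have npq: "insert p (insert q S) \<notin> \<N>" "insert q (insert p S) \<notin> \<N>" using Xeq sy by auto
      have L1: "insert p (insert v S) \<in> \<B>" if "insert p (insert u S) \<notin> \<B>"
        using b.line_exchange[OF cS uv(1) that pq(1)] .
      have L2: "insert p (insert u S) \<in> \<B>" if "insert p (insert v S) \<notin> \<B>"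
        using b.line_exchange[OF cS uv(2) that pq(1)] .
      have L3: "insert q (insert v S) \<in> \<B>" if "insert q (insert u S) \<notin> \<B>"
        using b.line_exchange[OF cS uv(1) that pq(2)] .
      have L4: "insert q (insert u S) \<in> \<B>" if "insert q (insert v S) \<notin> \<B>"
        using b.line_exchange[OF cS uv(2) that pq(2)] .
      have L5: "insert q (insert z S) \<in> \<B>" if "insert p (insert z S) \<notin> \<B>" "insert z (insert z' S) \<in> \<B>" for z z'
        using b.line_exchange[OF cS pq(1), of z z'] that sy by metis
      have L6: "insert p (insert z S) \<in> \<B>" if "insert q (insert z S) \<notin> \<B>" "insert z (insert z' S) \<in> \<B>" for z z'
        using b.line_exchange[OF cS pq(2), of z z'] that sy by metis
      have M1: "insert p (insert z' S) \<in> \<N>" if "insert p (insert z S) \<in> \<N>" "insert z' (insert q S) \<in> \<N>" for z z'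
      proof (rule ccontr)
        assume "insert p (insert z' S) \<notin> \<N>"
        from n.line_exchange[OF cSn that(2) this that(1)] show False using npq by simp
      qed
      have M2: "insert q (insert z' S) \<in> \<N>" if "insert q (insert z S) \<in> \<N>" "insert z' (insert p S) \<in> \<N>" for z z'
      proof (rule ccontr)
        assume "insert q (insert z' S) \<notin> \<N>"
        from n.line_exchange[OF cSn that(2) this that(1)] show False using npq by simp
      qed
      have "insert p (insert u S) \<in> \<N>" using n4 L1 L5[of u v] M1[of v u] uv sy by metis
      moreover have "insert p (insert v S) \<in> \<N>" using n4 L2 L5[of v u] M1[of u v] uv sy by metis
      moreover have "insert q (insert u S) \<in> \<N>" using n4 L3 L6[of u v] M2[of v u] uv sy by metis
      moreover have "insert q (insert v S) \<in> \<N>" using n4 L4 L6[of v u] M2[of u v] uv sy by metis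
      ultimately have "wit \<B> S {u,v,p,q}" using n4 uv pq dist ns sy
        by (intro witI) auto
      then show False using nw by blast
    qed
  qed
qed

text \<open>Move \<open>B\<close> by one exchange towards \<open>X\<close>. The neighbours of the
  new base are within distance two of the old one, so the families agree around the new base as
  well.\<close>

lemma agree_everywhere:
  assumes "base_family E \<B>" "base_family E \<N>" "\<And>S T. \<not> wit \<B> S T" "\<And>S T. \<not> wit \<N> S T"
    and "agree E \<B> \<N> B"
  shows "X \<in> \<B> \<longleftrightarrow> X \<in> \<N>"
  using assms
proof (induction "card (X - B)" arbitrary: B \<B> \<N> rule: less_induct)
  case less
  have main: "X \<in> \<N>" if fam: "base_family E \<B>" "base_family E \<N>" "\<And>S T. \<not> wit \<B> S T" "\<And>S T. \<not> wit \<N> S T"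
      "agree E \<B> \<N> B" "X \<in> \<B>" for \<B> \<N>
  proof (cases "card (X - B) \<le> 2")
    case True
    then show ?thesis using agree_distance_two fam by blast
  next
    case False
    interpret b: base_family E \<B> by fact
    interpret n: base_family E \<N> by fact
    have B: "B \<in> \<B>" "B \<in> \<N>" using fam(5) unfolding agree_def by auto
    have f: "finite X" "finite B" using b.finB fam B by auto
    have "X - B \<noteq> {}" using False by (metis card.empty zero_le)
    then obtain y where y: "y \<in> X - B" by blast
    obtain u where u: "u \<in> B - X" "insert y (B - {u}) \<in> \<B>" using b.exch_dual[OF B(1) fam(6) y] by blast
    let ?B = "insert y (B - {u})"
    have yE: "y \<in> E - B" using y fam(6) b.sub by blast
    have "?B \<in> \<N>" using u fam(5) yE unfolding agree_def by blast
    have d2: "Z \<in> \<B> \<longleftrightarrow> Z \<in> \<N>" if "card (Z - B) \<le> 2" for Z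
      using agree_distance_two[OF fam(1,2,3,5) _ that] agree_distance_two[OF fam(2,1,4) _ _ that] fam(5) agree_sym by blast
    have ag: "agree E \<B> \<N> ?B"
      unfolding agree_def
    proof (intro conjI ballI)
      show "?B \<in> \<B>" "?B \<in> \<N>" by fact+
      fix w z assume "w \<in> ?B" "z \<in> E - ?B"
      have "insert z (?B - {w}) - B \<subseteq> {y,z}" by auto
      then have "card (insert z (?B - {w}) - B) \<le> card {y,z}" by (intro card_mono) auto
      also have "\<dots> \<le> 2" by (simp add: card_insert_if)
      finally show "insert z (?B - {w}) \<in> \<B> \<longleftrightarrow> insert z (?B - {w}) \<in> \<N>" using d2 by blast
    qed
    have "X - ?B = (X - B) - {y}" using u by auto
    then have "card (X - ?B) < card (X - B)" using y f by (metis card_Diff1_less finite_Diff)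
    then have "X \<in> \<B> \<longleftrightarrow> X \<in> \<N>" using less.hyps[OF _ fam(1-4) ag] by blast
    then show ?thesis using fam by blast
  qed
  show ?case using main[OF less.prems] main[OF less.prems(2,1,4,3)] less.prems(5) agree_sym by blast
qed

lemma binary_iff_matrix_indep: "binary M \<longleftrightarrow> matroid M \<and> (\<exists>A. snd M = matrix_indep A (fst M))"
proof -
  have gen: "(\<forall>X. X \<subseteq> E \<longrightarrow> (X \<in> \<I> \<longleftrightarrow> Q X)) \<longleftrightarrow> \<I> = {X. X \<subseteq> E \<and> Q X}"
    if "\<And>X. X \<in> \<I> \<Longrightarrow> X \<subseteq> E" for E :: "'a set" and \<I> Q using that by (auto; blast)
  have v: "vsum A Y \<noteq> {} \<longleftrightarrow> (\<exists>i. odd (card {y\<in>Y. A y i}))" for A and Y :: "'a set"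
    by (auto simp: vsum_def)
  show ?thesis
  proof (cases "matroid M")
    case True
    have "(\<forall>X. X \<subseteq> fst M \<longrightarrow> (X \<in> snd M \<longleftrightarrow> Q X)) \<longleftrightarrow> snd M = {X. X \<subseteq> fst M \<and> Q X}" for Q
      using matroidD(2)[OF True] by (intro gen) auto
    then show ?thesis unfolding binary_def matrix_indep_def v by (simp only: True simp_thms)
  qed (simp add: binary_def)
qed

lemma fundamental_family:
  assumes "base_family E \<B>" and B: "B \<in> \<B>"
  obtains A where "agree E \<B> (bases (E, matrix_indep A E)) B"
proof -
  interpret base_family E \<B> by fact
  have fB: "finite B" "B \<subseteq> E" using finB sub B by auto
  obtain j :: "'a \<Rightarrow> nat" where j: "inj_on j B" using finite_imp_inj_to_nat_seg[OF fB(1)] by blast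
  \<comment> \<open>The rows are the elements of \<open>B\<close>, numbered by \<open>j\<close>.
    Columns in \<open>B\<close> are unit vectors; the column of any other \<open>y\<close> marks its
    fundamental circuit.\<close>
  define A where "A y i \<longleftrightarrow> (\<exists>b\<in>B. j b = i \<and> (if y \<in> B then y = b else insert y (B - {b}) \<in> \<B>))" for y i
  have Aj: "A y (j b) \<longleftrightarrow> (if y \<in> B then y = b else insert y (B - {b}) \<in> \<B>)" if "b \<in> B" for y b
    unfolding A_def using j that by (auto simp: inj_on_def)
  have m: "matroid (E, matrix_indep A E)" by (rule matrix_indep_matroid[OF fin])
  have odd1: "vsum A Y \<noteq> {}" if "b \<in> B" "{y\<in>Y. A y (j b)} = {z}" for Y b z
    using that unfolding vsum_def by (auto intro!: exI[of _ "j b"])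
  have indB: "B \<in> matrix_indep A E"
  proof -
    have "vsum A Y \<noteq> {}" if Y: "Y \<subseteq> B" "Y \<noteq> {}" for Y
    proof -
      obtain b where b: "b \<in> Y" using Y by blast
      have "b \<in> B" using b Y by blast
      then have "A y (j b) \<longleftrightarrow> y = b" if "y \<in> Y" for y using Aj[of b y] Y that by auto
      then have "{y\<in>Y. A y (j b)} = {b}" using b by blast
      then show ?thesis using odd1 b Y by blast
    qed
    then show ?thesis using fB by (auto simp: matrix_indep_def)
  qed
  \<comment> \<open>The column of \<open>y\<close> is the sum of the unit columns that it marks, so
    each row has either two ones or none.\<close>
  have dep: "vsum A (insert y {b\<in>B. A y (j b)}) = {}" if y: "y \<in> E - B" for y
  proof -
    have "even (card {x \<in> insert y {b\<in>B. A y (j b)}. A x i})" for i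
    proof (cases "A y i")
      case True
      then obtain b where b: "b \<in> B" "j b = i" by (auto simp: A_def)
      have "A x i \<longleftrightarrow> x = b" if "x \<in> B" for x using Aj[OF b(1), of x] b(2) that by auto
      then have "{x \<in> insert y {b\<in>B. A y (j b)}. A x i} = {y, b}"
        using b True by auto
      then show ?thesis using b y by (auto simp: card_insert_if)
    next
      case False
      have "\<not> A x i" if "x \<in> B" "A y (j x)" for x
        using that False unfolding A_def by (metis (no_types, lifting))
      then have "{x \<in> insert y {b\<in>B. A y (j b)}. A x i} = {}"
        using False by auto
      then show ?thesis by (simp only: card.empty even_zero)
    qed
    then show ?thesis by (auto simp: vsum_def)
  qed
  have Bbase: "B \<in> bases (E, matrix_indep A E)"
    unfolding bases_def
  proof (intro CollectI conjI ballI impI)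
    show "B \<in> snd (E, matrix_indep A E)" using indB by simp
    fix I assume I: "I \<in> snd (E, matrix_indep A E)" "B \<subseteq> I"
    have "y \<in> B" if y: "y \<in> I" for y
    proof (rule ccontr)
      assume "y \<notin> B"
      then have "vsum A (insert y {b\<in>B. A y (j b)}) = {}" using dep y I by (auto simp: matrix_indep_def)
      moreover have "insert y {b\<in>B. A y (j b)} \<subseteq> I" using I y by auto
      ultimately show False using I unfolding matrix_indep_def by auto
    qed
    then show "I = B" using I by blast
  qed
  have "agree E \<B> (bases (E, matrix_indep A E)) B"
    unfolding agree_def
  proof (intro conjI ballI B Bbase)
    fix b y assume bh: "b \<in> B" "y \<in> E - B"
    let ?X = "insert y (B - {b})"
    have c: "card ?X = card B" using bh fB
      by (metis DiffD2 card.remove card_insert_disjoint finite_Diff insert_Diff insert_iff)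
    have "?X \<in> matrix_indep A E \<longleftrightarrow> A y (j b)"
    proof
      assume X: "?X \<in> matrix_indep A E"
      show "A y (j b)"
      proof (rule ccontr)
        assume "\<not> A y (j b)"
        then have "insert y {b\<in>B. A y (j b)} \<subseteq> ?X" by auto
        then show False using X dep[OF bh(2)] unfolding matrix_indep_def by blast
      qed
    next
      assume Ay: "A y (j b)"
      have "vsum A Y \<noteq> {}" if Y: "Y \<subseteq> ?X" "Y \<noteq> {}" for Y
      proof (cases "y \<in> Y")
        case True
        have "A x (j b) \<longleftrightarrow> x = y" if "x \<in> Y" for x using Aj[OF bh(1), of x] Ay Y that bh by auto
        then have "{x\<in>Y. A x (j b)} = {y}" using True by blast
        then show ?thesis using odd1 bh(1) by blast
      next
        case False
        then have "Y \<subseteq> B" using Y by auto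
        then show ?thesis using indB Y unfolding matrix_indep_def by blast
      qed
      then show "?X \<in> matrix_indep A E" using bh fB by (auto simp: matrix_indep_def)
    qed
    moreover have "?X \<in> bases (E, matrix_indep A E) \<longleftrightarrow> ?X \<in> matrix_indep A E"
      using bases_card_eq(2)[OF m _ Bbase, of ?X] c basesD(1)[of ?X "(E, matrix_indep A E)"] by auto
    moreover have "A y (j b) \<longleftrightarrow> ?X \<in> \<B>" using Aj[OF bh(1), of y] bh by auto
    ultimately show "?X \<in> \<B> \<longleftrightarrow> ?X \<in> bases (E, matrix_indep A E)" by blast
  qed
  then show thesis by (rule that)
qed

text \<open>Tutte's characterization of binary matroids. For the converse, the matrix of fundamental
  circuits for one base gives a family without four-point lines that agrees with \<open>M\<close>
  around this base, hence everywhere.\<close>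

lemma binary_iff_no_wit:
  assumes m: "matroid M"
  shows "binary M \<longleftrightarrow> (\<forall>S T. \<not> wit (bases M) S T)"
proof
  assume "binary M"
  then obtain A where A: "snd M = matrix_indep A (fst M)" using binary_iff_matrix_indep by blast
  then have "M = (fst M, matrix_indep A (fst M))" by (metis prod.collapse)
  then show "\<forall>S T. \<not> wit (bases M) S T" using matrix_indep_no_wit[OF matroidD(1)[OF m]] by metis
next
  assume nw: "\<forall>S T. \<not> wit (bases M) S T"
  interpret base_family "fst M" "bases M" by (rule matroid_base_family[OF m])
  obtain B where B: "B \<in> bases M" using ne by blast
  obtain A where A: "agree (fst M) (bases M) (bases (fst M, matrix_indep A (fst M))) B"
    using fundamental_family[OF matroid_base_family[OF m] B] by blast
  let ?N = "(fst M, matrix_indep A (fst M))"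
  have mN: "matroid ?N" by (rule matrix_indep_matroid[OF fin])
  have bN: "base_family (fst M) (bases ?N)" using matroid_base_family[OF mN] by simp
  have "bases M = bases ?N"
    using agree_everywhere[OF matroid_base_family[OF m] bN _ _ A] nw matrix_indep_no_wit[OF fin] by blast
  then have "snd M = matrix_indep A (fst M)"
    using matroid_of_bases[OF m] matroid_of_bases[OF mN] by (metis fst_conv snd_conv)
  then show "binary M" using binary_iff_matrix_indep m by blast
qed

section \<open>Relaxations of binary matroids\<close>

lemma rank_eqI:
  assumes m: "matroid M" and I: "I \<in> snd M" "I \<subseteq> X" and le: "\<And>J. J \<in> snd M \<Longrightarrow> J \<subseteq> X \<Longrightarrow> card J \<le> card I"
  shows "rank M X = card I"
  unfolding rank_def
proof (rule Max_eqI)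
  have "{card I |I. I \<in> snd M \<and> I \<subseteq> X} \<subseteq> card ` Pow (fst M)" using matroidD(2)[OF m] by auto
  then show "finite {card I |I. I \<in> snd M \<and> I \<subseteq> X}"
    using matroidD(1)[OF m] finite_subset by blast
  show "\<And>y. y \<in> {card I |I. I \<in> snd M \<and> I \<subseteq> X} \<Longrightarrow> y \<le> card I" using le by auto
  show "card I \<in> {card I |I. I \<in> snd M \<and> I \<subseteq> X}" using I by blast
qed

lemma rank_witness:
  assumes m: "matroid M"
  obtains I where "I \<in> snd M" "I \<subseteq> X" "rank M X = card I" "\<And>J. J \<in> snd M \<Longrightarrow> J \<subseteq> X \<Longrightarrow> card J \<le> card I"
proof -
  let ?C = "{card I |I. I \<in> snd M \<and> I \<subseteq> X}"
  have "?C \<subseteq> card ` Pow (fst M)" using matroidD(2)[OF m] by auto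
  then have f: "finite ?C" using matroidD(1)[OF m] finite_subset by blast
  have "{} \<in> snd M \<and> {} \<subseteq> X" using matroidD(4)[OF m] by simp
  then have "?C \<noteq> {}" by blast
  then have "Max ?C \<in> ?C" using f by (intro Max_in)
  then obtain I where I: "I \<in> snd M" "I \<subseteq> X" "Max ?C = card I" by auto
  moreover have "card J \<le> card I" if "J \<in> snd M" "J \<subseteq> X" for J
    using Max_ge[OF f, of "card J"] that I(3) by auto
  ultimately show thesis using that unfolding rank_def by metis
qed

lemma rank_ge: 
  assumes m: "matroid M" and "J \<in> snd M" "J \<subseteq> X"
  shows "card J \<le> rank M X"
  using rank_witness[OF m, of X] assms(2,3) by metis

lemma rank_ground:
  assumes m: "matroid M" and B: "B \<in> bases M"
  shows "rank M (fst M) = card B"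
proof (rule rank_eqI[OF m])
  show "B \<in> snd M" using basesD(1)[OF B] .
  then show "B \<subseteq> fst M" using matroidD(2)[OF m] by blast
  show "\<And>J. J \<in> snd M \<Longrightarrow> J \<subseteq> fst M \<Longrightarrow> card J \<le> card B" using bases_card_eq(1)[OF m _ B] by blast
qed

text \<open>A circuit-hyperplane seen from the bases: a nonbasis all of whose neighbours are bases.
  Without elements on both sides there would be no neighbours and the condition would be
  vacuous.\<close>

definition tight_set :: "'a set \<Rightarrow> 'a set set \<Rightarrow> 'a set \<Rightarrow> bool" where
  "tight_set E \<B> H \<longleftrightarrow> H \<subseteq> E \<and> H \<noteq> {} \<and> E - H \<noteq> {} \<and> H \<notin> \<B> \<and>
     (\<forall>h\<in>H. \<forall>e\<in>E - H. insert e (H - {h}) \<in> \<B>)"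

text \<open>A circuit that is a hyperplane has as many elements as a base. An element
  \<open>e\<close> outside raises the rank, and only \<open>e\<close> can extend
  \<open>H - h\<close>, since adding \<open>h\<close> gives back the dependent set
  \<open>H\<close>.\<close>

lemma circuit_hyperplane_iff:
  assumes m: "matroid M"
  shows "circuit_hyperplane M H \<longleftrightarrow> tight_set (fst M) (bases M) H"
proof
  interpret base_family "fst M" "bases M" by (rule matroid_base_family[OF m])
  obtain B where B: "B \<in> bases M" using ne by blast
  {
    assume "circuit_hyperplane M H"
    then have c: "H \<subseteq> fst M" "H \<notin> snd M" "\<And>D. D \<subset> H \<Longrightarrow> D \<in> snd M"
      and fl: "\<And>e. e \<in> fst M - H \<Longrightarrow> rank M (insert e H) > rank M H"
      and r: "rank M H + 1 = rank M (fst M)"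
      unfolding circuit_hyperplane_def circuit_def hyperplane_def flat_def by auto
    have fH: "finite H" using c(1) fin finite_subset by blast
    have Hne: "H \<noteq> {}" using c(2) matroidD(4)[OF m] by auto
    have rH: "rank M H = card (H - {h})" if "h \<in> H" for h
    proof (rule rank_eqI[OF m])
      show "H - {h} \<in> snd M" "H - {h} \<subseteq> H" using c(3) that by auto
      fix J assume "J \<in> snd M" "J \<subseteq> H"
      then have "J \<subset> H" using c(2) by blast
      then have "card J < card H" using fH psubset_card_mono by blast
      then show "card J \<le> card (H - {h})" using that fH by simp
    qed
    have rk': "rank M (fst M) = rk" using rank_ground[OF m B] cardB[OF B] by simp
    have "insert e (H - {h}) \<in> bases M" if "h \<in> H" "e \<in> fst M - H" for h e
    proof -
      obtain I where I: "I \<in> snd M" "I \<subseteq> insert e H" "rank M (insert e H) = card I"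
        using rank_witness[OF m, of "insert e H"] by metis
      have "card (H - {h}) < card I" using fl[OF that(2)] rH[OF that(1)] I by simp
      moreover have "H - {h} \<in> snd M" using c(3) that by blast
      ultimately obtain x where x: "x \<in> I - (H - {h})" "insert x (H - {h}) \<in> snd M"
        using matroidD(6)[OF m] I(1) by blast
      have "x \<noteq> h" using x c(2) that by (metis insert_Diff)
      then have xe: "x = e" using x I by blast
      have "card (insert e (H - {h})) = card B"
        using rH[OF that(1)] r rk' cardB[OF B] fH that by simp
      then show ?thesis using bases_card_eq(2)[OF m _ B] x xe by blast
    qed
    moreover have "H \<notin> bases M" using c(2) basesD(1) by blast
    moreover have "fst M - H \<noteq> {}" using r c(1) by auto
    ultimately show "tight_set (fst M) (bases M) H" unfolding tight_set_def using c Hne by blast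
  }
  assume t: "tight_set (fst M) (bases M) H"
  then have H: "H \<subseteq> fst M" "H \<noteq> {}" "H \<notin> bases M" "\<And>h e. h \<in> H \<Longrightarrow> e \<in> fst M - H \<Longrightarrow> insert e (H - {h}) \<in> bases M"
    unfolding tight_set_def by auto
  obtain e where e: "e \<in> fst M - H" using t unfolding tight_set_def by blast
  have fH: "finite H" using H(1) fin finite_subset by blast
  have ind: "H - {h} \<in> snd M" if "h \<in> H" for h
    using matroidD(5)[OF m basesD(1)[OF H(4)[OF that e]], of "H - {h}"] by blast
  obtain h0 where h0: "h0 \<in> H" using H by blast
  have cH: "card H = rk" using cardB[OF H(4)[OF h0 e]] fH e h0
    by (metis DiffD2 card.remove card_insert_disjoint finite_Diff insert_Diff insert_iff)
  have dep: "H \<notin> snd M" using bases_card_eq(2)[OF m _ B, of H] cH cardB[OF B] H(3) by auto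
  have ci: "circuit M H" unfolding circuit_def
  proof (intro conjI allI impI)
    fix D assume "D \<subset> H"
    then obtain h where "h \<in> H" "D \<subseteq> H - {h}" by blast
    then show "D \<in> snd M" using matroidD(5)[OF m ind] by blast
  qed (use H dep in auto)
  have rH: "rank M H = card (H - {h0})"
  proof (rule rank_eqI[OF m ind[OF h0]])
    fix J assume "J \<in> snd M" "J \<subseteq> H"
    then have "J \<subset> H" using dep by blast
    then have "card J < card H" using fH psubset_card_mono by blast
    then show "card J \<le> card (H - {h0})" using h0 fH by simp
  qed blast
  have ck: "card (H - {h0}) + 1 = rk" using cH h0 fH by (metis Suc_eq_plus1 card_Suc_Diff1)
  have "hyperplane M H" unfolding hyperplane_def flat_def
  proof (intro conjI ballI)
    show "H \<subseteq> fst M" by fact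
    show "rank M H + 1 = rank M (fst M)" using rH ck rank_ground[OF m B] cardB[OF B] by simp
    fix x assume x: "x \<in> fst M - H"
    have "card (insert x (H - {h0})) \<le> rank M (insert x H)"
      using basesD(1)[OF H(4)[OF h0 x]] by (intro rank_ge[OF m]) auto
    then show "rank M H < rank M (insert x H)" using rH x fH by simp
  qed
  then show "circuit_hyperplane M H" using ci by (simp add: circuit_hyperplane_def)
qed

lemma through_base:
  assumes "base_family E \<B>" and w: "wit \<B> S T" and th: "through H S T" and H: "card H = base_family.rk \<B>"
  shows "\<exists>x\<in>T. \<exists>y\<in>T. x \<noteq> y \<and> H = insert x (insert y S)"
proof -
  interpret base_family E \<B> by fact
  have c: "card S + 2 = rk" "finite S" "finite T" using wit_card[OF w] by auto
  have "S \<subseteq> H" "H \<subseteq> S \<union> T" using th by (auto simp: through_def)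
  then have "card (H - S) = 2" using c H by (simp add: card_Diff_subset)
  then obtain x y where "H - S = {x,y}" "x \<noteq> y" using card_2_iff by metis
  moreover then have "x \<in> T" "y \<in> T" using \<open>H \<subseteq> S \<union> T\<close> by auto
  ultimately show ?thesis using \<open>S \<subseteq> H\<close> by blast
qed

lemma throughI: "x \<in> T \<Longrightarrow> y \<in> T \<Longrightarrow> H = insert x (insert y S) \<Longrightarrow> through H S T"
  by (auto simp: through_def)

lemma relax_tight:
  assumes m: "matroid M" and t: "tight_set (fst M) (bases M) H"
  shows "matroid (relax M {H})" "bases (relax M {H}) = insert H (bases M)" "fst (relax M {H}) = fst M"
proof -
  interpret base_family "fst M" "bases M" by (rule matroid_base_family[OF m])
  have "base_family (fst M) (insert H (bases M))"
    using t by (intro relaxing) (auto simp: tight_set_def)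
  from of_bases_matroid[OF this]
  show "matroid (relax M {H})" "bases (relax M {H}) = insert H (bases M)" by (auto simp: relax_def)
  show "fst (relax M {H}) = fst M" by (simp add: relax_def)
qed

lemma wit_mono: "wit \<B> S T \<Longrightarrow> \<B> \<subseteq> \<B>' \<Longrightarrow> wit \<B>' S T"
  unfolding wit_def by blast

lemma wit_relaxed:
  assumes "wit (\<B> \<union> \<H>) S T" "\<not> wit \<B> S T"
  obtains H where "H \<in> \<H>" "through H S T"
proof -
  obtain x y where "x \<in> T" "y \<in> T" "x \<noteq> y" "insert x (insert y S) \<notin> \<B>"
    using assms unfolding wit_def by blast
  moreover then have "insert x (insert y S) \<in> \<H>" using witD[OF assms(1)] by blast
  ultimately show thesis using that throughI by metis
qed

lemma in_R_matroid: "in_R M \<Longrightarrow> matroid M"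
  unfolding in_R_def using relax_tight(1) circuit_hyperplane_iff by (metis binary_def)

text \<open>A relaxation creates only lines that use the new base. Conversely, removing a free base
  that lies on every line destroys all lines, so the tightened matroid is binary and relaxing
  \<open>H\<close> restores \<open>M\<close>.\<close>

lemma in_R_iff_good:
  assumes m: "matroid M"
  shows "in_R M \<longleftrightarrow> good (fst M) (bases M)"
proof
  assume "in_R M"
  then consider "binary M" | M0 H where "binary M0" "circuit_hyperplane M0 H" "M = relax M0 {H}"
    unfolding in_R_def by blast
  then show "good (fst M) (bases M)"
  proof cases
    case 1 then show ?thesis using binary_iff_no_wit[OF m] by (simp add: good_def)
  next
    case 2
    have m0: "matroid M0" using 2 by (simp add: binary_def)
    have t: "tight_set (fst M0) (bases M0) H" using 2 circuit_hyperplane_iff[OF m0] by blast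
    have b: "bases M = insert H (bases M0)" "fst M = fst M0" using relax_tight[OF m0 t] 2 by auto
    have "free_base (fst M) (bases M) H" using t b by (auto simp: free_base_def tight_set_def)
    moreover have "through H S T" if w: "wit (bases M) S T" for S T
    proof -
      have "\<not> wit (bases M0) S T" using binary_iff_no_wit[OF m0] 2 by blast
      then show ?thesis using wit_relaxed[of "bases M0" "{H}" S T] w b by auto
    qed
    ultimately show ?thesis unfolding good_def by blast
  qed
next
  interpret base_family "fst M" "bases M" by (rule matroid_base_family[OF m])
  assume g: "good (fst M) (bases M)"
  show "in_R M"
  proof (cases "\<forall>S T. \<not> wit (bases M) S T")
    case True then show ?thesis using binary_iff_no_wit[OF m] by (simp add: in_R_def)
  next
    case False
    then obtain H S T where H: "free_base (fst M) (bases M) H" "\<And>S T. wit (bases M) S T \<Longrightarrow> through H S T"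
      and w: "wit (bases M) S T" using g unfolding good_def by blast
    have HB: "H \<in> bases M" using H by (simp add: free_base_def)
    have ch: "card H = rk" using cardB[OF HB] .
    obtain x y where xy: "x \<in> T" "y \<in> T" "x \<noteq> y" "H = insert x (insert y S)"
      using through_base[OF matroid_base_family[OF m] w H(2)[OF w] ch] by blast
    have "card T = 4" "S \<inter> T = {}" using w by (auto simp: wit_def)
    then have "\<not> T \<subseteq> {x,y}" using card_mono[of "{x,y}" T] xy by auto
    \<comment> \<open>A third point of the line supplies a base other than \<open>H\<close> and an
      element outside \<open>H\<close>, so that tightening leaves a base and \<open>H\<close> has a
      nonempty complement.\<close>
    then obtain z where z: "z \<in> T" "z \<noteq> x" "z \<noteq> y" by blast
    have zH: "z \<notin> H" using z xy \<open>S \<inter> T = {}\<close> by auto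
    have "insert z (insert y S) \<in> bases M" using witD[OF w] z xy by blast
    moreover have "insert z (insert y S) \<noteq> H" using zH by auto
    ultimately have "bases M - {H} \<noteq> {}" by blast
    then have f0: "base_family (fst M) (bases M - {H})" using tighten H by blast
    let ?M0 = "of_bases (fst M) (bases M - {H})"
    have m0: "matroid ?M0" "bases ?M0 = bases M - {H}" "fst ?M0 = fst M" using of_bases_matroid[OF f0] by auto
    have "\<not> wit (bases M - {H}) S T" for S T
    proof
      assume w': "wit (bases M - {H}) S T"
      have w: "wit (bases M) S T" by (rule wit_mono[OF w']) blast
      obtain x y where "x \<in> T" "y \<in> T" "x \<noteq> y" "H = insert x (insert y S)"
        using through_base[OF matroid_base_family[OF m] w H(2)[OF w] ch] by blast
      then show False using witD[OF w', of x y] by auto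
    qed
    then have bin: "binary ?M0" using binary_iff_no_wit[OF m0(1)] m0(2) by simp
    have "insert e (H - {h}) \<noteq> H" if "e \<in> fst M - H" for e h using that by auto
    then have "tight_set (fst ?M0) (bases ?M0) H"
      using H(1) xy zH z wit_sub[OF w] sub[OF HB] unfolding m0 tight_set_def free_base_def by auto
    then have ch: "circuit_hyperplane ?M0 H" using circuit_hyperplane_iff[OF m0(1)] by blast
    have "insert H (bases M - {H}) = bases M" using HB by blast
    then have "relax ?M0 {H} = M" unfolding relax_def m0 using matroid_of_bases[OF m] by simp
    then show ?thesis unfolding in_R_def using bin ch by metis
  qed
qed

section \<open>Closure of the class under duality and minors\<close>

lemma in_R_dual: "in_R M \<Longrightarrow> in_R (dual M)"
proof -
  assume r: "in_R M"
  have m: "matroid M" using in_R_matroid[OF r] .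
  interpret base_family "fst M" "bases M" by (rule matroid_base_family[OF m])
  show ?thesis using r good_dual dual_facts[OF m] in_R_iff_good[OF m] in_R_iff_good[of "dual M"] by simp
qed

text \<open>A line of the contraction lifts to one with \<open>e\<close> in \<open>S\<close>. If
  \<open>e\<close> is in \<open>H\<close>, then \<open>H - e\<close> inherits freeness and the
  lines; if not, no line can lift, because \<open>S\<close> would have to lie in
  \<open>H\<close>.\<close>

lemma good_contract_element:
  assumes g: "good E \<B>" and e: "e \<in> E"
  shows "good (E - {e}) {B - {e} |B. B \<in> \<B> \<and> e \<in> B}"
proof -
  let ?C = "{B - {e} |B. B \<in> \<B> \<and> e \<in> B}"
  have mem: "X \<in> ?C \<longleftrightarrow> e \<notin> X \<and> insert e X \<in> \<B>" for X
  proof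
    assume "e \<notin> X \<and> insert e X \<in> \<B>"
    then show "X \<in> ?C" by (auto intro!: exI[of _ "insert e X"])
  qed (auto simp: insert_absorb)
  have wc: "wit \<B> (insert e S) T \<and> e \<notin> S \<and> e \<notin> T" if w: "wit ?C S T" for S T
  proof -
    obtain a b c d where t: "T = {a,b,c,d}" "distinct [a,b,c,d]" using w card4E unfolding wit_def by metis
    have m: "e \<notin> insert x (insert y S) \<and> insert e (insert x (insert y S)) \<in> \<B>" if "x \<in> T" "y \<in> T" "x \<noteq> y" for x y
      using witD[OF w that] unfolding mem .
    have "e \<notin> S" "e \<notin> T" using m[of a b] m[of c d] t by auto
    moreover have "wit \<B> (insert e S) T" unfolding wit_def
      using w m \<open>e \<notin> T\<close> by (auto simp: wit_def insert_commute)
    ultimately show ?thesis by blast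
  qed
  consider "\<forall>S T. \<not> wit \<B> S T" | H where "free_base E \<B> H" "\<forall>S T. wit \<B> S T \<longrightarrow> through H S T"
    using g unfolding good_def by blast
  then show ?thesis
  proof cases
    case 1 then show ?thesis using wc unfolding good_def by blast
  next
    case 2
    show ?thesis
    proof (cases "e \<in> H")
      case True
      have "insert e (insert f (H - {e} - {h})) = insert f (H - {h})" if "h \<in> H - {e}" for f h
        using True that by auto
      then have "free_base (E - {e}) ?C (H - {e})"
        using 2(1) True unfolding free_base_def mem by (auto simp: insert_absorb)
      moreover have "through (H - {e}) S T" if w: "wit ?C S T" for S T
        using 2(2) wc[OF w] by (auto simp: through_def)
      ultimately show ?thesis unfolding good_def by blast
    next
      case False
      have "\<not> wit ?C S T" for S T using 2(2) wc[of S T] False by (auto simp: through_def)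
      then show ?thesis unfolding good_def by blast
    qed
  qed
qed

text \<open>Contraction of a nonloop comes directly; deletion follows from it by duality, except for
  a coloop, whose deletion has the bases of its contraction. Contraction of any element, loops
  included, is then dual to deletion.\<close>

lemma in_R_contract_element:
  assumes r: "in_R M" and e: "e \<in> fst M"
  shows "in_R (contract M {e})" "in_R (delete M {e})"
proof -
  have con: "in_R (contract M {e})" if r: "in_R M" and e: "e \<in> fst M" and nl: "\<exists>B\<in>bases M. e \<in> B" for M
  proof -
    have m: "matroid M" using in_R_matroid[OF r] .
    obtain B where B: "B \<in> bases M" "e \<in> B" using nl by blast
    have "good (fst M) (bases M)" using in_R_iff_good[OF m] r by simp
    from good_contract_element[OF this e] show ?thesis
      unfolding in_R_iff_good[OF contract_matroid[OF m]] contract_fst[OF m] bases_contract[OF m B] .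
  qed
  have del: "in_R (delete M {e})" if r: "in_R M" and e: "e \<in> fst M" for M
  proof -
    have m: "matroid M" using in_R_matroid[OF r] .
    interpret base_family "fst M" "bases M" by (rule matroid_base_family[OF m])
    show ?thesis
    proof (cases "\<forall>B\<in>bases M. e \<in> B")
      case True
      then have b: "bases (delete M {e}) = {B - {e} |B. B \<in> bases M \<and> e \<in> B}"
        using bases_delete_coloop[OF m, of e] by auto
      have "good (fst M) (bases M)" using in_R_iff_good[OF m] r by simp
      from good_contract_element[OF this e] show ?thesis
        unfolding in_R_iff_good[OF delete_matroid[OF m]] delete_fst b .
    next
      case False
      then obtain B where B: "B \<in> bases M" "e \<notin> B" by blast
      have dm: "matroid (dual M)" "fst (dual M) = fst M" "dual (dual M) = M"
        using dual_facts[OF m] dual_dual[OF m] by auto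
      have "fst M - B \<in> bases (dual M)" using B dual_facts(2)[OF m] by (auto simp: dfam_def)
      then have "\<exists>B\<in>bases (dual M). e \<in> B" using e B by blast
      then have "in_R (contract (dual M) {e})" using con[OF in_R_dual[OF r]] e dm by simp
      then have "in_R (dual (delete M {e}))" unfolding contract_def dm .
      from in_R_dual[OF this] show ?thesis using dual_dual[OF delete_matroid[OF m]] by simp
    qed
  qed
  show "in_R (delete M {e})" using del r e .
  have m: "matroid M" using in_R_matroid[OF r] .
  show "in_R (contract M {e})" unfolding contract_def
    using in_R_dual[OF del[OF in_R_dual[OF r]]] dual_facts(3)[OF m] e by simp
qed

lemma delete_delete: "delete (delete M D) D' = delete M (D \<union> D')"
  unfolding delete_def by auto

lemma contract_contract: "matroid M \<Longrightarrow> contract (contract M C) C' = contract M (C \<union> C')"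
  unfolding contract_def by (simp add: dual_dual dual_facts delete_matroid delete_delete)

lemma in_R_delete: "in_R M \<Longrightarrow> D \<subseteq> fst M \<Longrightarrow> in_R (delete M D)"
proof -
  assume r: "in_R M" and D: "D \<subseteq> fst M"
  have "finite D" using D matroidD(1)[OF in_R_matroid[OF r]] finite_subset by blast
  then show ?thesis using D
  proof induction
    case empty
    have "delete M {} = M" by (simp add: delete_def)
    then show ?case using r by simp
  next
    case (insert x F)
    have "in_R (delete (delete M F) {x})"
      using insert by (intro in_R_contract_element) auto
    then show ?case by (simp add: delete_delete)
  qed
qed

lemma in_R_contract: "in_R M \<Longrightarrow> C \<subseteq> fst M \<Longrightarrow> in_R (contract M C)"
  unfolding contract_def
  by (intro in_R_dual in_R_delete) (simp_all add: dual_facts in_R_matroid)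

text \<open>Since the class is closed under minors, every proper minor can be reached through a
  single deletion or contraction that is already in it.\<close>

lemma excluded_minor_iff:
  assumes m: "matroid M"
  shows "excluded_minor_R M \<longleftrightarrow> \<not> in_R M \<and> (\<forall>e\<in>fst M. in_R (delete M {e}) \<and> in_R (contract M {e}))"
proof
  assume em: "excluded_minor_R M"
  have c0: "contract M {} = M" by (simp add: contract_def delete_def dual_dual[OF m])
  have d0: "delete N {} = N" for N :: "'a matroid" by (simp add: delete_def)
  have "proper_minor (delete M {e}) M" if "e \<in> fst M" for e
    unfolding proper_minor_def using that c0 by (intro exI[of _ "{}"] exI[of _ "{e}"]) simp
  moreover have "proper_minor (contract M {e}) M" if "e \<in> fst M" for e
    unfolding proper_minor_def using that d0 by (intro exI[of _ "{e}"] exI[of _ "{}"]) simp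
  ultimately show "\<not> in_R M \<and> (\<forall>e\<in>fst M. in_R (delete M {e}) \<and> in_R (contract M {e}))"
    using em unfolding excluded_minor_R_def by blast
next
  assume a: "\<not> in_R M \<and> (\<forall>e\<in>fst M. in_R (delete M {e}) \<and> in_R (contract M {e}))"
  have "in_R N" if n: "proper_minor N M" for N
  proof -
    obtain C D where cd: "C \<subseteq> fst M" "D \<subseteq> fst M" "C \<inter> D = {}" "C \<union> D \<noteq> {}" "N = delete (contract M C) D"
      using n unfolding proper_minor_def by blast
    show ?thesis
    proof (cases "C = {}")
      case True
      then obtain d where d: "d \<in> D" using cd by blast
      have "N = delete M D" using cd True by (simp add: contract_def delete_def dual_dual[OF m])
      also have "\<dots> = delete (delete M {d}) (D - {d})" using d by (simp add: delete_delete insert_absorb)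
      finally show ?thesis using in_R_delete[of "delete M {d}" "D - {d}"] a d cd by auto
    next
      case False
      then obtain c where c: "c \<in> C" by blast
      have "contract M C = contract (contract M {c}) (C - {c})" using c by (simp add: contract_contract[OF m] insert_absorb)
      moreover have "in_R (contract (contract M {c}) (C - {c}))"
        using a c cd contract_fst[OF m, of "{c}"] by (intro in_R_contract[of "contract M {c}"]) auto
      ultimately have "in_R (contract M C)" by simp
      then show ?thesis unfolding cd(5) by (intro in_R_delete) (use cd contract_fst[OF m, of C] in auto)
    qed
  qed
  then show "excluded_minor_R M" unfolding excluded_minor_R_def using a m by blast
qed

lemma excluded_minor_dual: "excluded_minor_R M \<Longrightarrow> excluded_minor_R (dual M)"
proof -
  assume em: "excluded_minor_R M"
  have m: "matroid M" using em by (simp add: excluded_minor_R_def)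
  have d: "matroid (dual M)" "fst (dual M) = fst M" using dual_facts[OF m] by auto
  have "delete (dual M) {e} = dual (contract M {e})" "contract (dual M) {e} = dual (delete M {e})" for e
    unfolding contract_def by (simp_all add: dual_dual m d delete_matroid)
  then show ?thesis using em unfolding excluded_minor_iff[OF m] excluded_minor_iff[OF d(1)]
    using in_R_dual dual_dual[OF m] d by metis
qed

section \<open>Free bases through a four-point line\<close>

text \<open>The seven small minors in the form in which they meet a line \<open>(S, T)\<close>: an
  outside element is neither a fifth point (\<open>noU25\<close>) nor a loop (\<open>noloop\<close>)
  on it, an element of \<open>S\<close> is neither its dual (\<open>noU35\<close>) nor a coloop
  (\<open>nocoloop\<close>), and three different points cannot all have parallel partners
  (\<open>noK\<close>) or all have series partners (\<open>noKdual\<close>). In \<open>noR6\<close>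
  the two triangles live on the contraction of \<open>Z\<close>.\<close>

locale no_small_minor = base_family E \<B> for E :: "'a set" and \<B> +
  assumes noU25: "wit \<B> S T \<Longrightarrow> r \<in> E - S - T \<Longrightarrow> \<exists>t\<in>T. insert r (insert t S) \<notin> \<B>"
    and noloop: "wit \<B> S T \<Longrightarrow> r \<in> E - S - T \<Longrightarrow> \<exists>t\<in>T. insert r (insert t S) \<in> \<B>"
    and noU35: "wit \<B> S T \<Longrightarrow> s \<in> S \<Longrightarrow> \<exists>t\<in>T. (S - {s}) \<union> (T - {t}) \<notin> \<B>"
    and nocoloop: "wit \<B> S T \<Longrightarrow> s \<in> S \<Longrightarrow> \<exists>t\<in>T. (S - {s}) \<union> (T - {t}) \<in> \<B>"
    and noK: "wit \<B> S T \<Longrightarrow> {r1,r2,r3} \<subseteq> E - S - T \<Longrightarrow> {t1,t2,t3} \<subseteq> T \<Longrightarrow> distinct [t1,t2,t3] \<Longrightarrow>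
      insert r1 (insert t1 S) \<notin> \<B> \<Longrightarrow> insert r2 (insert t2 S) \<notin> \<B> \<Longrightarrow> insert r3 (insert t3 S) \<notin> \<B> \<Longrightarrow> False"
    and noKdual: "wit \<B> S T \<Longrightarrow> {s1,s2,s3} \<subseteq> S \<Longrightarrow> {t1,t2,t3} \<subseteq> T \<Longrightarrow> distinct [t1,t2,t3] \<Longrightarrow>
      (S - {s1}) \<union> (T - {t1}) \<notin> \<B> \<Longrightarrow> (S - {s2}) \<union> (T - {t2}) \<notin> \<B> \<Longrightarrow> (S - {s3}) \<union> (T - {t3}) \<notin> \<B> \<Longrightarrow> False"
    and noR6: "card X = 3 \<Longrightarrow> card Y = 3 \<Longrightarrow> X \<inter> Y = {} \<Longrightarrow> Z \<inter> (X \<union> Y) = {} \<Longrightarrow>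
      Z \<union> X \<notin> \<B> \<Longrightarrow> Z \<union> Y \<notin> \<B> \<Longrightarrow>
      (\<And>p q w. p \<in> X \<Longrightarrow> q \<in> X \<Longrightarrow> w \<in> Y \<Longrightarrow> p \<noteq> q \<Longrightarrow> insert p (insert q (insert w Z)) \<in> \<B>) \<Longrightarrow>
      (\<And>p q w. p \<in> X \<Longrightarrow> q \<in> Y \<Longrightarrow> w \<in> Y \<Longrightarrow> q \<noteq> w \<Longrightarrow> insert p (insert q (insert w Z)) \<in> \<B>) \<Longrightarrow> False"

context base_family begin

lemma dual_add:
  assumes "S \<subseteq> E" "T \<subseteq> E" "S \<inter> T = {}" "r \<in> E - S - T" "t \<in> T"
  shows "insert r (insert t S) \<in> dfam E \<B> \<longleftrightarrow> (E - S - T - {r}) \<union> (T - {t}) \<in> \<B>"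
proof -
  have "insert r (insert t S) \<subseteq> E" "E - insert r (insert t S) = (E - S - T - {r}) \<union> (T - {t})"
    using assms by auto
  then show ?thesis using dual_mem by simp
qed

lemma dual_remove:
  assumes "S \<subseteq> E" "T \<subseteq> E" "S \<inter> T = {}" "s \<in> S" "t \<in> T"
  shows "(S - {s}) \<union> (T - {t}) \<in> dfam E \<B> \<longleftrightarrow> insert s (insert t (E - S - T)) \<in> \<B>"
proof -
  have "(S - {s}) \<union> (T - {t}) \<subseteq> E" "E - ((S - {s}) \<union> (T - {t})) = insert s (insert t (E - S - T))"
    using assms by auto
  then show ?thesis using dual_mem by simp
qed

text \<open>An element \<open>r\<close> that is neither a fifth point nor a loop on the line is
  parallel to some \<open>l\<close>, and then it pairs with every point that \<open>l\<close> pairs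
  with.\<close>

lemma unique_label:
  assumes w: "wit \<B> S T" and n: "\<exists>t\<in>T. insert r (insert t S) \<notin> \<B>" and y: "\<exists>t\<in>T. insert r (insert t S) \<in> \<B>"
  shows "\<exists>l\<in>T. \<forall>t\<in>T. insert r (insert t S) \<in> \<B> \<longleftrightarrow> t \<noteq> l"
proof -
  obtain l where l: "l \<in> T" "insert r (insert l S) \<notin> \<B>" using n by blast
  obtain t0 where t0: "t0 \<in> T" "insert r (insert t0 S) \<in> \<B>" using y by blast
  have "insert r (insert t S) \<in> \<B>" if "t \<in> T" "t \<noteq> l" for t
    using line_exchange[OF wit_card(1)[OF w] _ l(2) t0(2)] witD[OF w l(1) that(1)] that by blast
  then show ?thesis using l by blast
qed

end

lemma card3E:
  assumes "card T = 3"
  obtains a b c where "T = {a,b,c}" "distinct [a,b,c]"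
  using assms card_3_iff[of T] by auto

context no_small_minor begin

text \<open>The assumptions come in dual pairs, and \<open>noR6\<close> is its own dual:
  complementing turns two points of one triangle and one of the other into the remaining one and
  two. Later arguments thus need only one of two dual forms.\<close>

lemma dual_no_small_minor: "no_small_minor E (dfam E \<B>)"
proof -
  interpret d: base_family E "dfam E \<B>" by (rule dual_family)
  show ?thesis
  proof
    fix S T r assume w: "wit (dfam E \<B>) S T" and r: "r \<in> E - S - T"
    note ww = dual_witE[OF w]
    show "\<exists>t\<in>T. insert r (insert t S) \<notin> dfam E \<B>"
      using noU35[OF ww(1) r] dual_add[OF ww(2-4) r] by blast
    show "\<exists>t\<in>T. insert r (insert t S) \<in> dfam E \<B>"
      using nocoloop[OF ww(1) r] dual_add[OF ww(2-4) r] by blast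
  next
    fix S T s assume w: "wit (dfam E \<B>) S T" and s: "s \<in> S"
    note ww = dual_witE[OF w]
    have s': "s \<in> E - (E - S - T) - T" using s ww by auto
    show "\<exists>t\<in>T. (S - {s}) \<union> (T - {t}) \<notin> dfam E \<B>"
      using noU25[OF ww(1) s'] dual_remove[OF ww(2-4) s] by blast
    show "\<exists>t\<in>T. (S - {s}) \<union> (T - {t}) \<in> dfam E \<B>"
      using noloop[OF ww(1) s'] dual_remove[OF ww(2-4) s] by blast
  next
    fix S T r1 r2 r3 t1 t2 t3
    assume w: "wit (dfam E \<B>) S T" and r: "{r1,r2,r3} \<subseteq> E - S - T" and t: "{t1,t2,t3} \<subseteq> T" "distinct [t1,t2,t3]"
      and n: "insert r1 (insert t1 S) \<notin> dfam E \<B>" "insert r2 (insert t2 S) \<notin> dfam E \<B>" "insert r3 (insert t3 S) \<notin> dfam E \<B>"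
    note ww = dual_witE[OF w]
    show False
      by (rule noKdual[OF ww(1) r t]) (use n r t dual_add[OF ww(2-4)] in auto)
  next
    fix S T s1 s2 s3 t1 t2 t3
    assume w: "wit (dfam E \<B>) S T" and r: "{s1,s2,s3} \<subseteq> S" and t: "{t1,t2,t3} \<subseteq> T" "distinct [t1,t2,t3]"
      and n: "(S - {s1}) \<union> (T - {t1}) \<notin> dfam E \<B>" "(S - {s2}) \<union> (T - {t2}) \<notin> dfam E \<B>" "(S - {s3}) \<union> (T - {t3}) \<notin> dfam E \<B>"
    note ww = dual_witE[OF w]
    have r': "{s1,s2,s3} \<subseteq> E - (E - S - T) - T" using r ww by auto
    show False
      by (rule noK[OF ww(1) r' t]) (use n r t dual_remove[OF ww(2-4)] in auto)
  next
    fix X Y Z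
    assume c: "card X = 3" "card Y = 3" "X \<inter> Y = {}" "Z \<inter> (X \<union> Y) = {}"
      and n: "Z \<union> X \<notin> dfam E \<B>" "Z \<union> Y \<notin> dfam E \<B>"
      and p1: "\<And>p q w. p \<in> X \<Longrightarrow> q \<in> X \<Longrightarrow> w \<in> Y \<Longrightarrow> p \<noteq> q \<Longrightarrow> insert p (insert q (insert w Z)) \<in> dfam E \<B>"
      and p2: "\<And>p q w. p \<in> X \<Longrightarrow> q \<in> Y \<Longrightarrow> w \<in> Y \<Longrightarrow> q \<noteq> w \<Longrightarrow> insert p (insert q (insert w Z)) \<in> dfam E \<B>"
    obtain x1 x2 x3 where X: "X = {x1,x2,x3}" "distinct [x1,x2,x3]" using card3E[OF c(1)] .
    obtain y1 y2 y3 where Y: "Y = {y1,y2,y3}" "distinct [y1,y2,y3]" using card3E[OF c(2)] .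
    have XE: "p \<in> E" "Z \<subseteq> E" if "p \<in> X" for p
      using d.sub[OF p2[of p y1 y2]] that Y by auto
    have YE: "p \<in> E" if "p \<in> Y" for p using d.sub[OF p1[of x1 x2 p]] that X by auto
    have ss: "X \<subseteq> E" "Y \<subseteq> E" "Z \<subseteq> E" using XE YE X by auto
    let ?Z = "E - Z - X - Y"
    have third: "\<exists>v. A - {p,q} = {v} \<and> v \<in> A" if "card A = 3" "p \<in> A" "q \<in> A" "p \<noteq> q" for A :: "'a set" and p q
    proof -
      have "card (A - {p,q}) = 1" using that by (simp add: card_Diff_subset)
      then show ?thesis by (metis card_1_singletonE Diff_iff insertI1)
    qed
    have two: "\<exists>u v. A - {p} = {u,v} \<and> u \<noteq> v \<and> u \<in> A \<and> v \<in> A" if "card A = 3" "p \<in> A" for A :: "'a set" and p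
    proof -
      have "card (A - {p}) = 2" using that by (simp add: card_Diff_subset)
      then show ?thesis by (metis card_2_iff Diff_iff insertI1 insertI2)
    qed
    show False
    proof (rule noR6[of X Y ?Z])
      show "?Z \<union> X \<notin> \<B>"
      proof -
        have "E - (Z \<union> Y) = ?Z \<union> X" using ss c by auto
        then show ?thesis using n(2) dual_mem[of "Z \<union> Y"] ss by auto
      qed
      show "?Z \<union> Y \<notin> \<B>"
      proof -
        have "E - (Z \<union> X) = ?Z \<union> Y" using ss c by auto
        then show ?thesis using n(1) dual_mem[of "Z \<union> X"] ss by auto
      qed
      fix p q w
      {
        assume a: "p \<in> X" "q \<in> X" "w \<in> Y" "p \<noteq> q"
        obtain v where v: "X - {p,q} = {v}" "v \<in> X" using third[OF c(1) a(1,2,4)] by blast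
        obtain u t where u: "Y - {w} = {u,t}" "u \<noteq> t" "u \<in> Y" "t \<in> Y" using two[OF c(2) a(3)] by blast
        have "insert v (insert u (insert t Z)) \<in> dfam E \<B>" using p2 v u by blast
        moreover have "E - insert v (insert u (insert t Z)) = insert p (insert q (insert w ?Z))"
          using v u a ss c by auto
        moreover have "insert v (insert u (insert t Z)) \<subseteq> E" using v u ss by auto
        ultimately show "insert p (insert q (insert w ?Z)) \<in> \<B>" using dual_mem by metis
      }
      {
        assume a: "p \<in> X" "q \<in> Y" "w \<in> Y" "q \<noteq> w"
        obtain v where v: "Y - {q,w} = {v}" "v \<in> Y" using third[OF c(2) a(2,3,4)] by blast
        obtain u t where u: "X - {p} = {u,t}" "u \<noteq> t" "u \<in> X" "t \<in> X" using two[OF c(1) a(1)] by blast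
        have "insert u (insert t (insert v Z)) \<in> dfam E \<B>" using p1 v u by blast
        moreover have "E - insert u (insert t (insert v Z)) = insert p (insert q (insert w ?Z))"
          using v u a ss c by auto
        moreover have "insert u (insert t (insert v Z)) \<subseteq> E" using v u ss by auto
        ultimately show "insert p (insert q (insert w ?Z)) \<in> \<B>" using dual_mem by metis
      }
    qed (use c in auto)
  qed
qed

section \<open>Parallel and series labels, and bad triples\<close>

lemma parallel_label:
  assumes w: "wit \<B> S T" and r: "r \<in> E - S - T"
  shows "\<exists>l\<in>T. \<forall>t\<in>T. insert r (insert t S) \<in> \<B> \<longleftrightarrow> t \<noteq> l"
  using unique_label[OF w noU25[OF w r] noloop[OF w r]] .

lemma series_label:
  assumes w: "wit \<B> S T" and s: "s \<in> S"
  shows "\<exists>l\<in>T. \<forall>t\<in>T. (S - {s}) \<union> (T - {t}) \<in> \<B> \<longleftrightarrow> t \<noteq> l"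
proof -
  have st: "S \<subseteq> E" "T \<subseteq> E" "S \<inter> T = {}" using wit_sub[OF w] w by (auto simp: wit_def)
  have ww: "wit (dfam E \<B>) (E - S - T) T" by (rule wit_dual[OF w])
  have e: "E - (E - S - T) - T = S" using st by auto
  have s': "s \<in> E - (E - S - T) - T" using s e by simp
  have eq: "insert s (insert t (E - S - T)) \<in> dfam E \<B> \<longleftrightarrow> (S - {s}) \<union> (T - {t}) \<in> \<B>" if "t \<in> T" for t
    using dual_add[of "E - S - T" T s t] e s' that st by auto
  show ?thesis using no_small_minor.parallel_label[OF dual_no_small_minor ww s'] eq by blast
qed

text \<open>When \<open>Z\<close> has three elements fewer than a base, this is a basis of the
  rank-three contraction of \<open>Z\<close>; its failure can be read as collinearity in a
  plane.\<close>

definition tri :: "'a set \<Rightarrow> 'a \<Rightarrow> 'a \<Rightarrow> 'a \<Rightarrow> bool" where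
  "tri Z a b c \<longleftrightarrow> insert a (insert b (insert c Z)) \<in> \<B>"

lemma tri_perm: "tri Z a b c = tri Z b a c" "tri Z a b c = tri Z a c b"
  unfolding tri_def by (simp_all add: insert_commute)

text \<open>The independent pair \<open>a, y\<close> is completed from the basis
  \<open>a, x, z\<close>.\<close>

lemma tri_exchange:
  assumes c: "card Z + 3 = rk" and "tri Z a x z" "tri Z a y w"
  shows "tri Z a y x \<or> tri Z a y z"
proof -
  have t: "insert x (insert z (insert a Z)) \<in> \<B>" "insert y (insert w (insert a Z)) \<in> \<B>"
    using assms unfolding tri_def by (auto simp: insert_commute)
  have f: "finite Z" using finB[OF t(1)] by simp
  have "card (insert x (insert z (insert a Z))) = card Z + 3" using cardB[OF t(1)] c by simp
  then have "a \<notin> Z" using f by (auto simp: card_insert_if split: if_splits)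
  then have "card (insert a Z) + 2 = rk" using c f by simp
  from line_exchange[OF this t(1), of y w] t(2)
  show ?thesis unfolding tri_def by (metis insert_commute)
qed

lemma wit_tri: "distinct [p,a,b,c,d] \<Longrightarrow> Z \<inter> {a,b,c,d} = {} \<Longrightarrow>
  tri Z p a b \<Longrightarrow> tri Z p a c \<Longrightarrow> tri Z p a d \<Longrightarrow> tri Z p b c \<Longrightarrow> tri Z p b d \<Longrightarrow> tri Z p c d \<Longrightarrow>
  wit \<B> (insert p Z) {a,b,c,d}"
  unfolding tri_def by (intro witI) (auto simp: insert_commute)

text \<open>This is \<open>nocoloop\<close> for the contracted element \<open>p\<close>: if no three
  of the four points were a base over \<open>Z\<close>, then \<open>p\<close> would be a coloop
  beside the line.\<close>

lemma coloop_triples: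
  assumes w: "wit \<B> (insert p Z) {a,b,c,d}" and p: "p \<notin> Z" and d: "distinct [a,b,c,d]"
  shows "tri Z b c d \<or> tri Z a c d \<or> tri Z a b d \<or> tri Z a b c"
proof -
  obtain t where t: "t \<in> {a,b,c,d}" "(insert p Z - {p}) \<union> ({a,b,c,d} - {t}) \<in> \<B>"
    using nocoloop[OF w, of p] by blast
  have e: "insert p Z - {p} = Z" using p by auto
  have e2: "Z \<union> ({a,b,c,d} - {a}) = insert b (insert c (insert d Z))"
    "Z \<union> ({a,b,c,d} - {b}) = insert a (insert c (insert d Z))"
    "Z \<union> ({a,b,c,d} - {c}) = insert a (insert b (insert d Z))"
    "Z \<union> ({a,b,c,d} - {d}) = insert a (insert b (insert c Z))" using d by auto
  from t(1) consider "t = a" | "t = b" | "t = c" | "t = d" by blast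
  then show ?thesis using t(2) unfolding tri_def e e2[symmetric] by cases simp_all
qed

text \<open>If \<open>r\<close> is parallel and \<open>s\<close> is in series to the same point of a four-point line, then these
  six elements form \<open>R\<^sub>6\<close>, unless they degenerate to a four-point line plus a loop or a coloop.\<close>

lemma labels_disjoint:
  assumes w: "wit \<B> S T" and r: "r \<in> E - S - T" and s: "s \<in> S" and l: "l \<in> T"
    and rl: "insert r (insert l S) \<notin> \<B>" and sl: "(S - {s}) \<union> (T - {l}) \<notin> \<B>"
  shows False
proof -
  define Z where "Z = S - {s}"
  have S: "S = insert s Z" "s \<notin> Z" using s Z_def by auto
  have st: "S \<inter> T = {}" "S \<subseteq> E" "T \<subseteq> E" "card T = 4" using w wit_sub[OF w] by (auto simp: wit_def)
  have "card (T - {l}) = 3" using st l by (simp add: card_Diff_subset)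
  then obtain x y z where xyz: "T - {l} = {x,y,z}" "distinct [x,y,z]" using card3E by blast
  have T: "T = {l,x,y,z}" using xyz l by auto
  have dT: "distinct [l,x,y,z]" using xyz by auto
  have cZ: "card Z + 3 = rk" using wit_card[OF w] S by simp
  have ex: "\<And>a x z y w. tri Z a x z \<Longrightarrow> tri Z a y w \<Longrightarrow> tri Z a y x \<or> tri Z a y z"
    using tri_exchange[OF cZ] .
  have sT: "tri Z s a b" if "a \<in> T" "b \<in> T" "a \<noteq> b" for a b
    using witD[OF w that] unfolding tri_def S by (simp add: insert_commute)
  have n1: "\<not> tri Z x y z" using sl xyz S unfolding tri_def Z_def by (metis Un_commute insert_is_Un Un_insert_left sup_bot_left)
  have n2: "\<not> tri Z s r l" using rl S unfolding tri_def by (simp add: insert_commute)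
  have y1: "tri Z l x y" "tri Z l x z" "tri Z l y z"
  proof -
    obtain m where m: "m \<in> T" "\<And>t. t \<in> T \<Longrightarrow> (S - {s}) \<union> (T - {t}) \<in> \<B> \<longleftrightarrow> t \<noteq> m" using series_label[OF w s] by blast
    have "m = l" using m(2)[OF l] sl by blast
    then have "Z \<union> (T - {t}) \<in> \<B>" if "t \<in> {x,y,z}" for t using m(2)[of t] that T dT Z_def by auto
    moreover have "T - {z} = {l,x,y}" "T - {y} = {l,x,z}" "T - {x} = {l,y,z}" using T dT by auto
    ultimately show "tri Z l x y" "tri Z l x z" "tri Z l y z"
      unfolding tri_def by (metis insertI1 insertI2 Un_commute insert_is_Un Un_insert_left sup_bot_left)+
  qed
  have y2: "tri Z s r x" "tri Z s r y" "tri Z s r z"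
  proof -
    obtain m where m: "m \<in> T" "\<And>t. t \<in> T \<Longrightarrow> insert r (insert t S) \<in> \<B> \<longleftrightarrow> t \<noteq> m" using parallel_label[OF w r] by blast
    have "m = l" using m(2)[OF l] rl by blast
    then have "insert r (insert t S) \<in> \<B>" if "t \<in> {x,y,z}" for t using m(2)[of t] that T dT by auto
    moreover have "insert s (insert r (insert t Z)) = insert r (insert t S)" for t using S by auto
    ultimately have "tri Z s r t" if "t \<in> {x,y,z}" for t
      using that unfolding tri_def by simp
    then show "tri Z s r x" "tri Z s r y" "tri Z s r z" by auto
  qed
  have rr: "r \<in> E" "r \<notin> Z" "r \<noteq> s" "r \<notin> T" using r S by auto
  have zT: "Z \<inter> T = {}" "s \<notin> T" using st S by auto
  \<comment> \<open>Otherwise \<open>r\<close> forms no base over \<open>Z + l\<close> with any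
    element, hence is a loop there, while \<open>x, y, z, s\<close> is a four-point line over
    \<open>Z + l\<close>.\<close>
  have A: "tri Z l r q" if q: "q \<in> {x,y,z}" for q
  proof (rule ccontr)
    assume n: "\<not> tri Z l r q"
    have lsq: "tri Z l s q" using sT[of l q] q T dT by (auto simp: tri_perm)
    have nol: "\<not> tri Z l r v" for v using ex[OF lsq, of r v] n n2 by (auto simp: tri_perm)
    have "wit \<B> (insert l Z) {x,y,z,s}"
      using dT zT S y1 sT[of l x] sT[of l y] sT[of l z] T
      by (intro wit_tri) (auto simp: tri_perm)
    moreover have "r \<in> E - insert l Z - {x,y,z,s}" using rr T by auto
    ultimately obtain t where "insert r (insert t (insert l Z)) \<in> \<B>" using noloop by blast
    then have "tri Z l r t" unfolding tri_def by (simp add: insert_commute)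
    then show False using nol by blast
  qed
  \<comment> \<open>Otherwise \<open>r\<close> lies on the line \<open>x y z\<close> over
    \<open>Z\<close>; over \<open>Z + l\<close> these four are a four-point line, and
    \<open>l\<close> would be a coloop beside it.\<close>
  have B: "tri Z r a b" if ab: "a \<in> {x,y,z}" "b \<in> {x,y,z}" "a \<noteq> b" for a b
  proof (rule ccontr)
    assume n: "\<not> tri Z r a b"
    obtain v where v: "v \<in> {x,y,z}" "v \<noteq> a" "v \<noteq> b" using ab dT by auto
    have nv: "\<not> tri Z a b v" using n1 v ab by (auto simp: tri_perm)
    have lp: "tri Z l u t" if "u \<in> {x,y,z}" "t \<in> {x,y,z}" "u \<noteq> t" for u t
      using y1 that by (auto simp: tri_perm)
    have lab: "tri Z l a b" "tri Z l a v" "tri Z l b v" using lp v ab by metis+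
    have n3: "\<not> tri Z a r v" using ex[of a r v b l] n nv lab by (auto simp: tri_perm)
    have n4: "\<not> tri Z b r v" using ex[of b r v a l] n nv lab by (auto simp: tri_perm)
    have dd: "distinct [l,a,b,v,r]" "Z \<inter> {a,b,v,r} = {}" "l \<notin> Z"
      using v ab dT rr T zT by auto
    have w2: "wit \<B> (insert l Z) {a,b,v,r}"
      using dd lab A[OF ab(1)] A[OF ab(2)] A[OF v(1)] by (intro wit_tri) (auto simp: tri_perm)
    have "tri Z b v r \<or> tri Z a v r \<or> tri Z a b r \<or> tri Z a b v"
      using coloop_triples[OF w2] dd by auto
    then show False using n nv n3 n4 by (auto simp: tri_perm)
  qed
  \<comment> \<open>All triples other than \<open>x y z\<close> and \<open>s r l\<close> are now
    bases over \<open>Z\<close>, which is the pattern of \<open>R\<^sub>6\<close>.\<close>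
  show False
  proof (rule noR6[of "{x,y,z}" "{s,r,l}" Z])
    show "card {x,y,z} = 3" "card {s,r,l} = 3" "{x,y,z} \<inter> {s,r,l} = {}" "Z \<inter> ({x,y,z} \<union> {s,r,l}) = {}"
      using dT rr T zT S by auto
    show "Z \<union> {x,y,z} \<notin> \<B>" "Z \<union> {s,r,l} \<notin> \<B>" using n1 n2 unfolding tri_def by simp_all
    fix p q v
    {
      assume "p \<in> {x,y,z}" "q \<in> {x,y,z}" "v \<in> {s,r,l}" "p \<noteq> q"
      then have "tri Z p q v" using y1 sT[of p q] B[of p q] T by (auto simp: tri_perm)
      then show "insert p (insert q (insert v Z)) \<in> \<B>" by (simp add: tri_def)
    }
    {
      assume "p \<in> {x,y,z}" "q \<in> {s,r,l}" "v \<in> {s,r,l}" "q \<noteq> v"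
      then have "tri Z p q v" using y2 sT[of p l] A[of p] T dT by (auto simp: tri_perm)
      then show "insert p (insert q (insert v Z)) \<in> \<B>" by (simp add: tri_def)
    }
  qed
qed

text \<open>What the two labels determine over \<open>S - {s}\<close> about the six points
  \<open>p, l, x, y, s, r\<close>: the nonbases found are \<open>l x y\<close> and
  \<open>s r l\<close>. Left open are only the triples of \<open>r\<close> with two points of the
  line.\<close>

lemma frame:
  assumes w: "wit \<B> S {p,l,x,y}" and d: "distinct [p,l,x,y]" and s: "s \<in> S" and r: "r \<in> E - S - {p,l,x,y}"
    and rl: "insert r (insert l S) \<notin> \<B>" and sp: "(S - {s}) \<union> ({p,l,x,y} - {p}) \<notin> \<B>"
  shows "card (S - {s}) + 3 = rk"
    "\<And>a b. a \<in> {p,l,x,y} \<Longrightarrow> b \<in> {p,l,x,y} \<Longrightarrow> a \<noteq> b \<Longrightarrow> tri (S - {s}) s a b"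
    "tri (S - {s}) p l x" "tri (S - {s}) p l y" "tri (S - {s}) p x y" "\<not> tri (S - {s}) l x y"
    "tri (S - {s}) s r p" "tri (S - {s}) s r x" "tri (S - {s}) s r y" "\<not> tri (S - {s}) s r l"
    "r \<in> E" "r \<noteq> s" "r \<notin> S" "s \<notin> {p,l,x,y}" "S \<inter> {p,l,x,y} = {}"
proof -
  let ?T = "{p,l,x,y}"
  define Z where "Z = S - {s}"
  have S: "S = insert s Z" "s \<notin> Z" using s Z_def by auto
  have fS: "finite S" using wit_card[OF w] by blast
  show cZ: "card (S - {s}) + 3 = rk" using wit_card(1)[OF w] card_Suc_Diff1[OF fS s] by linarith
  show st: "S \<inter> ?T = {}" using w by (simp only: wit_def)
  show "tri (S - {s}) s a b" if "a \<in> ?T" "b \<in> ?T" "a \<noteq> b" for a b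
  proof -
    have "insert s (insert a (insert b Z)) = insert a (insert b S)" using S by auto
    then show ?thesis using witD[OF w that] unfolding tri_def Z_def[symmetric] by simp
  qed
  obtain m where m: "m \<in> ?T" "\<And>t. t \<in> ?T \<Longrightarrow> (S - {s}) \<union> (?T - {t}) \<in> \<B> \<longleftrightarrow> t \<noteq> m" using series_label[OF w s] by blast
  have "m = p" using m(2)[of p] sp by blast
  then have mm: "Z \<union> (?T - {t}) \<in> \<B>" if "t \<in> {l,x,y}" for t using m(2)[of t] that d Z_def by auto
  have e: "Z \<union> (?T - {l}) = insert p (insert x (insert y Z))" "Z \<union> (?T - {x}) = insert p (insert l (insert y Z))"
    "Z \<union> (?T - {y}) = insert p (insert l (insert x Z))" "Z \<union> (?T - {p}) = insert l (insert x (insert y Z))"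
    using d by auto
  show "tri (S - {s}) p l x" "tri (S - {s}) p l y" "tri (S - {s}) p x y" "\<not> tri (S - {s}) l x y"
    using mm[of l] mm[of x] mm[of y] sp unfolding tri_def Z_def[symmetric] e by auto
  obtain k where k: "k \<in> ?T" "\<And>t. t \<in> ?T \<Longrightarrow> insert r (insert t S) \<in> \<B> \<longleftrightarrow> t \<noteq> k" using parallel_label[OF w r] by blast
  have kl: "k = l" using k(2)[of l] rl by blast
  have e2: "insert s (insert r (insert t Z)) = insert r (insert t S)" for t using S by auto
  show "tri (S - {s}) s r p" "tri (S - {s}) s r x" "tri (S - {s}) s r y" "\<not> tri (S - {s}) s r l"
    using k(2)[of p] k(2)[of x] k(2)[of y] kl d rl unfolding tri_def Z_def[symmetric] e2 by auto
  show "r \<in> E" "r \<noteq> s" "r \<notin> S" "s \<notin> ?T" using r s st by auto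
qed

text \<open>Let \<open>p\<close> be the series label of \<open>s\<close> and \<open>l\<close> the parallel label of \<open>r\<close>. The only neighbours of
  \<open>S \<union> {p, x}\<close> that may fail to be bases are the sets \<open>S - s + r + p + x\<close>; the following lemmas restrict such failures.\<close>

lemma bad_once:
  assumes w: "wit \<B> S {p,l,x,y}" and d: "distinct [p,l,x,y]" and s: "s \<in> S" and r: "r \<in> E - S - {p,l,x,y}"
    and rl: "insert r (insert l S) \<notin> \<B>" and sp: "(S - {s}) \<union> ({p,l,x,y} - {p}) \<notin> \<B>"
    and b: "\<not> tri (S - {s}) r p x" "\<not> tri (S - {s}) r p y"
  shows False
proof -
  note F = frame[OF w d s r rl sp]
  show False using tri_exchange[OF F(1), of p x y r s] F(5,7) b by (simp add: tri_perm)
qed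

text \<open>Over \<open>S - {s}\<close> the points \<open>s, l, r, r'\<close> are collinear, as both
  \<open>r\<close> and \<open>r'\<close> carry the label \<open>l\<close>. After contracting
  \<open>p\<close> the bad triples make \<open>r\<close> parallel to \<open>x\<close> and
  \<open>r'\<close> to \<open>y\<close>, so these four points form a four-point line, beside which
  \<open>p\<close> is a coloop.\<close>

lemma bad_same_series:
  assumes w: "wit \<B> S {p,l,x,y}" and d: "distinct [p,l,x,y]" and s: "s \<in> S"
    and r: "r \<in> E - S - {p,l,x,y}" and r': "r' \<in> E - S - {p,l,x,y}" and rr: "r \<noteq> r'"
    and rl: "insert r (insert l S) \<notin> \<B>" and rl': "insert r' (insert l S) \<notin> \<B>"
    and sp: "(S - {s}) \<union> ({p,l,x,y} - {p}) \<notin> \<B>"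
    and b: "\<not> tri (S - {s}) r p x" "\<not> tri (S - {s}) r' p y"
  shows False
proof -
  note F = frame[OF w d s r rl sp] and F' = frame[OF w d s r' rl' sp]
  let ?Z = "S - {s}"
  note ex = tri_exchange[OF F(1)]
  have 1: "tri ?Z p r y" using ex[of p x y r s] F(3-10) b by (simp add: tri_perm)
  have 2: "tri ?Z p r r'" using ex[of p r y r' s] 1 F'(3-10) b by (simp add: tri_perm)
  have 3: "tri ?Z p r l" using ex[of p x l r s] F(3-10) b by (simp add: tri_perm)
  have 4: "tri ?Z p r' l" using ex[of p y l r' s] F'(3-10) b by (simp add: tri_perm)
  have 5: "tri ?Z s p l" "tri ?Z s l x" using F(2)[of p l] F(2)[of l x] d by auto
  have dd: "distinct [p,s,r,r',l]" "?Z \<inter> {s,r,r',l} = {}" "p \<notin> ?Z"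
    using F(11-15) F'(11-15) rr d r r' by auto
  have w2: "wit \<B> (insert p ?Z) {s,r,r',l}"
    by (rule wit_tri[OF dd(1,2)]) (use 2 3 4 5 F(7) F'(7) in \<open>simp_all add: tri_perm\<close>)
  have 6: "\<not> tri ?Z s r r'" using ex[of s r r' l x] 5 F(10) F'(10) by (auto simp: tri_perm)
  have "tri ?Z l s x" using 5 by (simp add: tri_perm)
  then have 7: "\<not> tri ?Z l r r'" using ex[of l r r' s x] F(10) F'(10) by (auto simp: tri_perm)
  have "tri ?Z r r' l \<or> tri ?Z s r' l \<or> tri ?Z s r l \<or> tri ?Z s r r'"
    using coloop_triples[OF w2 dd(3)] dd(1) by auto
  then show False using 6 7 F(10) F'(10) by (auto simp: tri_perm)
qed

text \<open>A bad triple at \<open>p, x\<close> excludes a second parallel label at the remaining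
  point \<open>y\<close>. The cases follow the position of \<open>r'\<close> over
  \<open>S - {s} + p\<close>.\<close>

lemma bad_two_parallel_labels:
  assumes w: "wit \<B> S {p,l,x,y}" and d: "distinct [p,l,x,y]" and s: "s \<in> S"
    and r: "r \<in> E - S - {p,l,x,y}" and r': "r' \<in> E - S - {p,l,x,y}"
    and rl: "insert r (insert l S) \<notin> \<B>" and rl': "insert r' (insert y S) \<notin> \<B>"
    and sp: "(S - {s}) \<union> ({p,l,x,y} - {p}) \<notin> \<B>"
    and b: "\<not> tri (S - {s}) r p x"
  shows False
proof -
  let ?Z = "S - {s}"
  have eqT: "{p,l,x,y} = {p,y,x,l}" by auto
  have d': "distinct [p,y,x,l]" using d by auto
  note F = frame[OF w d s r rl sp] and F' = frame[OF w[unfolded eqT] d' s r'[unfolded eqT] rl' sp[unfolded eqT]]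
  note ex = tri_exchange[OF F(1)]
  have rr: "r \<noteq> r'" using F(9,10) F'(10) by auto
  have Ts: "tri ?Z s p l" "tri ?Z s p x" "tri ?Z s p y" "tri ?Z s l x" "tri ?Z s l y" "tri ?Z s x y"
    using F(2)[of p l] F(2)[of p x] F(2)[of p y] F(2)[of l x] F(2)[of l y] F(2)[of x y] d by auto
  have dd: "distinct [s,p,l,x,y,r,r']" "?Z \<inter> {s,p,l,x,y,r,r'} = {}"
    using F(11-15) F'(11-15) rr d r r' by auto
  consider "\<not> tri ?Z r' p x" | "tri ?Z r' p x" "\<not> tri ?Z r' p l" | "tri ?Z r' p x" "tri ?Z r' p l" by blast
  then show False
  proof cases
    \<comment> \<open>Over \<open>S\<close> the points \<open>x, r, r', p\<close> form a four-point
      line, but no three of them are a base over \<open>S - {s}\<close>; so \<open>s\<close> would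
      be a coloop beside it.\<close>
    case 1
    have a1: "tri ?Z s r r'" using ex[of s l r' r x] F(3-10) F'(3-10) by (auto simp: tri_perm)
    have w2: "wit \<B> (insert s ?Z) {x,r,r',p}"
      by (rule wit_tri) (use dd a1 Ts F(3-10) F'(3-10) in \<open>auto simp: tri_perm\<close>)
    have 6: "\<not> tri ?Z p r r'" using ex[of p r r' x y] F(5) b 1 by (auto simp: tri_perm)
    have "tri ?Z x p y" using F(5) by (simp add: tri_perm)
    then have 7: "\<not> tri ?Z x r r'" using ex[of x r r' p y] b 1 by (auto simp: tri_perm)
    have "tri ?Z r r' p \<or> tri ?Z x r' p \<or> tri ?Z x r p \<or> tri ?Z x r r'"
      using coloop_triples[OF w2] dd(1) by auto
    then show False using 6 7 b 1 by (auto simp: tri_perm)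
  next
    \<comment> \<open>Over \<open>S - {s} + p\<close> the points \<open>x, s, y, r'\<close> form a
      line on which \<open>r\<close> is parallel to \<open>x\<close> and, as \<open>s r' y\<close>
      is no base, \<open>p\<close> is in series to \<open>x\<close>.\<close>
    case 2
    have a1: "tri ?Z p r' y" using ex[of p l y r' s] 2 F(4) F'(7) by (auto simp: tri_perm)
    have w2: "wit \<B> (insert p ?Z) {x,s,y,r'}"
      by (rule wit_tri) (use dd a1 2 Ts F(3-10) F'(3-10) in \<open>auto simp: tri_perm\<close>)
    show False
    proof (rule labels_disjoint[OF w2, of r p x])
      show "r \<in> E - insert p ?Z - {x,s,y,r'}" using dd F by auto
      show "insert r (insert x (insert p ?Z)) \<notin> \<B>" using b unfolding tri_def by (simp add: insert_commute)
      have "insert p ?Z - {p} \<union> ({x,s,y,r'} - {x}) = insert s (insert r' (insert y ?Z))" using dd by auto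
      then show "insert p ?Z - {p} \<union> ({x,s,y,r'} - {x}) \<notin> \<B>" using F'(10) unfolding tri_def by simp
    qed auto
  next
    \<comment> \<open>On the line \<open>x, s, y, l\<close> over \<open>S - {s} + p\<close> only
      \<open>y\<close> can be parallel to \<open>r'\<close>. As \<open>y\<close> is also the label
      of \<open>r'\<close>, this makes \<open>r'\<close> a loop over \<open>S - {s} + y\<close>,
      where \<open>x, s, p, r\<close> is a line.\<close>
    case 3
    have w2: "wit \<B> (insert p ?Z) {x,s,y,l}"
      by (rule wit_tri) (use dd Ts F(3-10) F'(3-10) in \<open>auto simp: tri_perm\<close>)
    have "r' \<in> E - insert p ?Z - {x,s,y,l}" using dd F' by auto
    then obtain t where t: "t \<in> {x,s,y,l}" "insert r' (insert t (insert p ?Z)) \<notin> \<B>" using noU25[OF w2] by blast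
    then have "\<not> tri ?Z p r' t" unfolding tri_def by (simp add: insert_commute)
    then have a1: "\<not> tri ?Z p r' y" using t 3 F'(7) by (auto simp: tri_perm)
    have ysp: "tri ?Z y s p" using Ts by (simp add: tri_perm)
    have nol: "\<not> tri ?Z y r' v" for v using ex[OF ysp, of r' v] a1 F'(10) by (auto simp: tri_perm)
    have a2: "tri ?Z x r y" using ex[of x p y r s] F(3-10) b by (auto simp: tri_perm)
    have a3: "tri ?Z p r y" using ex[of p x y r s] F(3-10) b by (auto simp: tri_perm)
    have w3: "wit \<B> (insert y ?Z) {x,s,p,r}"
      by (rule wit_tri) (use dd a2 a3 Ts F(3-10) in \<open>auto simp: tri_perm\<close>)
    have "r' \<in> E - insert y ?Z - {x,s,p,r}" using dd F' by auto
    then obtain u where "insert r' (insert u (insert y ?Z)) \<in> \<B>" using noloop[OF w3] by blast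
    then have "tri ?Z y r' u" unfolding tri_def by (simp add: insert_commute)
    then show False using nol by blast
  qed
qed

text \<open>Duality swaps \<open>s\<close> with \<open>r\<close>, \<open>p\<close> with
  \<open>l\<close> and \<open>x\<close> with \<open>y\<close>, so a bad triple stays bad with its
  two kinds of elements exchanged.\<close>

lemma dual_bad:
  assumes S: "S \<subseteq> E" "S \<inter> {p,l,x,y} = {}" "{p,l,x,y} \<subseteq> E" "distinct [p,l,x,y]" "s \<in> S" "r \<in> E - S - {p,l,x,y}"
  shows "insert s (insert l (insert y (E - S - {p,l,x,y} - {r}))) \<in> dfam E \<B> \<longleftrightarrow> tri (S - {s}) r p x"
proof -
  have "insert s (insert l (insert y (E - S - {p,l,x,y} - {r}))) \<subseteq> E" using S by auto
  moreover have "E - insert s (insert l (insert y (E - S - {p,l,x,y} - {r}))) = insert r (insert p (insert x (S - {s})))"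
    using S by auto
  ultimately show ?thesis using dual_mem unfolding tri_def by simp
qed

text \<open>The dual of \<open>bad_same_series\<close>, under the renaming of
  \<open>dual_bad\<close>.\<close>

lemma bad_same_parallel:
  assumes w: "wit \<B> S {p,l,x,y}" and d: "distinct [p,l,x,y]" and s: "s \<in> S" and s': "s' \<in> S" and ss: "s \<noteq> s'"
    and r: "r \<in> E - S - {p,l,x,y}"
    and rl: "insert r (insert l S) \<notin> \<B>"
    and sp: "(S - {s}) \<union> ({p,l,x,y} - {p}) \<notin> \<B>" and sp': "(S - {s'}) \<union> ({p,l,x,y} - {p}) \<notin> \<B>"
    and b: "\<not> tri (S - {s}) r p x" "\<not> tri (S - {s'}) r p y"
  shows False
proof -
  interpret d: no_small_minor E "dfam E \<B>" by (rule dual_no_small_minor)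
  let ?T = "{p,l,x,y}" and ?S = "E - S - {p,l,x,y}"
  have eqT: "?T = {l,p,y,x}" and eqT2: "?T = {p,l,y,x}" by auto
  have st: "S \<subseteq> E" "?T \<subseteq> E" "S \<inter> ?T = {}" using wit_sub[OF w] w unfolding wit_def by blast+
  have e: "E - ?S - ?T = S" using st by auto
  have w2: "wit (dfam E \<B>) ?S {l,p,y,x}" using wit_dual[OF w] eqT by simp
  have sE: "s \<in> E - ?S - {l,p,y,x}" "s' \<in> E - ?S - {l,p,y,x}" using s s' e eqT by auto
  have st2: "?S \<subseteq> E" "?S \<inter> ?T = {}" by auto
  have n1: "insert s (insert p ?S) \<notin> dfam E \<B>" "insert s' (insert p ?S) \<notin> dfam E \<B>"
    using dual_add[OF st2(1) st(2) st2(2), of s p] dual_add[OF st2(1) st(2) st2(2), of s' p] sp sp' s s' unfolding e by auto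
  have n2: "(?S - {r}) \<union> ({l,p,y,x} - {l}) \<notin> dfam E \<B>"
    using dual_remove[OF st2(1) st(2) st2(2) r, of l] rl unfolding e eqT[symmetric] by auto
  have n3: "\<not> d.tri (?S - {r}) s l y" unfolding d.tri_def using dual_bad[OF st(1,3,2) d s r] b by blast
  have d2: "distinct [p,l,y,x]" "distinct [l,p,y,x]" using d by auto
  have n4: "\<not> d.tri (?S - {r}) s' l x" unfolding d.tri_def
    using dual_bad[OF st(1,3,2)[unfolded eqT2] d2(1) s' r[unfolded eqT2]] b eqT2 by simp
  show False using d.bad_same_series[OF w2 d2(2) _ sE ss n1 n2 n3 n4] r by blast
qed

text \<open>The dual of \<open>bad_two_parallel_labels\<close>: a bad triple at \<open>p, x\<close>
  excludes \<open>x\<close> as a series label.\<close>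

lemma bad_two_series_labels:
  assumes w: "wit \<B> S {p,l,x,y}" and d: "distinct [p,l,x,y]" and s: "s \<in> S" and s': "s' \<in> S"
    and r: "r \<in> E - S - {p,l,x,y}"
    and rl: "insert r (insert l S) \<notin> \<B>"
    and sp: "(S - {s}) \<union> ({p,l,x,y} - {p}) \<notin> \<B>" and sp': "(S - {s'}) \<union> ({p,l,x,y} - {x}) \<notin> \<B>"
    and b: "\<not> tri (S - {s}) r p x"
  shows False
proof -
  interpret d: no_small_minor E "dfam E \<B>" by (rule dual_no_small_minor)
  let ?T = "{p,l,x,y}" and ?S = "E - S - {p,l,x,y}"
  have eqT: "?T = {l,p,y,x}" by auto
  have st: "S \<subseteq> E" "?T \<subseteq> E" "S \<inter> ?T = {}" using wit_sub[OF w] w unfolding wit_def by blast+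
  have e: "E - ?S - ?T = S" using st by auto
  have w2: "wit (dfam E \<B>) ?S {l,p,y,x}" using wit_dual[OF w] eqT by simp
  have sE: "s \<in> E - ?S - {l,p,y,x}" "s' \<in> E - ?S - {l,p,y,x}" using s s' e eqT by auto
  have st2: "?S \<subseteq> E" "?S \<inter> ?T = {}" by auto
  have n1: "insert s (insert p ?S) \<notin> dfam E \<B>" "insert s' (insert x ?S) \<notin> dfam E \<B>"
    using dual_add[OF st2(1) st(2) st2(2), of s p] dual_add[OF st2(1) st(2) st2(2), of s' x] sp sp' s s' unfolding e by auto
  have n2: "(?S - {r}) \<union> ({l,p,y,x} - {l}) \<notin> dfam E \<B>"
    using dual_remove[OF st2(1) st(2) st2(2) r, of l] rl unfolding e eqT[symmetric] by auto
  have n3: "\<not> d.tri (?S - {r}) s l y" unfolding d.tri_def using dual_bad[OF st(1,3,2) d s r] b by blast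
  have d2: "distinct [l,p,y,x]" using d by auto
  show False using d.bad_two_parallel_labels[OF w2 d2 _ sE n1 n2 n3] r by blast
qed

text \<open>The preceding lemmas turn the mixed triples that are needed into bases. Then
  \<open>s, s', y, r'\<close> is a four-point line over \<open>S - {s,s'} + p + x\<close>, on which
  \<open>r\<close> is parallel and \<open>x\<close> is in series to the same point
  \<open>s'\<close>; this contradicts \<open>labels_disjoint\<close>.\<close>

lemma bad_disjoint:
  assumes w: "wit \<B> S {p,l,x,y}" and d: "distinct [p,l,x,y]" and s: "s \<in> S" and s': "s' \<in> S" and ss: "s \<noteq> s'"
    and r: "r \<in> E - S - {p,l,x,y}" and r': "r' \<in> E - S - {p,l,x,y}" and rr: "r \<noteq> r'"
    and rl: "insert r (insert l S) \<notin> \<B>" and rl': "insert r' (insert l S) \<notin> \<B>"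
    and sp: "(S - {s}) \<union> ({p,l,x,y} - {p}) \<notin> \<B>" and sp': "(S - {s'}) \<union> ({p,l,x,y} - {p}) \<notin> \<B>"
    and b: "\<not> tri (S - {s}) r p x" "\<not> tri (S - {s'}) r' p y"
  shows False
proof -
  note F = frame[OF w d s r rl sp] and F' = frame[OF w d s' r' rl' sp']
  define Z where "Z = S - {s,s'}"
  have Zs: "S - {s} = insert s' Z" "S - {s'} = insert s Z" "S = insert s (insert s' Z)"
    using s s' ss Z_def by auto
  have m1: "tri (S - {s}) r' p x"
    using bad_same_parallel[OF w d s s' ss r' rl' sp sp'] b by blast
  have m2: "tri (S - {s}) r' p y"
    using bad_same_series[OF w d s r r' rr rl rl' sp b(1)] by blast
  have m3: "tri (S - {s'}) r' p x"
    using bad_once[OF w d s' r' rl' sp'] b(2) by blast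
  have dd: "distinct [s,s',p,l,x,y,r,r']" "Z \<inter> {s,s',p,l,x,y,r,r'} = {}"
    using F(11-15) F'(11-15) d r r' rr ss s s' Z_def by auto
  have fS: "finite S" using wit_card[OF w] by blast
  let ?S2 = "insert p (insert x Z)" and ?U = "insert p (insert y Z)"
  have cZ: "card Z + 4 = rk" using wit_card(1)[OF w] fS dd unfolding Zs(3) by simp
  have "card ?U + 2 = rk" using cZ dd fS Z_def by simp
  moreover have "insert s (insert x ?U) \<in> \<B>" using F'(5) unfolding tri_def Zs(1,2) by (simp add: insert_commute)
  moreover have "insert r' (insert s ?U) \<notin> \<B>" using b(2) unfolding tri_def Zs(1,2) by (simp add: insert_commute)
  moreover have "insert r' (insert s' ?U) \<in> \<B>" using m2 unfolding tri_def Zs(1,2) by (simp add: insert_commute)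
  ultimately have yr: "insert r' (insert x ?U) \<in> \<B>" by (rule line_exchange)
  have w2: "wit \<B> ?S2 {s,s',y,r'}"
  proof (rule witI)
    show "distinct [s,s',y,r']" "?S2 \<inter> {s,s',y,r'} = {}" using dd by auto
    have "insert p (insert x S) \<in> \<B>" using witD[OF w, of p x] d by auto
    then show "insert s (insert s' ?S2) \<in> \<B>" unfolding Zs(3) by (simp add: insert_commute)
    show "insert s (insert y ?S2) \<in> \<B>" using F'(5) unfolding tri_def Zs(1,2) by (simp add: insert_commute)
    show "insert s' (insert y ?S2) \<in> \<B>" using F(5) unfolding tri_def Zs(1,2) by (simp add: insert_commute)
    show "insert s (insert r' ?S2) \<in> \<B>" using m3 unfolding tri_def Zs(1,2) by (simp add: insert_commute)
    show "insert s' (insert r' ?S2) \<in> \<B>" using m1 unfolding tri_def Zs(1,2) by (simp add: insert_commute)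
    show "insert y (insert r' ?S2) \<in> \<B>" using yr by (simp add: insert_commute)
  qed
  show False
  proof (rule labels_disjoint[OF w2, of r x s'])
    show "r \<in> E - ?S2 - {s,s',y,r'}" using F(11) dd by auto
    show "insert r (insert s' ?S2) \<notin> \<B>" using b(1) unfolding tri_def Zs(1,2) by (simp add: insert_commute)
    have "?S2 - {x} \<union> ({s,s',y,r'} - {s'}) = insert r' (insert p (insert y (insert s Z)))" using dd by auto
    then show "?S2 - {x} \<union> ({s,s',y,r'} - {s'}) \<notin> \<B>" using b(2) unfolding tri_def Zs(1,2) by simp
  qed auto
qed

text \<open>Complete \<open>S\<close> by two points of \<open>T\<close> that include all series
  labels and no parallel label. If the result is not free, its bad triple forces \<open>p\<close> to
  be the only series label and \<open>l\<close> the only parallel one. Then \<open>{p, y}\<close> is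
  a second such choice, and its bad triple clashes with the first one whether or not they share
  \<open>s\<close> or \<open>r\<close>.\<close>

theorem free_base_through:
  assumes w: "wit \<B> S T"
  shows "\<exists>H. free_base E \<B> H \<and> through H S T"
proof (rule ccontr)
  assume none: "\<not> ?thesis"
  define R where "R = E - S - T"
  have st: "S \<subseteq> E" "T \<subseteq> E" "S \<inter> T = {}" "card T = 4" "finite T"
    using wit_sub[OF w] w wit_card[OF w] unfolding wit_def by blast+
  have "\<forall>r\<in>R. \<exists>l. l \<in> T \<and> (\<forall>t\<in>T. insert r (insert t S) \<in> \<B> \<longleftrightarrow> t \<noteq> l)"
    using parallel_label[OF w] R_def by blast
  then obtain lm where lm: "\<And>r. r \<in> R \<Longrightarrow> lm r \<in> T" "\<And>r t. r \<in> R \<Longrightarrow> t \<in> T \<Longrightarrow> insert r (insert t S) \<in> \<B> \<longleftrightarrow> t \<noteq> lm r"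
    by metis
  have "\<forall>s\<in>S. \<exists>l. l \<in> T \<and> (\<forall>t\<in>T. (S - {s}) \<union> (T - {t}) \<in> \<B> \<longleftrightarrow> t \<noteq> l)"
    using series_label[OF w] by blast
  then obtain sg where sg: "\<And>s. s \<in> S \<Longrightarrow> sg s \<in> T" "\<And>s t. s \<in> S \<Longrightarrow> t \<in> T \<Longrightarrow> (S - {s}) \<union> (T - {t}) \<in> \<B> \<longleftrightarrow> t \<noteq> sg s"
    by metis
  define L where "L = lm ` R"
  define G where "G = sg ` S"
  have sub: "L \<subseteq> T" "G \<subseteq> T" using lm sg L_def G_def by auto
  have fin: "finite L" "finite G" using sub st finite_subset by blast+
  have three: "\<exists>a b c. {a,b,c} \<subseteq> A \<and> distinct [a,b,c]" if c: "\<not> card A \<le> 2" for A :: "'a set"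
  proof -
    obtain A' where "A' \<subseteq> A" "card A' = 3" using c obtain_subset_with_card_n[of 3 A] by auto
    then show ?thesis using card3E[of A'] by metis
  qed
  have cL: "card L \<le> 2"
  proof (rule ccontr)
    assume "\<not> card L \<le> 2"
    then obtain a b c where abc: "{a,b,c} \<subseteq> L" "distinct [a,b,c]" using three by blast
    then obtain ra rb rc where rs: "ra \<in> R" "lm ra = a" "rb \<in> R" "lm rb = b" "rc \<in> R" "lm rc = c" unfolding L_def by auto
    show False by (rule noK[OF w, of ra rb rc a b c]) (use rs abc lm sub R_def in auto)
  qed
  have cG: "card G \<le> 2"
  proof (rule ccontr)
    assume "\<not> card G \<le> 2"
    then obtain a b c where abc: "{a,b,c} \<subseteq> G" "distinct [a,b,c]" using three by blast
    then obtain ra rb rc where rs: "ra \<in> S" "sg ra = a" "rb \<in> S" "sg rb = b" "rc \<in> S" "sg rc = c" unfolding G_def by auto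
    show False by (rule noKdual[OF w, of ra rb rc a b c]) (use rs abc sg sub in auto)
  qed
  have LG: "L \<inter> G = {}"
  proof (rule ccontr)
    assume "L \<inter> G \<noteq> {}"
    then obtain r s where rs: "r \<in> R" "s \<in> S" "lm r = sg s" unfolding L_def G_def by auto
    show False using labels_disjoint[OF w, of r s "lm r"] rs lm sg R_def by auto
  qed
  have pr: "insert a (insert b S) \<in> \<B>" if "a \<in> T" "b \<in> T" "a \<noteq> b" for a b using witD[OF w that] .
  have bad: "\<exists>s\<in>S. \<exists>r\<in>R. \<not> tri (S - {s}) r q1 q2"
    if q: "T = {q1,q2,q3,q4}" "distinct [q1,q2,q3,q4]" "G \<subseteq> {q1,q2}" "L \<inter> {q1,q2} = {}" for q1 q2 q3 q4
  proof (rule ccontr)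
    assume nb: "\<not> ?thesis"
    let ?H = "insert q1 (insert q2 S)"
    have Hb: "?H \<in> \<B>" using pr q by auto
    have nS: "q1 \<notin> S" "q2 \<notin> S" "q3 \<notin> S" "q4 \<notin> S" using q st by auto
    have t1: "insert q3 (insert q1 (insert q2 (S - {s}))) \<in> \<B>" "insert q4 (insert q1 (insert q2 (S - {s}))) \<in> \<B>" if s: "s \<in> S" for s
    proof -
      have "sg s \<in> {q1,q2}" using q s G_def by auto
      then have "(S - {s}) \<union> (T - {q4}) \<in> \<B>" "(S - {s}) \<union> (T - {q3}) \<in> \<B>" using sg(2)[OF s] q by auto
      moreover have "(S - {s}) \<union> (T - {q4}) = insert q3 (insert q1 (insert q2 (S - {s})))"
        "(S - {s}) \<union> (T - {q3}) = insert q4 (insert q1 (insert q2 (S - {s})))" using q by auto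
      ultimately show "insert q3 (insert q1 (insert q2 (S - {s}))) \<in> \<B>" "insert q4 (insert q1 (insert q2 (S - {s}))) \<in> \<B>" by auto
    qed
    have t2: "insert r (insert q1 (insert q2 (S - {s}))) \<in> \<B>" if "s \<in> S" "r \<in> R" for s r
      using nb that unfolding tri_def by blast
    have t3: "insert r (insert q1 S) \<in> \<B>" "insert r (insert q2 S) \<in> \<B>" if r: "r \<in> R" for r
      using lm(2)[OF r] r q L_def by auto
    have t4: "insert a (insert b S) \<in> \<B>" if "a \<in> {q3,q4}" "b \<in> {q1,q2}" for a b using pr that q by auto
    have "insert e (?H - {h}) \<in> \<B>" if he: "h \<in> ?H" "e \<in> E - ?H" for h e
    proof -
      have eR: "e \<in> R \<or> e = q3 \<or> e = q4" using he q R_def by auto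
      consider "h \<in> S" | "h = q1" | "h = q2" using he by auto
      then show ?thesis
      proof cases
        case 1
        then have "?H - {h} = insert q1 (insert q2 (S - {h}))" using nS by auto
        then show ?thesis using t1[OF 1] t2[OF 1] eR by auto
      next
        case 2
        then have "?H - {h} = insert q2 S" using nS q by auto
        then show ?thesis using t3[of e] t4[of e q2] eR by auto
      next
        case 3
        then have "?H - {h} = insert q1 S" using nS q by auto
        then show ?thesis using t3[of e] t4[of e q1] eR by auto
      qed
    qed
    then have "free_base E \<B> ?H" using Hb unfolding free_base_def by blast
    moreover have "through ?H S T" using q by (auto simp: through_def)
    ultimately show False using none by blast
  qed
  have "card (T - L) \<ge> 2" using cL sub st fin by (simp add: card_Diff_subset)
  \<comment> \<open>There are at most two series labels, they avoid the parallel labels, and at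
    least two points of \<open>T\<close> carry no parallel label; so a two-point set fits in
    between.\<close>
  then obtain Q where Q: "G \<subseteq> Q" "Q \<subseteq> T - L" "card Q = 2"
    using exists_subset_between[of G 2 "T - L"] cG sub LG st by auto
  obtain q1 q2 where q12: "Q = {q1,q2}" "q1 \<noteq> q2" using Q card_2_iff by metis
  have "Q \<subseteq> T" "finite Q" using Q(2) st finite_subset by blast+
  then have "card (T - Q) = 2" using Q(3) st by (simp add: card_Diff_subset)
  then obtain q3 q4 where q34: "T - Q = {q3,q4}" "q3 \<noteq> q4" using card_2_iff by metis
  have Tq: "T = {q1,q2,q3,q4}" "distinct [q1,q2,q3,q4]" using q12 q34 Q by auto
  obtain s r where sr: "s \<in> S" "r \<in> R" "\<not> tri (S - {s}) r q1 q2"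
    using bad[OF Tq] Q q12 by auto
  define p where "p = sg s"
  define l where "l = lm r"
  have pQ: "p \<in> {q1,q2}" using Q q12 sr G_def p_def by auto
  have lQ: "l \<in> {q3,q4}" using Q q12 sr L_def l_def lm(1)[OF sr(2)] Tq by auto
  obtain x where x: "{q1,q2} = {p,x}" "x \<noteq> p" using pQ Tq by auto
  obtain y where y: "{q3,q4} = {l,y}" "y \<noteq> l" using lQ Tq by auto
  have Te: "T = {p,l,x,y}" using Tq x y by auto
  have d: "distinct [p,l,x,y]" using Tq x y by auto
  have bx: "\<not> tri (S - {s}) r p x" using sr(3) x Tq by (auto simp: doubleton_eq_iff tri_perm)
  have Rm: "\<And>r. r \<in> R \<Longrightarrow> r \<in> E - S - {p,l,x,y}" using R_def Te by auto
  have wT: "wit \<B> S {p,l,x,y}" using w Te by simp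
  have rl: "insert r (insert (lm r) S) \<notin> \<B>" if "r \<in> R" for r using lm[OF that] by blast
  have sp: "(S - {s}) \<union> ({p,l,x,y} - {sg s}) \<notin> \<B>" if "s \<in> S" for s using sg[OF that] Te by blast
  have yL: "y \<notin> L"
  proof
    assume "y \<in> L"
    then obtain r' where r': "r' \<in> R" "lm r' = y" unfolding L_def by auto
    show False using bad_two_parallel_labels[OF wT d sr(1) Rm[OF sr(2)] Rm[OF r'(1)] _ _ _ bx] rl[OF sr(2)] rl[OF r'(1)] sp[OF sr(1)] r'
      unfolding p_def[symmetric] l_def[symmetric] by simp
  qed
  have xG: "x \<notin> G"
  proof
    assume "x \<in> G"
    then obtain s' where s': "s' \<in> S" "sg s' = x" unfolding G_def by auto
    show False using bad_two_series_labels[OF wT d sr(1) s'(1) Rm[OF sr(2)] _ _ _ bx] rl[OF sr(2)] sp[OF s'(1)] sp[OF sr(1)] s'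
      unfolding p_def[symmetric] l_def[symmetric] by simp
  qed
  have G1: "G \<subseteq> {p}" using xG Q q12 x by auto
  have L1: "L \<subseteq> {l}" using yL Q q12 x Te sub by auto
  have pL: "p \<notin> L" using LG sr(1) G_def p_def by auto
  have Te2: "T = {p,y,l,x}" using Te by auto
  obtain s' r' where sr': "s' \<in> S" "r' \<in> R" "\<not> tri (S - {s'}) r' p y"
    using bad[OF Te2] G1 pL yL d by auto
  have e1: "sg s' = p" "lm r' = l" using G1 L1 sr' G_def L_def by auto
  note h = rl[OF sr(2), folded l_def] rl[OF sr'(2), unfolded e1] sp[OF sr(1), folded p_def] sp[OF sr'(1), unfolded e1]
  consider "s = s'" "r = r'" | "s = s'" "r \<noteq> r'" | "s \<noteq> s'" "r = r'" | "s \<noteq> s'" "r \<noteq> r'" by blast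
  then show False
  proof cases
    case 1
    then show ?thesis using bad_once[OF wT d sr(1) Rm[OF sr(2)] h(1,3) bx] sr' by simp
  next
    case 2
    then show ?thesis using bad_same_series[OF wT d sr(1) Rm[OF sr(2)] Rm[OF sr'(2)] _ h(1,2,3) bx] sr' by simp
  next
    case 3
    then show ?thesis using bad_same_parallel[OF wT d sr(1) sr'(1) _ Rm[OF sr(2)] h(1,3,4) bx] sr' by simp
  next
    case 4
    then show ?thesis using bad_disjoint[OF wT d sr(1) sr'(1) _ Rm[OF sr(2)] Rm[OF sr'(2)] _ h bx] sr' by simp
  qed
qed

end

section \<open>Four-point lines through a free basis\<close>

context base_family begin

text \<open>Freeness in the restriction to \<open>F\<close>. It is needed because minimality
  provides bases that are free only after one element has been deleted.\<close>

definition free_in :: "'a set \<Rightarrow> 'a set \<Rightarrow> bool" where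
  "free_in F H \<longleftrightarrow> F \<subseteq> E \<and> H \<subseteq> F \<and> H \<in> \<B> \<and> (\<forall>h\<in>H. \<forall>e\<in>F - H. insert e (H - {h}) \<in> \<B>)"

text \<open>The value of the two-by-two minor with rows \<open>h, h'\<close> in \<open>H\<close> and
  columns \<open>f, f'\<close> outside. A repeated row or column counts as zero, so the parity laws
  below hold for all choices of indices.\<close>

definition act :: "'a set \<Rightarrow> 'a \<Rightarrow> 'a \<Rightarrow> 'a \<Rightarrow> 'a \<Rightarrow> bool" where
  "act H h h' f f' \<longleftrightarrow> h \<noteq> h' \<and> f \<noteq> f' \<and> insert f (insert f' (H - {h,h'})) \<in> \<B>"

lemma act_sym: "act H h h' f f' = act H h' h f f'" "act H h h' f f' = act H h h' f' f"
  unfolding act_def by (auto simp: insert_commute)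

lemma free_in_E: "free_base E \<B> H \<longleftrightarrow> free_in E H"
  unfolding free_base_def free_in_def using sub by blast

lemma free_in_sub: "free_base E \<B> H \<Longrightarrow> F \<subseteq> E \<Longrightarrow> H \<subseteq> F \<Longrightarrow> free_in F H"
  unfolding free_base_def free_in_def by blast

lemma free_pairs:
  assumes H: "free_in F H" and h: "h \<in> H" "h' \<in> H" "h \<noteq> h'" and f: "f \<in> F - H"
  shows "insert f (insert h (H - {h,h'})) \<in> \<B>" "insert h (insert h' (H - {h,h'})) \<in> \<B>"
    "card (H - {h,h'}) + 2 = rk"
proof -
  have "insert f (insert h (H - {h,h'})) = insert f (H - {h'})" using h by auto
  then show "insert f (insert h (H - {h,h'})) \<in> \<B>" using H h f unfolding free_in_def by auto
  have "insert h (insert h' (H - {h,h'})) = H" using h by auto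
  moreover have HB: "H \<in> \<B>" using H unfolding free_in_def by blast
  ultimately show "insert h (insert h' (H - {h,h'})) \<in> \<B>" by simp
  have "card {h,h'} \<le> card H" using h finB[OF HB] by (intro card_mono) auto
  then show "card (H - {h,h'}) + 2 = rk" using h cardB[OF HB] by (simp add: card_Diff_subset)
qed

lemma act_wit:
  assumes H: "free_in F H" and h: "h \<in> H" "h' \<in> H" and f: "f \<in> F - H" "f' \<in> F - H" and a: "act H h h' f f'"
  shows "wit \<B> (H - {h,h'}) {h,h',f,f'}" "through H (H - {h,h'}) {h,h',f,f'}"
proof -
  have ne: "h \<noteq> h'" "f \<noteq> f'" using a unfolding act_def by auto
  have e: "H - {h',h} = H - {h,h'}" by auto
  note p1 = free_pairs[OF H h(1,2) ne(1)] and p2 = free_pairs[OF H h(2,1) ne(1)[symmetric], unfolded e]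
  show "wit \<B> (H - {h,h'}) {h,h',f,f'}"
  proof (rule witI)
    show "insert h (insert h' (H - {h,h'})) \<in> \<B>" by (rule p1(2)[OF f(1)])
    show "insert h (insert f (H - {h,h'})) \<in> \<B>" "insert h (insert f' (H - {h,h'})) \<in> \<B>"
      using p1(1)[OF f(1)] p1(1)[OF f(2)] by (simp_all add: insert_commute)
    show "insert h' (insert f (H - {h,h'})) \<in> \<B>" "insert h' (insert f' (H - {h,h'})) \<in> \<B>"
      using p2(1)[OF f(1)] p2(1)[OF f(2)] by (simp_all add: insert_commute)
    show "insert f (insert f' (H - {h,h'})) \<in> \<B>" using a unfolding act_def by blast
  qed (use h f ne in auto)
  show "through H (H - {h,h'}) {h,h',f,f'}" unfolding through_def by auto
qed

lemma through_act:
  assumes H: "H \<in> \<B>" and w: "wit \<B> S T" and t: "through H S T"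
  obtains h h' f f' where "h \<in> H" "h' \<in> H" "f \<in> E - H" "f' \<in> E - H" "S = H - {h,h'}" "T = {h,h',f,f'}"
    "act H h h' f f'" "distinct [h,h',f,f']"
proof -
  have st: "S \<inter> T = {}" "card T = 4" "T \<subseteq> E" "finite T" using w wit_sub[OF w] wit_card[OF w] unfolding wit_def by auto
  obtain h h' where h: "h \<in> T" "h' \<in> T" "h \<noteq> h'" "H = insert h (insert h' S)"
    using through_base[OF base_family_axioms w t cardB[OF H]] by blast
  have "card (T - {h,h'}) = 2" using h st by (simp add: card_Diff_subset)
  then obtain f f' where f: "T - {h,h'} = {f,f'}" "f \<noteq> f'" using card_2_iff by metis
  have T: "T = {h,h',f,f'}" using f h by auto
  have d: "distinct [h,h',f,f']" using f h by auto
  have S: "S = H - {h,h'}" using h st by auto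
  have fH: "f \<in> E - H" "f' \<in> E - H" using T st h d by auto
  have "insert f (insert f' S) \<in> \<B>" using witD[OF w, of f f'] T d by auto
  then have "act H h h' f f'" unfolding act_def using S d by auto
  then show thesis using that[of h h' f f'] h fH S T d by blast
qed

end

context no_small_minor begin

text \<open>Over \<open>H - {h,h'}\<close> no column is a loop, because it pairs with
  \<open>h\<close>; so inactive pairs are parallel, and exactly one active pair among three columns
  is impossible. Three active pairs would make \<open>h, h', f, f', f''\<close> a five-point line.
  The number of active pairs is therefore even.\<close>

lemma act_cols:
  assumes H: "free_in F H" and h: "h \<in> H" "h' \<in> H" and f: "f \<in> F - H" "f' \<in> F - H" "f'' \<in> F - H"
  shows "act H h h' f f'' \<longleftrightarrow> act H h h' f f' \<noteq> act H h h' f' f''"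
proof (cases "distinct [f,f',f''] \<and> h \<noteq> h'")
  case False
  then show ?thesis unfolding act_def by (auto simp: insert_commute)
next
  case True
  let ?S = "H - {h,h'}"
  have ne: "h \<noteq> h'" "f \<noteq> f'" "f' \<noteq> f''" "f \<noteq> f''" using True by auto
  have e: "H - {h',h} = H - {h,h'}" by auto
  note p1 = free_pairs[OF H h(1,2) ne(1)] and p2 = free_pairs[OF H h(2,1) ne(1)[symmetric], unfolded e]
  note lx = line_exchange[OF p1(3)[OF f(1)]]
  have a: "act H h h' x y \<longleftrightarrow> insert x (insert y ?S) \<in> \<B>" if "x \<noteq> y" for x y using ne that unfolding act_def by blast
  have a': "act H h h' x y \<longleftrightarrow> act H h h' y x" for x y by (rule act_sym(2))
  have "act H h h' z y" if "act H h h' x y" "\<not> act H h h' z x" "x \<noteq> y" "z \<noteq> x" "z \<noteq> y" "z \<in> F - H" for x y z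
    using lx[of x y z h] p1(1)[of z] that a by metis
  then have i: "act H h h' f f''" if "act H h h' f' f'' \<noteq> act H h h' f f'"
    using that a' ne f by metis
  have i2: "act H h h' f' f''" if "act H h h' f f''" "\<not> act H h h' f f'"
    using that a' ne f \<open>\<And>z y x. \<lbrakk>act H h h' x y; \<not> act H h h' z x; x \<noteq> y; z \<noteq> x; z \<noteq> y; z \<in> F - H\<rbrakk> \<Longrightarrow> act H h h' z y\<close>
    by metis
  have "False" if "act H h h' f f'" "act H h h' f' f''" "act H h h' f f''"
  proof -
    have w: "wit \<B> ?S {h,h',f,f'}" by (rule act_wit(1)[OF H h f(1,2) that(1)])
    have FE: "F \<subseteq> E" using H unfolding free_in_def by blast
    have r: "f'' \<in> E - ?S - {h,h',f,f'}" using f ne h FE by auto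
    have "insert f'' (insert t ?S) \<in> \<B>" if t: "t \<in> {h,h',f,f'}" for t
      using t p1(1)[OF f(3)] p2(1)[OF f(3)] that a a' ne \<open>act H h h' f' f''\<close> \<open>act H h h' f f''\<close> by (metis empty_iff insert_iff)
    then show False using noU25[OF w r] by blast
  qed
  then show ?thesis using i i2 by blast
qed

text \<open>The same parity for rows, worked out over \<open>H\<close> without the three rows:
  exchange excludes exactly one active pair, and \<open>noU35\<close> excludes three.\<close>

lemma act_rows:
  assumes H: "free_in F H" and h: "h \<in> H" "h' \<in> H" "h'' \<in> H" and f: "f \<in> F - H" "f' \<in> F - H"
  shows "act H h h'' f f' \<longleftrightarrow> act H h h' f f' \<noteq> act H h' h'' f f'"
proof (cases "distinct [h,h',h''] \<and> f \<noteq> f'")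
  case False
  then show ?thesis unfolding act_def by (auto simp: insert_commute)
next
  case True
  have ne: "h \<noteq> h'" "h' \<noteq> h''" "h \<noteq> h''" "f \<noteq> f'" using True by auto
  define Z where "Z = H - {h,h',h''}"
  have HB: "H \<in> \<B>" using H unfolding free_in_def by blast
  have "card {h,h',h''} \<le> card H" using h finB[OF HB] by (intro card_mono) auto
  then have cZ: "card Z + 3 = rk" using h ne cardB[OF HB] Z_def by (simp add: card_Diff_subset)
  have s: "H - {h,h'} = insert h'' Z" "H - {h,h''} = insert h' Z" "H - {h',h''} = insert h Z"
    using h ne Z_def by auto
  have a: "act H h h' f f' \<longleftrightarrow> tri Z f f' h''" "act H h h'' f f' \<longleftrightarrow> tri Z f f' h'" "act H h' h'' f f' \<longleftrightarrow> tri Z f f' h"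
    unfolding act_def s tri_def using ne by auto
  have p: "tri Z x h h'" "tri Z x h h''" "tri Z x h' h''" if "x \<in> F - H" for x
  proof -
    have "H - {h''} = insert h (insert h' Z)" "H - {h'} = insert h (insert h'' Z)" "H - {h} = insert h' (insert h'' Z)"
      using h ne Z_def by auto
    then show "tri Z x h h'" "tri Z x h h''" "tri Z x h' h''"
      using H that h unfolding free_in_def tri_def by metis+
  qed
  note ex = tri_exchange[OF cZ]
  have 1: "tri Z f f' h \<or> tri Z f f' h''" if "tri Z f f' h'" using ex[OF p(2)[OF f(1)] that] .
  have 2: "tri Z f f' h \<or> tri Z f f' h'" if "tri Z f f' h''" using ex[OF p(1)[OF f(1)] that] .
  have 3: "tri Z f f' h' \<or> tri Z f f' h''" if "tri Z f f' h" using ex[OF p(3)[OF f(1)] that] .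
  have "False" if t: "tri Z f f' h" "tri Z f f' h'" "tri Z f f' h''"
  proof -
    have act: "act H h h' f f'" using t a by blast
    have w: "wit \<B> (H - {h,h'}) {h,h',f,f'}" by (rule act_wit(1)[OF H h(1,2) f act])
    have z: "H - {h,h'} - {h''} = Z" using Z_def by auto
    have T: "Z \<union> ({h,h',f,f'} - {h}) = insert f (insert f' (insert h' Z))"
      "Z \<union> ({h,h',f,f'} - {h'}) = insert f (insert f' (insert h Z))"
      "Z \<union> ({h,h',f,f'} - {f}) = insert f' (insert h (insert h' Z))"
      "Z \<union> ({h,h',f,f'} - {f'}) = insert f (insert h (insert h' Z))" using ne h f by auto
    have "Z \<union> ({h,h',f,f'} - {u}) \<in> \<B>" if u: "u \<in> {h,h',f,f'}" for u
    proof -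
      from u consider "u = h" | "u = h'" | "u = f" | "u = f'" by blast
      then show ?thesis using T t p(1)[OF f(1)] p(1)[OF f(2)] unfolding tri_def by cases simp_all
    qed
    then show False using noU35[OF w, of h''] h ne unfolding z by blast
  qed
  then show ?thesis unfolding a using 1 2 3 by blast
qed

text \<open>A line through \<open>G\<close> that contracts \<open>g\<close> or deletes
  \<open>k\<close> would be the only way to miss \<open>H\<close>; parity shows that no line through
  \<open>G\<close> does so.\<close>

lemma adjacent_free_same_wits:
  assumes H: "free_in F H" and G: "free_in F G" and adj: "G = insert g (H - {k})" "k \<in> H" "g \<in> F - H"
    and w: "wit \<B> S T" "through G S T" "S \<union> T \<subseteq> F"
  shows "through H S T"
proof -
  have GB: "G \<in> \<B>" using G unfolding free_in_def by blast
  obtain u v p q where uv: "u \<in> G" "v \<in> G" "p \<in> E - G" "q \<in> E - G" "S = G - {u,v}" "T = {u,v,p,q}" "act G u v p q" "distinct [u,v,p,q]"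
    using through_act[OF GB w(1,2)] .
  have pq: "p \<in> F - G" "q \<in> F - G" using uv w(3) by auto
  have gG: "g \<in> G" and kG: "k \<in> F - G" using adj H unfolding free_in_def by auto
  \<comment> \<open>The base at distance two from \<open>G\<close> is a neighbour of the free base
    \<open>H\<close>: row \<open>g\<close> with any other row is active on every pair of columns
    containing \<open>k\<close>. By column parity it is inactive on all other pairs.\<close>
  have A: "act G g a k b" if a: "a \<in> G" "a \<noteq> g" and b: "b \<in> F - G" "b \<noteq> k" for a b
  proof -
    have "insert k (insert b (G - {g,a})) = insert b (H - {a})" using adj a b by auto
    moreover have "a \<in> H" "b \<in> F - H" using a b adj by auto
    ultimately show ?thesis using H a b unfolding act_def free_in_def by auto
  qed
  have B: "\<not> act G g a b c" if a: "a \<in> G" "a \<noteq> g" and b: "b \<in> F - G" "b \<noteq> k" "c \<in> F - G" "c \<noteq> k" for a b c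
    using act_cols[OF G gG a(1) b(1) kG b(3)] A[OF a b(1,2)] A[OF a b(3,4)] act_sym(2) by metis
  \<comment> \<open>Were \<open>g\<close> not among the two rows, both would have the same activity
    with \<open>g\<close>, and row parity would make them inactive together.\<close>
  have g1: "g \<in> {u,v}"
  proof (rule ccontr)
    assume n: "g \<notin> {u,v}"
    have X: "act G g a p q \<longleftrightarrow> p = k \<or> q = k" if "a \<in> G" "a \<noteq> g" for a
    proof -
      consider "p = k" | "q = k" | "p \<noteq> k" "q \<noteq> k" by blast
      then show ?thesis
      proof cases
        case 1
        then show ?thesis using A[OF that pq(2)] uv(8) by auto
      next
        case 2
        then show ?thesis using A[OF that pq(1)] uv(8) act_sym(2)[of G g a p q] by auto
      next
        case 3
        then show ?thesis using B[OF that pq(1) _ pq(2)] by blast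
      qed
    qed
    have "act G u g p q \<longleftrightarrow> act G g v p q"
      using X[OF uv(1)] X[OF uv(2)] n act_sym(1)[of G u g p q] by auto
    then show False using act_rows[OF G uv(1) gG uv(2) pq] uv(7) by blast
  qed
  have k1: "k \<in> {p,q}"
  proof (rule ccontr)
    assume n: "k \<notin> {p,q}"
    then show False using B[of u p q] B[of v p q] uv pq g1 act_sym(1)[of G u v p q] by auto
  qed
  have "S \<subseteq> H" using uv(5) adj g1 by auto
  moreover have "H \<subseteq> S \<union> T" using uv(5,6) adj g1 k1 by auto
  ultimately show ?thesis by (simp add: through_def)
qed

end

section \<open>The structure of excluded minors\<close>

text \<open>Deleting an element off a line, or contracting one in its \<open>S\<close>, leaves a
  nonbinary member of the class, which has a free base on all its lines. Both bases are stated
  inside \<open>E\<close>, with \<open>e\<close> put back after a contraction, so that lines need no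
  translation.\<close>

locale minor_minimal = base_family E \<B> for E :: "'a set" and \<B> +
  assumes deletion: "wit \<B> S T \<Longrightarrow> e \<in> E - S - T \<Longrightarrow>
      \<exists>G\<in>\<B>. e \<notin> G \<and> (\<forall>h\<in>G. \<forall>f\<in>E - G - {e}. insert f (G - {h}) \<in> \<B>) \<and>
        (\<forall>S T. wit \<B> S T \<longrightarrow> e \<notin> S \<union> T \<longrightarrow> through G S T)"
    and contraction: "wit \<B> S T \<Longrightarrow> e \<in> S \<Longrightarrow>
      \<exists>G\<in>\<B>. e \<in> G \<and> (\<forall>h\<in>G - {e}. \<forall>f\<in>E - G. insert f (G - {h}) \<in> \<B>) \<and>
        (\<forall>S T. wit \<B> S T \<longrightarrow> e \<in> S \<longrightarrow> through G S T)"
    and not_good: "\<not> good E \<B>"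
begin

lemma dual_minor_minimal: "minor_minimal E (dfam E \<B>)"
proof -
  interpret d: base_family E "dfam E \<B>" by (rule dual_family)
  show ?thesis
  proof
    show "\<not> good E (dfam E \<B>)" using not_good good_dual_iff by blast
  next
    fix S T e assume w: "wit (dfam E \<B>) S T" and e: "e \<in> E - S - T"
    note ww = dual_witE[OF w]
    obtain G where G: "G \<in> \<B>" "e \<in> G" "\<And>h f. h \<in> G - {e} \<Longrightarrow> f \<in> E - G \<Longrightarrow> insert f (G - {h}) \<in> \<B>"
      "\<And>S T. wit \<B> S T \<Longrightarrow> e \<in> S \<Longrightarrow> through G S T" using contraction[OF ww(1) e] by blast
    have GE: "G \<subseteq> E" using sub[OF G(1)] .
    show "\<exists>G\<in>dfam E \<B>. e \<notin> G \<and> (\<forall>h\<in>G. \<forall>f\<in>E - G - {e}. insert f (G - {h}) \<in> dfam E \<B>) \<and>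
        (\<forall>S T. wit (dfam E \<B>) S T \<longrightarrow> e \<notin> S \<union> T \<longrightarrow> through G S T)"
    proof (intro bexI[of _ "E - G"] conjI ballI allI impI)
      show "E - G \<in> dfam E \<B>" using G(1) by (auto simp: dfam_def)
      show "e \<notin> E - G" using G by simp
      fix h f assume hf: "h \<in> E - G" "f \<in> E - (E - G) - {e}"
      then have "insert h (G - {f}) \<in> \<B>" using G(3)[of f h] GE by auto
      moreover have "E - insert f (E - G - {h}) = insert h (G - {f})" using hf GE by auto
      moreover have "insert f (E - G - {h}) \<subseteq> E" using hf by auto
      ultimately show "insert f (E - G - {h}) \<in> dfam E \<B>" using dual_mem by simp
    next
      fix S T assume w: "wit (dfam E \<B>) S T" and n: "e \<notin> S \<union> T"
      note ww = dual_witE[OF w]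
      have "through G (E - S - T) T" using G(4)[OF ww(1)] n e by auto
      then show "through (E - G) S T" using ww GE unfolding through_def by auto
    qed
  next
    fix S T e assume w: "wit (dfam E \<B>) S T" and e: "e \<in> S"
    note ww = dual_witE[OF w]
    have e': "e \<in> E - (E - S - T) - T" using e ww by auto
    obtain G where G: "G \<in> \<B>" "e \<notin> G" "\<And>h f. h \<in> G \<Longrightarrow> f \<in> E - G - {e} \<Longrightarrow> insert f (G - {h}) \<in> \<B>"
      "\<And>S T. wit \<B> S T \<Longrightarrow> e \<notin> S \<union> T \<Longrightarrow> through G S T" using deletion[OF ww(1) e'] by blast
    have GE: "G \<subseteq> E" using sub[OF G(1)] .
    show "\<exists>G\<in>dfam E \<B>. e \<in> G \<and> (\<forall>h\<in>G - {e}. \<forall>f\<in>E - G. insert f (G - {h}) \<in> dfam E \<B>) \<and>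
        (\<forall>S T. wit (dfam E \<B>) S T \<longrightarrow> e \<in> S \<longrightarrow> through G S T)"
    proof (intro bexI[of _ "E - G"] conjI ballI allI impI)
      show "E - G \<in> dfam E \<B>" using G(1) by (auto simp: dfam_def)
      show "e \<in> E - G" using G e' by simp
      fix h f assume hf: "h \<in> E - G - {e}" "f \<in> E - (E - G)"
      then have "insert h (G - {f}) \<in> \<B>" using G(3)[of f h] GE by auto
      moreover have "E - insert f (E - G - {h}) = insert h (G - {f})" using hf GE by auto
      moreover have "insert f (E - G - {h}) \<subseteq> E" using hf by auto
      ultimately show "insert f (E - G - {h}) \<in> dfam E \<B>" using dual_mem by simp
    next
      fix S T assume w: "wit (dfam E \<B>) S T" and n: "e \<in> S"
      note ww = dual_witE[OF w]
      have "through G (E - S - T) T" using G(4)[OF ww(1)] n ww by auto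
      then show "through (E - G) S T" using ww GE unfolding through_def by auto
    qed
  qed
qed

end

locale minimal_bad = no_small_minor E \<B> + minor_minimal E \<B> for E :: "'a set" and \<B>
begin

lemma dual_minimal_bad: "minimal_bad E (dfam E \<B>)"
  by (rule minimal_bad.intro[OF dual_no_small_minor dual_minor_minimal])

text \<open>In rank two a free base \<open>H\<close> lies on every line: an element of
  \<open>H\<close> off \<open>T'\<close> would be parallel to some point of \<open>T'\<close>, but
  by freeness it forms a base with every element outside \<open>H\<close>, and \<open>H\<close>
  itself is a base.\<close>

lemma wit_S_nonempty: 
  assumes w: "wit \<B> S T"
  shows "S \<noteq> {}"
proof
  assume S: "S = {}"
  obtain H where H: "free_base E \<B> H" "through H S T" using free_base_through[OF w] by blast
  have HB: "H \<in> \<B>" using H unfolding free_base_def by blast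
  have "through H S' T'" if w': "wit \<B> S' T'" for S' T'
  proof -
    have "card S' = card S" using wit_card(1)[OF w] wit_card(1)[OF w'] by simp
    then have S': "S' = {}" using S wit_card(2)[OF w'] by simp
    have "q \<in> T'" if q: "q \<in> H" for q
    proof (rule ccontr)
      assume "q \<notin> T'"
      then have r: "q \<in> E - S' - T'" using q sub[OF HB] S' by auto
      obtain t where t: "t \<in> T'" "insert q (insert t {}) \<notin> \<B>" using parallel_label[OF w' r] S' by auto
      obtain x y where xy: "x \<noteq> y" "H = {x,y}" using through_base[OF base_family_axioms w H(2) cardB[OF HB]] S by blast
      obtain q2 where q2: "H = {q,q2}" "q2 \<noteq> q" using xy q by auto
      have tq: "t \<noteq> q" using t \<open>q \<notin> T'\<close> by blast
      have "t \<notin> H" using t q2 tq HB by auto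
      moreover have "t \<in> E" using t wit_sub[OF w'] by blast
      ultimately have "insert t (H - {q2}) \<in> \<B>" using H(1) q2 unfolding free_base_def by blast
      moreover have "insert t (H - {q2}) = {q,t}" using q2 by auto
      ultimately show False using t by simp
    qed
    then show ?thesis using S' by (auto simp: through_def)
  qed
  then have "good E \<B>" unfolding good_def using H by blast
  then show False using not_good by blast
qed

lemma wit_R_nonempty: 
  assumes w: "wit \<B> S T"
  shows "E - S - T \<noteq> {}"
  using minimal_bad.wit_S_nonempty[OF dual_minimal_bad wit_dual[OF w]] .

text \<open>The free base \<open>G\<close> of the deletion lies on all lines avoiding
  \<open>e\<close>, in particular on \<open>(S, T)\<close>. So \<open>G\<close> and \<open>H\<close>
  are both \<open>S\<close> with two points of \<open>T\<close>. If they are adjacent,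
  \<open>adjacent_free_same_wits\<close> passes the lines of \<open>G\<close> on to
  \<open>H\<close>.\<close>

lemma through_common_R:
  assumes H: "free_base E \<B> H" and w: "wit \<B> S T" "through H S T" and e: "e \<in> E - S - T"
    and w': "wit \<B> S' T'" "e \<notin> S' \<union> T'"
  shows "through H S' T'"
proof -
  have HB: "H \<in> \<B>" using H unfolding free_base_def by blast
  have eH: "e \<notin> H" using w e by (auto simp: through_def)
  obtain G where G: "G \<in> \<B>" "e \<notin> G" "\<And>h f. h \<in> G \<Longrightarrow> f \<in> E - G - {e} \<Longrightarrow> insert f (G - {h}) \<in> \<B>"
    "\<And>S T. wit \<B> S T \<Longrightarrow> e \<notin> S \<union> T \<Longrightarrow> through G S T" using deletion[OF w(1) e] by blast
  let ?F = "E - {e}"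
  have fH: "free_in ?F H" using free_in_sub[OF H] sub[OF HB] eH by auto
  have fG: "free_in ?F G" unfolding free_in_def using G sub[OF G(1)] by auto
  have tG': "through G S' T'" using G(4) w' by blast
  have tG: "through G S T" using G(4) w e by blast
  obtain h h' f f' where a: "h \<in> H" "h' \<in> H" "f \<in> E - H" "f' \<in> E - H" "S = H - {h,h'}" "T = {h,h',f,f'}" "act H h h' f f'" "distinct [h,h',f,f']"
    using through_act[OF HB w] .
  have ff: "f \<in> ?F - H" "f' \<in> ?F - H" using a e by auto
  obtain x y where xy: "x \<in> T" "y \<in> T" "x \<noteq> y" "G = insert x (insert y S)"
    using through_base[OF base_family_axioms w(1) tG cardB[OF G(1)]] by blast
  have sT: "S' \<union> T' \<subseteq> ?F" using wit_sub[OF w'(1)] w'(2) by auto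
  have adj: "through H S' T'" if "u \<in> {h,h'}" "v \<in> {f,f'}" "G = insert v (H - {u})" for u v
    using adjacent_free_same_wits[OF fH fG that(3) _ _ w'(1) tG' sT] that a ff by blast
  have e1: "H - {h'} = insert h S" "H - {h} = insert h' S" "H = insert h (insert h' S)" using a by auto
  consider "G = H" | u v where "u \<in> {h,h'}" "v \<in> {f,f'}" "G = insert v (H - {u})" | "G = insert f (insert f' S)"
  proof -
    have "x \<in> {h,h',f,f'}" "y \<in> {h,h',f,f'}" using xy a by auto
    then consider "x \<in> {h,h'}" "y \<in> {h,h'}" | "x \<in> {h,h'}" "y \<in> {f,f'}" | "x \<in> {f,f'}" "y \<in> {h,h'}" | "x \<in> {f,f'}" "y \<in> {f,f'}"
      by blast
    then show ?thesis
    proof cases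
      case 1
      then have "G = H" using xy(3,4) e1(3) by auto
      then show ?thesis by (rule that(1))
    next
      case 2
      then have "G = insert y (H - {h}) \<or> G = insert y (H - {h'})" using xy(4) e1(1,2) by auto
      then show ?thesis using 2 that(2) by blast
    next
      case 3
      then have "G = insert x (H - {h}) \<or> G = insert x (H - {h'})" using xy(4) e1(1,2) by auto
      then show ?thesis using 3 that(2) by blast
    next
      case 4
      then have "G = insert f (insert f' S)" using xy(3,4) by auto
      then show ?thesis by (rule that(3))
    qed
  qed
  then show ?thesis
  proof cases
    case 1 then show ?thesis using tG' by simp
  next
    case 2 then show ?thesis using adj by blast
  next
    case 3
    \<comment> \<open>Now \<open>G\<close> contains neither \<open>h\<close> nor \<open>h'\<close>.
      By row parity \<open>k\<close> is active on \<open>f, f'\<close> together with one of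
      \<open>h, h'\<close>; the resulting line avoids \<open>e\<close> and contracts the other one,
      so it cannot pass through \<open>G\<close>.\<close>
    obtain k where k: "k \<in> S" using wit_S_nonempty[OF w(1)] by blast
    have kH: "k \<in> H" "k \<noteq> h" "k \<noteq> h'" using k a by auto
    have hG: "h \<notin> G" "h' \<notin> G" using 3 a by auto
    have no: False if "act H k u f f'" "{u,v} = {h,h'}" for u v
    proof -
      have uH: "u \<in> H" "v \<in> H" using that a by auto
      have kv: "v \<noteq> k" "v \<noteq> u" using that kH a(8) by (auto simp: doubleton_eq_iff)
      have "e \<notin> (H - {k,u}) \<union> {k,u,f,f'}" using eH kH uH ff by auto
      then have "through G (H - {k,u}) {k,u,f,f'}" using G(4) act_wit(1)[OF fH kH(1) uH(1) ff that(1)] by blast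
      then have "v \<in> G" using kv uH unfolding through_def by blast
      then show False using hG that by auto
    qed
    have "act H h k f f' \<or> act H k h' f f'" using act_rows[OF fH a(1) kH(1) a(2) ff] a(7) by blast
    then show ?thesis using no[of h h'] no[of h' h] act_sym(1)[of H h k f f'] by auto
  qed
qed

lemma through_common_S:
  assumes H: "free_base E \<B> H" and w: "wit \<B> S T" "through H S T" and e: "e \<in> S"
    and w': "wit \<B> S' T'" "e \<in> S'"
  shows "through H S' T'"
proof -
  have HE: "H \<subseteq> E" using H sub unfolding free_base_def by blast
  have st: "S \<subseteq> E" "T \<subseteq> E" "S \<inter> T = {}" "S' \<subseteq> E" "T' \<subseteq> E" "S' \<inter> T' = {}"
    using wit_sub[OF w(1)] wit_sub[OF w'(1)] w w' unfolding wit_def by blast+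
  have "through (E - H) (E - S' - T') T'"
  proof (rule minimal_bad.through_common_R[OF dual_minimal_bad free_dual[OF H] wit_dual[OF w(1)] _ _ wit_dual[OF w'(1)]])
    show "through (E - H) (E - S - T) T" using through_dual[OF HE st(1-3)] w by blast
    show "e \<in> E - (E - S - T) - T" "e \<notin> E - S' - T' \<union> T'" using e w' st by auto
  qed
  then show ?thesis using through_dual[OF HE st(4-6)] by blast
qed

text \<open>If no line through \<open>H\<close> contracts \<open>h\<close>, all active pairs of rows
  contain \<open>h\<close>. Row parity gives two of them, \<open>h, g\<close> and
  \<open>h, k\<close>; their lines contract \<open>k\<close> and \<open>g\<close>, so
  \<open>S'\<close> contains neither. A base on \<open>(S', T')\<close> then avoids \<open>g\<close>
  and \<open>k\<close>, and completing \<open>H - {g,k}\<close> from it makes the rows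
  \<open>g, k\<close> active without \<open>h\<close>.\<close>

lemma H_covered_by_S:
  assumes H: "free_base E \<B> H" and w: "wit \<B> S T" "through H S T" and w': "wit \<B> S' T'" "\<not> through H S' T'"
    and h: "h \<in> H"
  shows "\<exists>S T. wit \<B> S T \<and> through H S T \<and> h \<in> S"
proof (rule ccontr)
  assume no: "\<not> ?thesis"
  have HB: "H \<in> \<B>" using H unfolding free_base_def by blast
  have fH: "free_in E H" using H free_in_E by blast
  obtain h1 h2 f f' where a: "h1 \<in> H" "h2 \<in> H" "f \<in> E - H" "f' \<in> E - H" "S = H - {h1,h2}" "T = {h1,h2,f,f'}" "act H h1 h2 f f'" "distinct [h1,h2,f,f']"
    using through_act[OF HB w] .
  have never: "\<not> act H u v x y" if "u \<in> H" "v \<in> H" "x \<in> E - H" "y \<in> E - H" "h \<noteq> u" "h \<noteq> v" for u v x y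
    using act_wit[OF fH that(1-4)] no that h by blast
  obtain g where g: "g \<in> H" "act H h g f f'" "g \<noteq> h" "S = H - {h,g}"
  proof -
    have "h = h1 \<or> h = h2" using never[of h1 h2 f f'] a by blast
    then show thesis
    proof
      assume "h = h1" then show thesis using that[of h2] a by auto
    next
      assume "h = h2" then show thesis using that[of h1] a act_sym(1)[of H h1 h2 f f'] by auto
    qed
  qed
  obtain k where k: "k \<in> S" using wit_S_nonempty[OF w(1)] by blast
  have kH: "k \<in> H" "k \<noteq> h" "k \<noteq> g" using k g by auto
  have "act H h k f f'" using act_rows[OF fH h kH(1) g(1) a(3,4)] g(2) never[of k g f f'] kH g a by blast
  then have w2: "wit \<B> (H - {h,k}) {h,k,f,f'}" "through H (H - {h,k}) {h,k,f,f'}"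
    using act_wit[OF fH h kH(1) a(3,4)] by blast+
  have "g \<in> H - {h,k}" using g kH by blast
  then have gS: "g \<notin> S'" using through_common_S[OF H w2 _ w'(1)] w'(2) by blast
  have kS: "k \<notin> S'" using through_common_S[OF H w k w'(1)] w'(2) by blast
  have "card T' = 4" using w' unfolding wit_def by blast
  then have "2 \<le> card (T' - {g,k})" using card_Diff_subset_Int[of T' "{g,k}"] card_mono[of "{g,k}" "T' \<inter> {g,k}"] kH by auto
  then obtain W where "W \<subseteq> T' - {g,k}" "card W = 2" using obtain_subset_with_card_n by metis
  then obtain x y where xy: "x \<noteq> y" "x \<in> T' - {g,k}" "y \<in> T' - {g,k}" using card_2_iff by (metis insert_subset)
  define B where "B = insert x (insert y S')"
  have B: "B \<in> \<B>" "g \<notin> B" "k \<notin> B" using witD[OF w'(1), of x y] xy gS kS B_def by auto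
  obtain B' where B': "B' \<in> \<B>" "H - {g,k} \<subseteq> B'" "B' \<subseteq> (H - {g,k}) \<union> B"
    using extend_from_base[OF _ HB B(1), of "H - {g,k}"] by blast
  have c2: "card (H - {g,k}) + 2 = rk" using free_pairs(3)[OF fH g(1) kH(1) _ a(3)] kH by blast
  have "finite (H - {g,k})" using finB[OF HB] by simp
  then have "card (B' - (H - {g,k})) = 2" using cardB[OF B'(1)] c2 B' by (simp add: card_Diff_subset)
  then obtain p q where pq: "B' - (H - {g,k}) = {p,q}" "p \<noteq> q" using card_2_iff by metis
  have gB: "g \<notin> B'" "k \<notin> B'" using B' B by auto
  have pE: "p \<in> E - H" "q \<in> E - H" using pq gB sub[OF B'(1)] by auto
  have "insert p (insert q (H - {g,k})) = B'" using pq B' by auto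
  then have "act H g k p q" unfolding act_def using pq kH B' by auto
  then show False using never[of g k p q] g kH pE by blast
qed

lemma complement_covered_by_R:
  assumes H: "free_base E \<B> H" and w: "wit \<B> S T" "through H S T" and w': "wit \<B> S' T'" "\<not> through H S' T'"
    and h: "h \<in> E - H"
  shows "\<exists>S T. wit \<B> S T \<and> through H S T \<and> h \<in> E - S - T"
proof -
  have HE: "H \<subseteq> E" using H sub unfolding free_base_def by blast
  have st: "S \<subseteq> E" "T \<subseteq> E" "S \<inter> T = {}" "S' \<subseteq> E" "T' \<subseteq> E" "S' \<inter> T' = {}"
    using wit_sub[OF w(1)] wit_sub[OF w'(1)] w w' unfolding wit_def by blast+
  obtain S2 T2 where w2: "wit (dfam E \<B>) S2 T2" "through (E - H) S2 T2" "h \<in> S2"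
    using minimal_bad.H_covered_by_S[OF dual_minimal_bad free_dual[OF H] wit_dual[OF w(1)] _ wit_dual[OF w'(1)] _ h]
      through_dual[OF HE st(1-3)] through_dual[OF HE st(4-6)] w w' by blast
  note ww = dual_witE[OF w2(1)]
  have "through H (E - S2 - T2) T2" using w2(2) ww HE unfolding through_def by auto
  moreover have "h \<in> E - (E - S2 - T2) - T2" using ww w2 h by auto
  ultimately show ?thesis using ww(1) by blast
qed

text \<open>An element of \<open>H\<close> in \<open>S'\<close> is also contracted in some line
  through \<open>H\<close>, so \<open>through_common_S\<close> would put \<open>H\<close> on
  \<open>(S', T')\<close>; dually for deleted elements. Together the inclusions say that the
  complement of \<open>H\<close> passes through \<open>(S', T')\<close>.\<close>

lemma not_through_opposite:
  assumes H: "free_base E \<B> H" and w: "wit \<B> S T" "through H S T" and w': "wit \<B> S' T'" "\<not> through H S' T'"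
  shows "S' \<inter> H = {}" "E - S' - T' \<subseteq> H"
proof -
  show "S' \<inter> H = {}"
    using H_covered_by_S[OF H w w'] through_common_S[OF H _ _ _ w'(1)] w'(2) by blast
  show "E - S' - T' \<subseteq> H"
    using complement_covered_by_R[OF H w w'] through_common_R[OF H _ _ _ w'(1)] w'(2) by blast
qed

text \<open>Take free bases \<open>H\<close> and \<open>G\<close> through a line and through a line
  that misses \<open>H\<close>. Every line through \<open>H\<close> turns out to miss
  \<open>G\<close>, and the sets contracted and deleted in these lines cover \<open>H\<close> and
  its complement; so opposition to \<open>G\<close> gives \<open>G = E - H\<close>.\<close>

theorem complementary_free_bases:
  "\<exists>H. free_base E \<B> H \<and> free_base E \<B> (E - H) \<and>
     (\<forall>S T. wit \<B> S T \<longrightarrow> through H S T \<or> through (E - H) S T) \<and>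
     (\<exists>S T. wit \<B> S T \<and> through H S T \<and> S \<noteq> {})"
proof -
  obtain S0 T0 where w0: "wit \<B> S0 T0" using not_good unfolding good_def by blast
  obtain H where H: "free_base E \<B> H" "through H S0 T0" using free_base_through[OF w0] by blast
  obtain S' T' where w': "wit \<B> S' T'" "\<not> through H S' T'" using not_good H unfolding good_def by blast
  obtain G where G: "free_base E \<B> G" "through G S' T'" using free_base_through[OF w'(1)] by blast
  have HB: "H \<in> \<B>" "G \<in> \<B>" using H G unfolding free_base_def by blast+
  have fH: "free_in E H" using H free_in_E by blast
  \<comment> \<open>Otherwise the sets contracted in lines through \<open>H\<close>, which cover
    \<open>H\<close>, would all lie in \<open>G\<close>, giving \<open>H = G\<close>.\<close>
  have "\<exists>S T. wit \<B> S T \<and> through H S T \<and> \<not> through G S T"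
  proof (rule ccontr)
    assume n: "\<not> ?thesis"
    have "h \<in> G" if "h \<in> H" for h
    proof -
      obtain S T where "wit \<B> S T" "through H S T" "h \<in> S" using H_covered_by_S[OF H(1) w0 H(2) w' \<open>h \<in> H\<close>] by blast
      then show ?thesis using n unfolding through_def by blast
    qed
    then have "H = G" using base_subset_eq[OF HB] by blast
    then show False using G w' by blast
  qed
  then obtain S1 T1 where w1: "wit \<B> S1 T1" "through H S1 T1" "\<not> through G S1 T1" by blast
  note opp = not_through_opposite[OF G(1) w'(1) G(2)]
  \<comment> \<open>A line missing \<open>G\<close> has its contracted set disjoint from
    \<open>G\<close> and nonempty, so no line with the same \<open>S\<close> passes through
    \<open>G\<close>. \<open>stepR\<close> is the same for the deleted set.\<close>
  have stepS: "\<not> through G S2 T2" if "wit \<B> S T" "\<not> through G S T" "S2 = S" for S T S2 T2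
    using opp(1)[OF that(1,2)] wit_S_nonempty[OF that(1)] that(3) unfolding through_def by blast
  have stepR: "\<not> through G S2 T2" if "wit \<B> S T" "\<not> through G S T" "E - S2 - T2 = E - S - T" for S T S2 T2
  proof
    assume t: "through G S2 T2"
    have "E - S - T \<subseteq> G" using opp(2)[OF that(1,2)] .
    moreover have "(E - S2 - T2) \<inter> G = {}" using t unfolding through_def by blast
    ultimately show False using wit_R_nonempty[OF that(1)] that(3) by blast
  qed
  obtain h h' f f' where a: "h \<in> H" "h' \<in> H" "f \<in> E - H" "f' \<in> E - H" "S1 = H - {h,h'}" "T1 = {h,h',f,f'}" "act H h h' f f'" "distinct [h,h',f,f']"
    using through_act[OF HB(1) w1(1,2)] .
  \<comment> \<open>Missing \<open>G\<close> spreads from the line \<open>(S1, T1)\<close> to any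
    other line through \<open>H\<close>: change the columns at fixed rows, then the rows at fixed
    columns, then the columns again.\<close>
  have disj: "\<not> through G S2 T2" if w2: "wit \<B> S2 T2" "through H S2 T2" for S2 T2
  proof -
    obtain u u' g g' where b: "u \<in> H" "u' \<in> H" "g \<in> E - H" "g' \<in> E - H" "S2 = H - {u,u'}" "T2 = {u,u',g,g'}" "act H u u' g g'" "distinct [u,u',g,g']"
      using through_act[OF HB(1) w2] .
    have R: "E - (H - {p,q}) - {p,q,c,d} = E - H - {c,d}" if "p \<in> H" "q \<in> H" for p q c d using that by auto
    let ?N = "\<lambda>p q c d. \<not> through G (H - {p,q}) {p,q,c,d}"
    have 1: "?N h h' c d" for c d using stepS[OF w1(1,3)] a by blast
    have 2: "?N p q c d" if "act H h h' c d" "p \<in> H" "q \<in> H" "c \<in> E - H" "d \<in> E - H" for p q c d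
      by (rule stepR[OF act_wit(1)[OF fH a(1,2) that(4,5,1)] 1]) (simp only: R[OF that(2,3)] R[OF a(1,2)])
    have 3: "?N u u' g g'" if "act H h h' c d" "act H u u' c d" "c \<in> E - H" "d \<in> E - H" for c d
      by (rule stepS[OF act_wit(1)[OF fH b(1,2) that(3,4,2)] 2[OF that(1) b(1,2) that(3,4)] refl])
    \<comment> \<open>By column parity, the active pairs for two fixed rows are those separated by a
      partition of the columns into two classes. Both partitions are nontrivial, and two such
      partitions always have a common separated pair.\<close>
    have "\<exists>c d. c \<in> E - H \<and> d \<in> E - H \<and> act H h h' c d \<and> act H u u' c d"
    proof (rule ccontr)
      assume n: "\<not> ?thesis"
      then have n: "\<not> (act H h h' c d \<and> act H u u' c d)" if "c \<in> E - H" "d \<in> E - H" for c d using that by blast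
      note cA = act_cols[OF fH a(1,2)] and cB = act_cols[OF fH b(1,2)]
      show False
        using n[OF a(3,4)] n[OF b(3,4)] n[OF a(3) b(3)] n[OF a(3) b(4)] n[OF a(4) b(3)] n[OF a(4) b(4)] a(7) b(7)
          cA[OF a(3) b(3) a(4)] cA[OF a(3) b(4) a(4)] cA[OF b(3) a(3) b(4)] cA[OF b(3) a(4) b(4)]
          cB[OF a(3) b(3) a(4)] cB[OF a(3) b(4) a(4)] cB[OF b(3) a(3) b(4)] cB[OF b(3) a(4) b(4)]
          act_sym(2)[of H h h'] act_sym(2)[of H u u'] by metis
    qed
    then show ?thesis using 3 b by blast
  qed
  have GE: "G = E - H"
  proof (intro equalityI subsetI)
    fix x assume x: "x \<in> G"
    have "x \<notin> H"
    proof
      assume "x \<in> H"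
      then obtain S T where w: "wit \<B> S T" "through H S T" "x \<in> S" using H_covered_by_S[OF H(1) w0 H(2) w'] by blast
      then show False using opp(1)[OF w(1) disj[OF w(1,2)]] x by blast
    qed
    then show "x \<in> E - H" using x sub[OF HB(2)] by blast
  next
    fix x assume x: "x \<in> E - H"
    then obtain S T where w: "wit \<B> S T" "through H S T" "x \<in> E - S - T" using complement_covered_by_R[OF H(1) w0 H(2) w'] by blast
    then show "x \<in> G" using opp(2)[OF w(1) disj[OF w(1,2)]] by blast
  qed
  have "through (E - H) S T" if w: "wit \<B> S T" "\<not> through H S T" for S T
    using not_through_opposite[OF H(1) w0 H(2) w] wit_sub[OF w(1)] unfolding through_def by blast
  then show ?thesis using H(1) G(1) w0 H(2) wit_S_nonempty[OF w0] unfolding GE by blast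
qed

end

section \<open>Relaxing two complementary circuit-hyperplanes\<close>

text \<open>The counterpart of \<open>in_D\<close> for bases. The bound
  \<open>3 \<le> card H\<close> stands for connectedness: in rank two the tightened matroid would be
  the direct sum of two parallel pairs.\<close>

definition doubly_relaxed :: "'a set \<Rightarrow> 'a set set \<Rightarrow> bool" where
  "doubly_relaxed E \<B> \<longleftrightarrow> (\<exists>H. free_base E \<B> H \<and> free_base E \<B> (E - H) \<and> 3 \<le> card H \<and>
     (\<forall>S T. wit \<B> S T \<longrightarrow> through H S T \<or> through (E - H) S T))"

lemma fundamental_circuit:
  assumes m: "matroid M" and B: "B \<in> bases M" and g: "g \<in> fst M - B"
  shows "circuit M (insert g {b\<in>B. insert g (B - {b}) \<in> bases M})"
proof -
  interpret base_family "fst M" "bases M" by (rule matroid_base_family[OF m])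
  let ?C = "insert g {b\<in>B. insert g (B - {b}) \<in> bases M}"
  show ?thesis unfolding circuit_def
  proof (intro conjI allI impI)
    show "?C \<subseteq> fst M" using g sub[OF B] by auto
    show "?C \<notin> snd M"
    proof
      assume "?C \<in> snd M"
      then obtain B1 where B1: "B1 \<in> bases M" "?C \<subseteq> B1" using matroid_indep_iff[OF m] by blast
      obtain B' where B': "B' \<in> bases M" "?C \<subseteq> B'" "B' \<subseteq> ?C \<union> B" using extend_from_base[OF B1(2,1) B] by blast
      have "\<not> B \<subseteq> B'" using base_subset_eq[OF B B'(1)] B' g by blast
      then obtain b where b: "b \<in> B" "b \<notin> B'" by blast
      have "B' \<subseteq> insert g (B - {b})" using B' b by auto
      moreover have "card (insert g (B - {b})) = card B'"
        using g b finB[OF B] cardB[OF B] cardB[OF B'(1)]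
        by (metis DiffD1 DiffD2 card.remove card_insert_disjoint finite_Diff insert_Diff insert_iff)
      ultimately have "B' = insert g (B - {b})" using finB[OF B] by (intro card_subset_eq) auto
      then show False using B' b by auto
    qed
    fix D assume "D \<subset> ?C"
    then obtain d where d: "d \<in> ?C" "D \<subseteq> ?C - {d}" by blast
    show "D \<in> snd M"
    proof (cases "d = g")
      case True
      then have "D \<subseteq> B" using d by auto
      then show ?thesis using B matroid_indep_iff[OF m] by blast
    next
      case False
      then have "D \<subseteq> insert g (B - {d})" "insert g (B - {d}) \<in> bases M" using d by auto
      then show ?thesis using matroid_indep_iff[OF m] by blast
    qed
  qed
qed

context base_family begin

lemma free_not_complement:
  assumes "free_base E \<B> H" "3 \<le> card H" "e \<in> E - H" "h \<in> H"
  shows "insert e (H - {h}) \<noteq> E - H"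
proof
  assume a: "insert e (H - {h}) = E - H"
  have "H - {h} \<subseteq> {}" using a by auto
  then have "H \<subseteq> {h}" by auto
  then have "card H \<le> 1" using card_mono[of "{h}" H] by simp
  then show False using assms by simp
qed

text \<open>The independent set \<open>H - {x,h} + y\<close> lacks one element of a base, and it is
  completed from the base \<open>E - H\<close>.\<close>

lemma complementary_act:
  assumes H: "free_base E \<B> H" "E - H \<in> \<B>" and xy: "x \<in> H" "y \<in> E - H" "h \<in> H" "h \<noteq> x"
  shows "\<exists>g\<in>E - H. g \<noteq> y \<and> insert g (insert y (H - {x,h})) \<in> \<B>"
proof -
  let ?I = "insert y (H - {x,h})"
  have HB: "H \<in> \<B>" using H unfolding free_base_def by blast
  have 1: "insert y (H - {x}) \<in> \<B>" using H(1) xy unfolding free_base_def by blast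
  have "?I \<subseteq> insert y (H - {x})" by auto
  then obtain B where B: "B \<in> \<B>" "?I \<subseteq> B" "B \<subseteq> ?I \<union> (E - H)" using extend_from_base[OF _ 1 H(2)] by blast
  have "card {x,h} \<le> card H" using xy finB[OF HB] by (intro card_mono) auto
  then have cI: "card ?I + 1 = rk" using xy finB[OF HB] cardB[OF HB] by (simp add: card_Diff_subset)
  have "finite ?I" using finB[OF HB] by simp
  then have "card (B - ?I) = 1" using cardB[OF B(1)] cI B(2) by (simp add: card_Diff_subset)
  then obtain g where g: "B - ?I = {g}" using card_1_singletonE by blast
  have "insert g ?I = B" using g B by auto
  moreover have "g \<in> E - H" "g \<noteq> y" using g B by auto
  ultimately show ?thesis using B by blast
qed

end

text \<open>Since every line uses \<open>H\<close> or its complement, removing both leaves a binary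
  matroid. Each of the two sets is a circuit of it, so connectedness needs only circuits that join
  the two sides.\<close>

lemma doubly_relaxed_in_D:
  assumes m: "matroid M" and d: "doubly_relaxed (fst M) (bases M)"
  shows "in_D M"
proof -
  interpret base_family "fst M" "bases M" by (rule matroid_base_family[OF m])
  let ?E = "fst M"
  obtain H where H: "free_base ?E (bases M) H" "free_base ?E (bases M) (?E - H)" "3 \<le> card H"
    "\<And>S T. wit (bases M) S T \<Longrightarrow> through H S T \<or> through (?E - H) S T" using d unfolding doubly_relaxed_def by blast
  let ?G = "?E - H"
  have HB: "H \<in> bases M" "?G \<in> bases M" using H unfolding free_base_def by blast+
  have HE: "H \<subseteq> ?E" "?E - ?G = H" using sub[OF HB(1)] by auto
  have cG: "3 \<le> card ?G" using H(3) cardB[OF HB(1)] cardB[OF HB(2)] by simp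
  have nb: "insert e (H - {h}) \<in> bases M - {H} - {?G}" if "h \<in> H" "e \<in> ?G" for h e
    using H(1) free_not_complement[OF H(1,3) that(2,1)] that unfolding free_base_def by auto
  have nb2: "insert e (?G - {h}) \<in> bases M - {H} - {?G}" if "h \<in> ?G" "e \<in> H" for h e
    using H(2) free_not_complement[OF H(2) cG _ that(1), of e] that HE unfolding free_base_def by auto
  have HGne: "H \<noteq> {}" "?G \<noteq> {}" using H(3) cG by (metis card.empty not_numeral_le_zero)+
  then obtain h0 g0 where hg: "h0 \<in> H" "g0 \<in> ?G" by blast
  have "base_family ?E (bases M - {H})" by (rule tighten[OF H(1)]) (use nb[OF hg] in blast)
  moreover have "free_base ?E (bases M - {H}) ?G" using HB hg nb2 HE unfolding free_base_def by auto
  ultimately have f0: "base_family ?E (bases M - {H} - {?G})"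
    using base_family.tighten[of ?E "bases M - {H}" ?G] nb[OF hg] by blast
  let ?M0 = "of_bases ?E (bases M - {H} - {?G})"
  have m0: "matroid ?M0" "bases ?M0 = bases M - {H} - {?G}" "fst ?M0 = ?E" using of_bases_matroid[OF f0] by auto
  have "\<not> wit (bases M - {H} - {?G}) S T" for S T
  proof
    assume w': "wit (bases M - {H} - {?G}) S T"
    have w: "wit (bases M) S T" by (rule wit_mono[OF w']) blast
    obtain P where P: "P \<in> {H,?G}" "through P S T" using H(4)[OF w] by blast
    have "card P = rk" using P HB cardB by blast
    then obtain x y where "x \<in> T" "y \<in> T" "x \<noteq> y" "P = insert x (insert y S)"
      using through_base[OF base_family_axioms w P(2)] by blast
    then show False using witD[OF w', of x y] P by auto
  qed
  then have bin: "binary ?M0" using binary_iff_no_wit[OF m0(1)] m0(2) by simp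
  have t: "tight_set ?E (bases ?M0) H" "tight_set ?E (bases ?M0) ?G"
    unfolding tight_set_def m0(2) HE(2) using nb nb2 HE(1) HGne by blast+
  then have ch: "circuit_hyperplane ?M0 H" "circuit_hyperplane ?M0 ?G"
    using circuit_hyperplane_iff[OF m0(1)] m0(3) by auto
  \<comment> \<open>The circuit is the fundamental circuit of \<open>g\<close> for the base
    \<open>H - h + y\<close>: it contains \<open>x\<close> because \<open>H - {x,h} + y + g\<close>
    is a base, and \<open>y\<close> because \<open>H - h + g\<close> is one.\<close>
  have cross: "\<exists>C. circuit ?M0 C \<and> x \<in> C \<and> y \<in> C" if xy: "x \<in> H" "y \<in> ?G" for x y
  proof -
    have "\<not> H \<subseteq> {x}" using H(3) card_mono[of "{x}" H] by auto
    then obtain h where h: "h \<in> H" "h \<noteq> x" by blast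
    obtain g where g: "g \<in> ?G" "g \<noteq> y" "insert g (insert y (H - {x,h})) \<in> bases M"
      using complementary_act[OF H(1) HB(2) xy h] by blast
    have "\<not> H \<subseteq> {x,h}" using H(3) card_mono[of "{x,h}" H] h by auto
    \<comment> \<open>A third element of \<open>H\<close> stays in the new base and tells it apart
      from the removed complement.\<close>
    then obtain k where k: "k \<in> H" "k \<noteq> x" "k \<noteq> h" by blast
    let ?B = "insert y (H - {h})"
    have B: "?B \<in> bases ?M0" using nb[OF h(1) xy(2)] m0 by simp
    have gB: "g \<in> fst ?M0 - ?B" using g m0 by auto
    have "insert g (?B - {x}) = insert g (insert y (H - {x,h}))" using xy by auto
    moreover have "insert g (insert y (H - {x,h})) \<noteq> H" using g by auto
    moreover have "k \<in> insert g (insert y (H - {x,h}))" using k by auto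
    then have "insert g (insert y (H - {x,h})) \<noteq> ?G" using k by auto
    ultimately have "insert g (?B - {x}) \<in> bases ?M0" using g m0 by simp
    moreover have "insert g (?B - {y}) \<in> bases ?M0"
    proof -
      have "insert g (?B - {y}) = insert g (H - {h})" using xy by auto
      then show ?thesis using nb[OF h(1) g(1)] m0 by simp
    qed
    moreover have "x \<in> ?B" using xy h by auto
    ultimately show ?thesis using fundamental_circuit[OF m0(1) B gB] by blast
  qed
  have "\<exists>C. circuit ?M0 C \<and> x \<in> C \<and> y \<in> C" if xy: "x \<in> ?E" "y \<in> ?E" for x y
  proof -
    consider "x \<in> H" "y \<in> H" | "x \<in> ?G" "y \<in> ?G" | "x \<in> H" "y \<in> ?G" | "y \<in> H" "x \<in> ?G" using xy by blast
    then show ?thesis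
      by cases (use ch cross in \<open>auto simp: circuit_hyperplane_def\<close>)
  qed
  then have con: "connected ?M0" unfolding connected_def m0(3) by blast
  have "bases M - {H} - {?G} \<union> {H, ?G} = bases M" using HB by auto
  then have "relax ?M0 {H, ?G} = M" unfolding relax_def m0 using matroid_of_bases[OF m] by simp
  moreover have "H \<inter> ?G = {}" "H \<union> ?G = fst ?M0" using HE m0 by auto
  ultimately show ?thesis unfolding in_D_def using bin con ch by metis
qed

lemma in_D_doubly_relaxed:
  assumes D: "in_D M"
  shows "doubly_relaxed (fst M) (bases M)"
proof -
  obtain M0 X Y where d: "binary M0" "connected M0" "circuit_hyperplane M0 X" "circuit_hyperplane M0 Y"
    "X \<inter> Y = {}" "X \<union> Y = fst M0" "M = relax M0 {X,Y}" using D unfolding in_D_def by blast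
  have m0: "matroid M0" using d by (simp add: binary_def)
  interpret base_family "fst M0" "bases M0" by (rule matroid_base_family[OF m0])
  let ?E = "fst M0"
  have tX: "tight_set ?E (bases M0) X" and tY: "tight_set ?E (bases M0) Y" using d circuit_hyperplane_iff[OF m0] by auto
  have Ye: "Y = ?E - X" "X = ?E - Y" using d by auto
  have nX: "insert e (X - {h}) \<in> bases M0" if "h \<in> X" "e \<in> ?E - X" for h e using tX that unfolding tight_set_def by blast
  have nY: "insert e (Y - {h}) \<in> bases M0" if "h \<in> Y" "e \<in> ?E - Y" for h e using tY that unfolding tight_set_def by blast
  have f1: "base_family ?E (insert X (bases M0))"
    by (rule relaxing) (use tX in \<open>auto simp: tight_set_def\<close>)
  have f2: "base_family ?E (insert Y (insert X (bases M0)))"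
    by (rule base_family.relaxing[OF f1]) (use tY in \<open>auto simp: tight_set_def\<close>)
  have e: "M = of_bases ?E (insert Y (insert X (bases M0)))" using d(7) unfolding relax_def by (simp add: Un_commute insert_commute)
  have M: "bases M = insert Y (insert X (bases M0))" "fst M = ?E" using of_bases_matroid[OF f2] e by auto
  have free: "free_base ?E (bases M) X" "free_base ?E (bases M) Y" using nX nY unfolding free_base_def M by auto
  have thr: "through X S T \<or> through Y S T" if w: "wit (bases M) S T" for S T
  proof -
    have "\<not> wit (bases M0) S T" using binary_iff_no_wit[OF m0] d(1) by blast
    moreover have "wit (bases M0 \<union> {X,Y}) S T" using w unfolding M by (simp add: insert_commute)
    ultimately show ?thesis using wit_relaxed[of "bases M0" "{X,Y}" S T] by blast
  qed
  have fX: "finite X" "finite Y" using Ye fin by (metis finite_Diff)+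
  have cXY: "card X = card Y" using base_family.cardB[OF f2, of X] base_family.cardB[OF f2, of Y] by simp
  have XB: "X \<notin> bases M0" "Y \<notin> bases M0" "X \<noteq> {}" "Y \<noteq> {}" using tX tY unfolding tight_set_def by auto
  have "3 \<le> card X"
  proof (rule ccontr)
    assume "\<not> 3 \<le> card X"
    moreover have "card X \<noteq> 0" using XB fX by simp
    ultimately consider "card X = 1" | "card X = 2" by linarith
    then show False
    proof cases
      case 1
      then obtain x y where x: "X = {x}" "Y = {y}" using cXY card_1_singletonE by metis
      have "y \<in> ?E - X" using x(2) Ye(1) by blast
      then have "insert y (X - {x}) \<in> bases M0" using nX x(1) by blast
      then show False using x XB by simp
    next
      case 2
      obtain a b where ab: "X = {a,b}" "a \<noteq> b" using 2 card_2_iff by metis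
      obtain c c' where cd: "Y = {c,c'}" "c \<noteq> c'" using 2 cXY card_2_iff by metis
      have ne: "a \<noteq> c" using ab cd d(5) by auto
      obtain C where C: "circuit M0 C" "a \<in> C" "c \<in> C" 
      proof -
        have "a \<in> ?E" "c \<in> ?E" using ab(1) cd(1) d(6) by blast+
        then show thesis using d(2) ne that unfolding connected_def by blast
      qed
      have ind: "D \<in> snd M0" if "D \<subset> C" for D using C that unfolding circuit_def by blast
      have "c \<in> ?E - X" using cd(1) Ye(1) by blast
      then have "insert c (X - {b}) \<in> bases M0" using nX ab(1) by blast
      moreover have "insert c (X - {b}) = {a,c}" using ab by auto
      ultimately have ac: "{a,c} \<in> bases M0" by simp
      have two: "rk = 2" using cardB[OF ac] ne by simp
      have base: "D \<in> bases M0" if "D \<in> snd M0" "card D = 2" for D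
        using bases_card_eq(2)[OF m0 that(1) ac] that(2) ne by simp
      \<comment> \<open>The circuit through \<open>a\<close> and \<open>c\<close> properly contains
        \<open>X\<close> or \<open>Y\<close>, which would then be independent of full size, hence a
        base.\<close>
      have "C \<noteq> {a,c}" using C(1) basesD(1)[OF ac] unfolding circuit_def by auto
      moreover have "C \<subseteq> {a,b,c,c'}" using C(1) d(6) ab cd unfolding circuit_def by auto
      ultimately have "b \<in> C \<or> c' \<in> C" using C by auto
      then have "X \<subset> C \<or> Y \<subset> C" using C ab cd d(5) by auto
      then show False using ind base 2 cXY XB by metis
    qed
  qed
  then show ?thesis unfolding doubly_relaxed_def M(2)
    by (intro exI[of _ X]) (use free thr in \<open>simp add: Ye(1)[symmetric]\<close>)
qed

lemma in_D_iff: "matroid M \<Longrightarrow> in_D M \<longleftrightarrow> doubly_relaxed (fst M) (bases M)"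
  using doubly_relaxed_in_D in_D_doubly_relaxed by blast

section \<open>Doubly relaxed matroids are excluded minors\<close>

context base_family begin

lemma doubly_relaxed_dual:
  assumes "doubly_relaxed E \<B>" shows "doubly_relaxed E (dfam E \<B>)"
proof -
  obtain H where H: "free_base E \<B> H" "free_base E \<B> (E - H)" "3 \<le> card H"
    "\<And>S T. wit \<B> S T \<Longrightarrow> through H S T \<or> through (E - H) S T" using assms unfolding doubly_relaxed_def by blast
  have HB: "H \<in> \<B>" "E - H \<in> \<B>" using H unfolding free_base_def by blast+
  have HE: "H \<subseteq> E" "E - (E - H) = H" using sub[OF HB(1)] by auto
  have "free_base E (dfam E \<B>) H" "free_base E (dfam E \<B>) (E - H)" using free_dual[OF H(1)] free_dual[OF H(2)] HE by auto
  moreover have "through H S T \<or> through (E - H) S T" if w: "wit (dfam E \<B>) S T" for S T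
  proof -
    note ww = dual_witE[OF w]
    have "through H (E - S - T) T \<or> through (E - H) (E - S - T) T" using H(4)[OF ww(1)] .
    then show ?thesis using ww HE unfolding through_def by auto
  qed
  ultimately show ?thesis unfolding doubly_relaxed_def using H(3) by blast
qed

text \<open>With two further elements \<open>a, b\<close> of \<open>H\<close>, the base
  \<open>E - H\<close> makes the rows \<open>a, b\<close> active, and the resulting line contracts
  \<open>h\<close>.\<close>

lemma free_complement_cover:
  assumes H: "free_base E \<B> H" "E - H \<in> \<B>" "3 \<le> card H" and h: "h \<in> H"
  shows "\<exists>S T. wit \<B> S T \<and> through H S T \<and> h \<in> S"
proof -
  have HB: "H \<in> \<B>" using H unfolding free_base_def by blast
  have "\<not> H \<subseteq> {h}" using H(3) card_mono[of "{h}" H] by auto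
  then obtain a where a: "a \<in> H" "a \<noteq> h" by blast
  have "\<not> H \<subseteq> {h,a}" using H(3) card_mono[of "{h,a}" H] a by auto
  then obtain b where b: "b \<in> H" "b \<noteq> h" "b \<noteq> a" by blast
  have "card (E - H) = card H" using cardB[OF HB] cardB[OF H(2)] by simp
  then have "E - H \<noteq> {}" using H(3) by (metis card.empty not_numeral_le_zero)
  then obtain y where y: "y \<in> E - H" by blast
  obtain g where g: "g \<in> E - H" "g \<noteq> y" "insert g (insert y (H - {a,b})) \<in> \<B>"
    using complementary_act[OF H(1,2) a(1) y b(1,3)] by blast
  then have act: "act H a b g y" unfolding act_def using b by auto
  have "free_in E H" using H(1) free_in_E by blast
  from act_wit[OF this a(1) b(1) g(1) y act] show ?thesis using h a b by blast
qed

text \<open>A base on all lines contains every contracted set. These cover both \<open>H\<close> and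
  \<open>E - H\<close>, so the base would have to equal each of two disjoint sets.\<close>

lemma doubly_relaxed_not_good:
  assumes "doubly_relaxed E \<B>" shows "\<not> good E \<B>"
proof
  obtain H where H: "free_base E \<B> H" "free_base E \<B> (E - H)" "3 \<le> card H" using assms unfolding doubly_relaxed_def by blast
  have HB: "H \<in> \<B>" "E - H \<in> \<B>" using H unfolding free_base_def by blast+
  have HE: "E - (E - H) = H" using sub[OF HB(1)] by auto
  have cG: "3 \<le> card (E - H)" using H(3) cardB[OF HB(1)] cardB[OF HB(2)] by simp
  note c1 = free_complement_cover[OF H(1) HB(2) H(3)] and c2 = free_complement_cover[OF H(2) _ cG, unfolded HE, OF HB(1)]
  have "H \<noteq> {}" using H(3) by auto
  then obtain h where h: "h \<in> H" by blast
  assume "good E \<B>"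
  then obtain G where G: "free_base E \<B> G" "\<And>S T. wit \<B> S T \<Longrightarrow> through G S T"
    unfolding good_def using c1[OF h] by blast
  have GB: "G \<in> \<B>" using G unfolding free_base_def by blast
  have "H \<subseteq> G" using c1 G(2) unfolding through_def by blast
  then have "G = H" using base_subset_eq[OF HB(1) GB] by blast
  moreover have "E - H \<subseteq> G" using c2 G(2) unfolding through_def by blast
  then have "G = E - H" using base_subset_eq[OF HB(2) GB] by blast
  ultimately show False using h by auto
qed

lemma wit_avoid: "wit {B \<in> \<B>. e \<notin> B} S T \<longleftrightarrow> wit \<B> S T \<and> e \<notin> S \<union> T"
proof
  assume w: "wit {B \<in> \<B>. e \<notin> B} S T"
  then obtain a b c d where t: "T = {a,b,c,d}" "distinct [a,b,c,d]" using card4E unfolding wit_def by metis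
  have "insert a (insert b S) \<in> {B \<in> \<B>. e \<notin> B}" "insert c (insert d S) \<in> {B \<in> \<B>. e \<notin> B}"
    using witD[OF w, of a b] witD[OF w, of c d] t by auto
  then show "wit \<B> S T \<and> e \<notin> S \<union> T" using t wit_mono[OF w, of \<B>] by auto
next
  assume "wit \<B> S T \<and> e \<notin> S \<union> T"
  then show "wit {B \<in> \<B>. e \<notin> B} S T" unfolding wit_def by auto
qed

text \<open>Deleting \<open>e\<close> destroys the one of the two bases that contains it, together
  with all lines through that base; the other base stays free and lies on every line that is
  left.\<close>

lemma doubly_relaxed_delete_good:
  assumes "doubly_relaxed E \<B>" and e: "e \<in> E"
  shows "good (E - {e}) {B \<in> \<B>. e \<notin> B}" "\<exists>B\<in>\<B>. e \<notin> B"
proof -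
  obtain H where H: "free_base E \<B> H" "free_base E \<B> (E - H)"
    "\<And>S T. wit \<B> S T \<Longrightarrow> through H S T \<or> through (E - H) S T" using assms unfolding doubly_relaxed_def by blast
  obtain G where G: "G \<in> {H, E - H}" "e \<notin> G" "e \<in> E - G" using e by blast
  have fG: "free_base E \<B> G" using G H by blast
  have "free_base (E - {e}) {B \<in> \<B>. e \<notin> B} G" using fG G unfolding free_base_def by auto
  moreover have "through G S T" if w: "wit {B \<in> \<B>. e \<notin> B} S T" for S T
  proof -
    have w: "wit \<B> S T" "e \<notin> S \<union> T" using w wit_avoid by blast+
    have "\<not> through (E - G) S T" using w(2) G unfolding through_def by blast
    moreover have "through G S T \<or> through (E - G) S T"
      using H(3)[OF w(1)] G(1) sub H(1) unfolding free_base_def by (auto simp: double_diff)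
    ultimately show ?thesis by blast
  qed
  ultimately show "good (E - {e}) {B \<in> \<B>. e \<notin> B}" unfolding good_def by blast
  show "\<exists>B\<in>\<B>. e \<notin> B" using fG G unfolding free_base_def by blast
qed

end

text \<open>For a property that also holds for the dual, checking deletions is enough: a contraction
  is the dual of a deletion in the dual. The hypothesis \<open>del\<close> ranges over all families
  so that it can be applied to the dual one.\<close>

lemma excluded_minor_of_self_dual_property:
  assumes m: "matroid M" and P: "P (fst M) (bases M)"
    and dual: "P (fst M) (dfam (fst M) (bases M))"
    and ng: "\<not> good (fst M) (bases M)"
    and del: "\<And>\<B> e. base_family (fst M) \<B> \<Longrightarrow> P (fst M) \<B> \<Longrightarrow> e \<in> fst M \<Longrightarrow>
      good (fst M - {e}) {B \<in> \<B>. e \<notin> B} \<and> (\<exists>B\<in>\<B>. e \<notin> B)"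
  shows "excluded_minor_R M"
proof -
  have d: "in_R (delete M {e})" if m: "matroid M" and f: "fst M = E" and P: "P E (bases M)" and e: "e \<in> E" and E: "E = fst M'"
    and del: "\<And>\<B> e. base_family E \<B> \<Longrightarrow> P E \<B> \<Longrightarrow> e \<in> E \<Longrightarrow> good (E - {e}) {B \<in> \<B>. e \<notin> B} \<and> (\<exists>B\<in>\<B>. e \<notin> B)"
    for M M' :: "'a matroid" and e E
  proof -
    have g: "good (E - {e}) {B \<in> bases M. e \<notin> B}" "\<exists>B\<in>bases M. e \<notin> B"
      using del[OF _ P e] matroid_base_family[OF m] f by auto
    then obtain B where "B \<in> bases M" "B \<inter> {e} = {}" by blast
    then have "bases (delete M {e}) = {B \<in> bases M. e \<notin> B}" using bases_delete[OF m] by auto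
    then show ?thesis using g in_R_iff_good[OF delete_matroid[OF m]] f by simp
  qed
  note df = dual_facts[OF m]
  have "in_R (delete M {e})" if "e \<in> fst M" for e using d[OF m refl P that refl del] .
  moreover have "in_R (contract M {e})" if "e \<in> fst M" for e
    unfolding contract_def by (rule in_R_dual, rule d[OF df(1) df(3) _ that refl del]) (use dual df in auto)
  ultimately show ?thesis using excluded_minor_iff[OF m] in_R_iff_good[OF m] ng by blast
qed

lemma in_D_excluded:
  assumes m: "matroid M" and d: "in_D M"
  shows "excluded_minor_R M"
proof -
  interpret base_family "fst M" "bases M" by (rule matroid_base_family[OF m])
  have dr: "doubly_relaxed (fst M) (bases M)" using in_D_doubly_relaxed[OF d] .
  show ?thesis
  proof (rule excluded_minor_of_self_dual_property[where P = doubly_relaxed, OF m dr doubly_relaxed_dual[OF dr] doubly_relaxed_not_good[OF dr]])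
    fix \<B> e assume b: "base_family (fst M) \<B>" "doubly_relaxed (fst M) \<B>" "e \<in> fst M"
    show "good (fst M - {e}) {B \<in> \<B>. e \<notin> B} \<and> (\<exists>B\<in>\<B>. e \<notin> B)"
      using base_family.doubly_relaxed_delete_good[OF b] by blast
  qed
qed

section \<open>Locating small minors\<close>

text \<open>A line off \<open>e\<close>, or with \<open>e\<close> in its \<open>S\<close>, survives
  in the minor, so the binary alternative of \<open>good\<close> fails there and a free base exists;
  it remains to lift it to the whole ground set.\<close>

lemma excluded_minor_minimal:
  assumes em: "excluded_minor_R M"
  shows "minor_minimal (fst M) (bases M)"
proof -
  have m: "matroid M" using em by (simp add: excluded_minor_R_def)
  have R: "\<not> in_R M" "\<And>e. e \<in> fst M \<Longrightarrow> in_R (delete M {e})" "\<And>e. e \<in> fst M \<Longrightarrow> in_R (contract M {e})"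
    using em excluded_minor_iff[OF m] by auto
  interpret base_family "fst M" "bases M" by (rule matroid_base_family[OF m])
  show ?thesis
  proof
    show "\<not> good (fst M) (bases M)" using R(1) in_R_iff_good[OF m] by blast
  next
    fix S T e assume w: "wit (bases M) S T" and e: "e \<in> fst M - S - T"
    obtain a b c d where t: "T = {a,b,c,d}" "distinct [a,b,c,d]" using w card4E unfolding wit_def by metis
    have ab: "insert a (insert b S) \<in> bases M" using witD[OF w] t by auto
    moreover have "insert a (insert b S) \<inter> {e} = {}" using e t by auto
    ultimately have bd: "bases (delete M {e}) = {B \<in> bases M. e \<notin> B}" using bases_delete[OF m] by auto
    have g: "good (fst M - {e}) {B \<in> bases M. e \<notin> B}"
      using R(2)[of e] e in_R_iff_good[OF delete_matroid[OF m]] bd by simp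
    have "wit {B \<in> bases M. e \<notin> B} S T" using w e wit_avoid by blast
    then obtain G where G: "free_base (fst M - {e}) {B \<in> bases M. e \<notin> B} G"
      "\<And>S T. wit {B \<in> bases M. e \<notin> B} S T \<Longrightarrow> through G S T" using g unfolding good_def by blast
    have "through G S T" if "wit (bases M) S T" "e \<notin> S \<union> T" for S T using G(2) that wit_avoid by blast
    moreover have "insert f (G - {h}) \<in> bases M" if "h \<in> G" "f \<in> fst M - G - {e}" for h f
      using G(1) that unfolding free_base_def by blast
    moreover have "G \<in> bases M" "e \<notin> G" using G(1) unfolding free_base_def by auto
    ultimately show "\<exists>G\<in>bases M. e \<notin> G \<and> (\<forall>h\<in>G. \<forall>f\<in>fst M - G - {e}. insert f (G - {h}) \<in> bases M) \<and>
        (\<forall>S T. wit (bases M) S T \<longrightarrow> e \<notin> S \<union> T \<longrightarrow> through G S T)" by blast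
  next
    fix S T e assume w: "wit (bases M) S T" and e: "e \<in> S"
    obtain a b c d where t: "T = {a,b,c,d}" "distinct [a,b,c,d]" using w card4E unfolding wit_def by metis
    have ab: "insert a (insert b S) \<in> bases M" using witD[OF w] t by auto
    let ?C = "{B - {e} |B. B \<in> bases M \<and> e \<in> B}"
    have bc: "bases (contract M {e}) = ?C" using bases_contract[OF m ab] e by auto
    have eE: "e \<in> fst M" using wit_sub[OF w] e by blast
    have g: "good (fst M - {e}) ?C"
      using R(3)[OF eE] in_R_iff_good[OF contract_matroid[OF m]] bc contract_fst[OF m] by simp
    have wc: "wit ?C (S - {e}) T" if w: "wit (bases M) S T" "e \<in> S" for S T
    proof -
      have "insert x (insert y (S - {e})) \<in> ?C" if "x \<in> T" "y \<in> T" "x \<noteq> y" for x y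
      proof -
        have "x \<noteq> e" "y \<noteq> e" using that w unfolding wit_def by auto
        then have "insert x (insert y (S - {e})) = insert x (insert y S) - {e}" by auto
        moreover have "insert x (insert y S) \<in> bases M" using witD[OF w(1) that] .
        ultimately show ?thesis using w(2) by blast
      qed
      then show ?thesis using w(1) unfolding wit_def by blast
    qed
    obtain G where G: "free_base (fst M - {e}) ?C G" "\<And>S T. wit ?C S T \<Longrightarrow> through G S T"
      using g wc[OF w e] unfolding good_def by blast
    have mem: "insert e X \<in> bases M" "e \<notin> X" if "X \<in> ?C" for X using that by (auto simp: insert_absorb)
    have GC: "G \<in> ?C" using G(1) unfolding free_base_def by blast
    note Gm = mem[OF GC]
    have f1: "through (insert e G) S T" if "wit (bases M) S T" "e \<in> S" for S T
      using G(2)[OF wc[OF that]] that unfolding through_def by auto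
    have f2: "insert f (insert e G - {h}) \<in> bases M" if "h \<in> insert e G - {e}" "f \<in> fst M - insert e G" for h f
    proof -
      have "insert f (G - {h}) \<in> ?C" using G(1) that unfolding free_base_def by blast
      moreover have "insert f (insert e G - {h}) = insert e (insert f (G - {h}))" using that Gm by auto
      ultimately show ?thesis using mem(1)[of "insert f (G - {h})"] by simp
    qed
    show "\<exists>G\<in>bases M. e \<in> G \<and> (\<forall>h\<in>G - {e}. \<forall>f\<in>fst M - G. insert f (G - {h}) \<in> bases M) \<and>
        (\<forall>S T. wit (bases M) S T \<longrightarrow> e \<in> S \<longrightarrow> through G S T)"
    proof (rule bexI[of _ "insert e G"])
      have "\<forall>h\<in>insert e G - {e}. \<forall>f\<in>fst M - insert e G. insert f (insert e G - {h}) \<in> bases M" using f2 by blast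
      moreover have "\<forall>S T. wit (bases M) S T \<longrightarrow> e \<in> S \<longrightarrow> through (insert e G) S T" using f1 by blast
      ultimately show "e \<in> insert e G \<and> (\<forall>h\<in>insert e G - {e}. \<forall>f\<in>fst M - insert e G. insert f (insert e G - {h}) \<in> bases M) \<and>
        (\<forall>S T. wit (bases M) S T \<longrightarrow> e \<in> S \<longrightarrow> through (insert e G) S T)" by simp
    qed (rule Gm(1))
  qed
qed

section \<open>Small configurations exhaust the ground set of an excluded minor\<close>

context minor_minimal begin

text \<open>If a configuration of lines leaves an element \<open>e\<close> to spare, always deleted
  or always contracted, all its lines survive in one minor, so a single base \<open>G\<close> lies
  on all of them. The next lemmas show that their configurations admit no such
  \<open>G\<close>.\<close>

lemma common_base:
  assumes W: "W S0 T0" "\<And>S T. W S T \<Longrightarrow> wit \<B> S T"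
    and e: "(\<forall>S T. W S T \<longrightarrow> e \<in> E - S - T) \<or> (\<forall>S T. W S T \<longrightarrow> e \<in> S)"
  shows "\<exists>G\<in>\<B>. (\<forall>S T. W S T \<longrightarrow> through G S T) \<and> (\<forall>h\<in>G - {e}. \<forall>f\<in>E - G - {e}. insert f (G - {h}) \<in> \<B>)"
  using e
proof
  assume a: "\<forall>S T. W S T \<longrightarrow> e \<in> E - S - T"
  have e0: "e \<in> E - S0 - T0" using a W(1) by blast
  obtain G where "G \<in> \<B>" "\<And>h f. h \<in> G \<Longrightarrow> f \<in> E - G - {e} \<Longrightarrow> insert f (G - {h}) \<in> \<B>"
    "\<And>S T. wit \<B> S T \<Longrightarrow> e \<notin> S \<union> T \<Longrightarrow> through G S T" using deletion[OF W(2)[OF W(1)] e0] by blast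
  then show ?thesis using a W(2) by blast
next
  assume a: "\<forall>S T. W S T \<longrightarrow> e \<in> S"
  have e0: "e \<in> S0" using a W(1) by blast
  obtain G where "G \<in> \<B>" "\<And>h f. h \<in> G - {e} \<Longrightarrow> f \<in> E - G \<Longrightarrow> insert f (G - {h}) \<in> \<B>"
    "\<And>S T. wit \<B> S T \<Longrightarrow> e \<in> S \<Longrightarrow> through G S T" using contraction[OF W(2)[OF W(1)] e0] by blast
  then show ?thesis using a W(2) by blast
qed

text \<open>Any four of the five points form a line over \<open>S\<close>; a base through
  \<open>T\<close> uses a point of \<open>T\<close>, and the line omitting this point misses
  it.\<close>

lemma five_point_line:
  assumes w: "wit \<B> S T" and r: "r \<in> E - S - T" and a: "\<And>t. t \<in> T \<Longrightarrow> insert r (insert t S) \<in> \<B>"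
  shows "S = {} \<and> E = insert r T"
proof (rule ccontr)
  assume n: "\<not> ?thesis"
  have st: "S \<inter> T = {}" "card T = 4" "T \<subseteq> E" "finite T" using w wit_sub[OF w] wit_card[OF w] unfolding wit_def by auto
  obtain e where e: "e \<in> S \<or> e \<in> E - S - T - {r}" using n st r by blast
  define W where "W S' T' \<longleftrightarrow> S' = S \<and> (\<exists>t. T' = insert r T - {t} \<and> t \<in> insert r T)" for S' T'
  have Wr: "W S T" unfolding W_def using r by auto
  have ww: "wit \<B> S' T'" if W: "W S' T'" for S' T'
  proof -
    obtain t where t: "S' = S" "T' = insert r T - {t}" "t \<in> insert r T" using W unfolding W_def by blast
    have "card T' = 4" using t st r by simp
    moreover have "insert x (insert y S) \<in> \<B>" if "x \<in> insert r T" "y \<in> insert r T" "x \<noteq> y" for x y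
      using that a[of x] a[of y] witD[OF w, of x y] by (auto simp: insert_commute)
    ultimately show ?thesis unfolding wit_def using t st r by auto
  qed
  have dis: "(\<forall>S T. W S T \<longrightarrow> e \<in> E - S - T) \<or> (\<forall>S T. W S T \<longrightarrow> e \<in> S)" using e unfolding W_def by auto
  obtain G where G: "G \<in> \<B>" "\<And>S T. W S T \<Longrightarrow> through G S T"
    "\<And>h f. h \<in> G - {e} \<Longrightarrow> f \<in> E - G - {e} \<Longrightarrow> insert f (G - {h}) \<in> \<B>" using common_base[of W, OF Wr ww dis] by metis
  obtain x y where xy: "x \<in> T" "G = insert x (insert y S)"
    using through_base[OF base_family_axioms w G(2)[OF Wr] cardB[OF G(1)]] by blast
  have "W S (insert r T - {x})" unfolding W_def using xy by blast
  then have "x \<in> S \<union> (insert r T - {x})" using G(2) xy unfolding through_def by blast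
  then show False using xy st by auto
qed

text \<open>A base through the line would allow one of its points in \<open>T\<close> to be
  exchanged for \<open>r\<close>, but \<open>r\<close> forms no base over \<open>S\<close> with any
  point of \<open>T\<close>.\<close>

lemma line_and_loop:
  assumes w: "wit \<B> S T" and r: "r \<in> E - S - T" and a: "\<And>t. t \<in> T \<Longrightarrow> insert r (insert t S) \<notin> \<B>"
  shows "S = {} \<and> E = insert r T"
proof (rule ccontr)
  assume n: "\<not> ?thesis"
  have st: "S \<inter> T = {}" "T \<subseteq> E" using w wit_sub[OF w] unfolding wit_def by auto
  obtain e where e: "e \<in> S \<or> e \<in> E - S - T - {r}" using n st r by blast
  define W where "W S' T' \<longleftrightarrow> S' = S \<and> T' = T" for S' T'
  have Wr: "W S T" unfolding W_def by simp
  have ww: "wit \<B> S' T'" if "W S' T'" for S' T' using that w W_def by auto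
  have dis: "(\<forall>S T. W S T \<longrightarrow> e \<in> E - S - T) \<or> (\<forall>S T. W S T \<longrightarrow> e \<in> S)" using e unfolding W_def by auto
  obtain G where G: "G \<in> \<B>" "\<And>S T. W S T \<Longrightarrow> through G S T"
    "\<And>h f. h \<in> G - {e} \<Longrightarrow> f \<in> E - G - {e} \<Longrightarrow> insert f (G - {h}) \<in> \<B>" using common_base[of W, OF Wr ww dis] by metis
  obtain x y where xy: "x \<in> T" "y \<in> T" "x \<noteq> y" "G = insert x (insert y S)"
    using through_base[OF base_family_axioms w G(2)[OF Wr] cardB[OF G(1)]] by blast
  have "r \<in> E - G - {e}" using xy r e by auto
  moreover have "x \<in> G - {e}" using xy e st by auto
  ultimately have "insert r (G - {x}) \<in> \<B>" using G(3) by blast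
  moreover have "G - {x} = insert y S" using xy st by auto
  ultimately show False using a xy by auto
qed

text \<open>The partners \<open>r1, r2, r3\<close> together with \<open>t4\<close> form a second
  line over \<open>S\<close>. The two lines share only \<open>t4\<close>, whereas a common base
  would need two shared points.\<close>

lemma three_parallel_pairs:
  assumes w: "wit \<B> S {t1,t2,t3,t4}" and d: "distinct [t1,t2,t3,t4]" and r: "{r1,r2,r3} \<subseteq> E - S - {t1,t2,t3,t4}"
    and l1: "\<And>t. t \<in> {t1,t2,t3,t4} \<Longrightarrow> insert r1 (insert t S) \<in> \<B> \<longleftrightarrow> t \<noteq> t1"
    and l2: "\<And>t. t \<in> {t1,t2,t3,t4} \<Longrightarrow> insert r2 (insert t S) \<in> \<B> \<longleftrightarrow> t \<noteq> t2"
    and l3: "\<And>t. t \<in> {t1,t2,t3,t4} \<Longrightarrow> insert r3 (insert t S) \<in> \<B> \<longleftrightarrow> t \<noteq> t3"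
  shows "S = {} \<and> E = {t1,t2,t3,t4,r1,r2,r3} \<and> distinct [t1,t2,t3,t4,r1,r2,r3] \<and>
    insert r1 (insert r2 S) \<in> \<B> \<and> insert r1 (insert r3 S) \<in> \<B> \<and> insert r2 (insert r3 S) \<in> \<B>"
proof -
  let ?T = "{t1,t2,t3,t4}"
  have st: "S \<inter> ?T = {}" "?T \<subseteq> E" using w wit_sub[OF w] unfolding wit_def by blast+
  have dr: "r1 \<noteq> r2" "r1 \<noteq> r3" "r2 \<noteq> r3" using l1[of t1] l2[of t1] l2[of t2] l3[of t1] l3[of t2] d by auto
  note lx = line_exchange[OF wit_card(1)[OF w]]
  have sw: "insert x (insert y S) \<in> \<B>" if "insert y (insert x S) \<in> \<B>" for x y using that by (simp add: insert_commute)
  have p12: "insert r1 (insert r2 S) \<in> \<B>"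
    by (rule lx[OF sw, of r2 t1 r1 t4]) (use l1[of t1] l2[of t1] l1[of t4] d in auto)
  have p13: "insert r1 (insert r3 S) \<in> \<B>"
    by (rule lx[OF sw, of r3 t1 r1 t4]) (use l1[of t1] l3[of t1] l1[of t4] d in auto)
  have p23: "insert r2 (insert r3 S) \<in> \<B>"
    by (rule lx[OF sw, of r3 t2 r2 t4]) (use l2[of t2] l3[of t2] l2[of t4] d in auto)
  have w2: "wit \<B> S {r1,r2,r3,t4}"
    by (rule witI) (use dr r st p12 p13 p23 l1[of t4] l2[of t4] l3[of t4] d in auto)
  have "S = {} \<and> E = {t1,t2,t3,t4,r1,r2,r3}"
  proof (rule ccontr)
    assume n: "\<not> ?thesis"
    obtain e where e: "e \<in> S \<or> e \<in> E - S - ?T - {r1,r2,r3}" using n st r by blast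
    define W where "W S' T' \<longleftrightarrow> S' = S \<and> (T' = ?T \<or> T' = {r1,r2,r3,t4})" for S' T'
    have Wr: "W S ?T" "W S {r1,r2,r3,t4}" unfolding W_def by auto
    have ww: "wit \<B> S' T'" if "W S' T'" for S' T' using that w w2 W_def by auto
    have dis: "(\<forall>S T. W S T \<longrightarrow> e \<in> E - S - T) \<or> (\<forall>S T. W S T \<longrightarrow> e \<in> S)" using e unfolding W_def by auto
    obtain G where G: "G \<in> \<B>" "\<And>S T. W S T \<Longrightarrow> through G S T"
    "\<And>h f. h \<in> G - {e} \<Longrightarrow> f \<in> E - G - {e} \<Longrightarrow> insert f (G - {h}) \<in> \<B>" using common_base[of W, OF Wr(1) ww dis] by metis
    obtain x y where xy: "x \<in> ?T" "y \<in> ?T" "x \<noteq> y" "G = insert x (insert y S)"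
      using through_base[OF base_family_axioms w G(2)[OF Wr(1)] cardB[OF G(1)]] by blast
    have "G \<subseteq> S \<union> {r1,r2,r3,t4}" using G(2)[OF Wr(2)] unfolding through_def by blast
    then have "x = t4" "y = t4" using xy st r by auto
    then show False using xy by simp
  qed
  then show ?thesis using dr d r p12 p13 p23 by auto
qed

text \<open>For distinct \<open>p, q\<close> in \<open>X\<close>, the points of \<open>Y\<close> and
  \<open>q\<close> form a line over \<open>Z + p\<close>. A base on all these lines contains
  \<open>Z \<union> X\<close> and has its size, but \<open>Z \<union> X\<close> is no base.\<close>

lemma two_disjoint_triangles:
  assumes c: "card X = 3" "card Y = 3" "X \<inter> Y = {}" "Z \<inter> (X \<union> Y) = {}" "Z \<union> X \<notin> \<B>"
    and p1: "\<And>p q w. p \<in> X \<Longrightarrow> q \<in> X \<Longrightarrow> w \<in> Y \<Longrightarrow> p \<noteq> q \<Longrightarrow> insert p (insert q (insert w Z)) \<in> \<B>"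
    and p2: "\<And>p q w. p \<in> X \<Longrightarrow> q \<in> Y \<Longrightarrow> w \<in> Y \<Longrightarrow> q \<noteq> w \<Longrightarrow> insert p (insert q (insert w Z)) \<in> \<B>"
  shows "Z = {} \<and> E = X \<union> Y"
proof (rule ccontr)
  assume n: "\<not> ?thesis"
  obtain x y z where X: "X = {x,y,z}" "distinct [x,y,z]" using card3E[OF c(1)] .
  obtain a b d where Y: "Y = {a,b,d}" "distinct [a,b,d]" using card3E[OF c(2)] .
  have XE: "X \<union> Y \<subseteq> E"
    using sub[OF p1[of x y a]] sub[OF p1[of x z b]] sub[OF p2[of x b d]] X Y by auto
  obtain e where e: "e \<in> Z \<or> e \<in> E - Z - X - Y" using n XE by blast
  define W where "W S' T' \<longleftrightarrow> (\<exists>p q. p \<in> X \<and> q \<in> X \<and> p \<noteq> q \<and> S' = insert p Z \<and> T' = insert q Y)" for S' T'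
  have Wr: "W (insert x Z) (insert y Y)" unfolding W_def using X by auto
  have fY: "finite Y" using Y by simp
  have ww: "wit \<B> S' T'" if W: "W S' T'" for S' T'
  proof -
    obtain p q where pq: "p \<in> X" "q \<in> X" "p \<noteq> q" "S' = insert p Z" "T' = insert q Y" using W unfolding W_def by blast
    have qY: "q \<notin> Y" "p \<notin> Y" "p \<notin> Z" "q \<notin> Z" "Z \<inter> Y = {}" using pq c by auto
    have "card T' = 4" using pq c qY fY by simp
    moreover have "S' \<inter> T' = {}" using pq qY by auto
    moreover have "insert u (insert v S') \<in> \<B>" if uv: "u \<in> T'" "v \<in> T'" "u \<noteq> v" for u v
    proof -
      consider "u \<in> Y" "v \<in> Y" | "u = q" "v \<in> Y" | "v = q" "u \<in> Y" using uv pq by auto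
      then show ?thesis
      proof cases
        case 1
        then show ?thesis using p2[OF pq(1) 1 uv(3)] pq by (simp add: insert_commute)
      next
        case 2
        then show ?thesis using p1[OF pq(2,1) 2(2)] pq by (simp add: insert_commute)
      next
        case 3
        then show ?thesis using p1[OF pq(2,1) 3(2)] pq by (simp add: insert_commute)
      qed
    qed
    ultimately show ?thesis unfolding wit_def by blast
  qed
  have dis: "(\<forall>S T. W S T \<longrightarrow> e \<in> E - S - T) \<or> (\<forall>S T. W S T \<longrightarrow> e \<in> S)" using e unfolding W_def by auto
  obtain G where G: "G \<in> \<B>" "\<And>S T. W S T \<Longrightarrow> through G S T"
    "\<And>h f. h \<in> G - {e} \<Longrightarrow> f \<in> E - G - {e} \<Longrightarrow> insert f (G - {h}) \<in> \<B>" using common_base[of W, OF Wr ww dis] by metis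
  have "W (insert x Z) (insert y Y)" "W (insert y Z) (insert x Y)" "W (insert z Z) (insert y Y)" unfolding W_def using X by auto
  then have sub: "Z \<union> X \<subseteq> G" using G(2) X unfolding through_def by blast
  have fZ: "finite Z" using sub finB[OF G(1)] finite_subset by blast
  have "card (insert x Z) + 2 = rk" using wit_card(1)[OF ww[OF Wr]] .
  then have "card (Z \<union> X) = rk" using c X fZ by auto
  then have "Z \<union> X = G" using card_subset_eq[OF finB[OF G(1)] sub] cardB[OF G(1)] by simp
  then show False using G c by simp
qed

end

section \<open>The small matroids up to isomorphism\<close>

text \<open>Used to restate the isomorphism types, which are defined by independent sets, in terms
  of bases.\<close>

lemma indep_iff_bases:
  assumes m: "matroid M" and I: "\<And>X. X \<in> \<I> \<longleftrightarrow> (\<exists>B\<in>\<B>. X \<subseteq> B)" and c: "\<And>B. B \<in> \<B> \<Longrightarrow> finite B \<and> card B = k"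
  shows "snd M = \<I> \<longleftrightarrow> bases M = \<B>"
proof
  assume s: "snd M = \<I>"
  show "bases M = \<B>"
  proof (intro equalityI subsetI)
    fix B assume B: "B \<in> bases M"
    then obtain B' where B': "B' \<in> \<B>" "B \<subseteq> B'" using basesD(1)[OF B] s I by blast
    then have "B' \<in> snd M" using s I by blast
    then show "B \<in> \<B>" using basesD(2)[OF B _ B'(2)] B' by blast
  next
    fix B assume B: "B \<in> \<B>"
    then have "B \<in> snd M" using s I by blast
    moreover have "J = B" if J: "J \<in> snd M" "B \<subseteq> J" for J
    proof -
      obtain B' where B': "B' \<in> \<B>" "J \<subseteq> B'" using J s I by blast
      have "card B = card B'" "finite B'" using c B B' by auto
      then have "B = B'" using card_subset_eq B' J by blast
      then show ?thesis using B' J by blast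
    qed
    ultimately show "B \<in> bases M" unfolding bases_def by blast
  qed
next
  assume "bases M = \<B>"
  then show "snd M = \<I>" using matroid_indep_iff[OF m] I by blast
qed

lemma uniform_indep_iff:
  assumes "finite F" "k \<le> card F"
  shows "X \<in> {X. X \<subseteq> F \<and> card X \<le> k} \<longleftrightarrow> (\<exists>B\<in>{B. B \<subseteq> F \<and> card B = k}. X \<subseteq> B)"
proof
  assume X: "X \<in> {X. X \<subseteq> F \<and> card X \<le> k}"
  then show "\<exists>B\<in>{B. B \<subseteq> F \<and> card B = k}. X \<subseteq> B"
    using exists_subset_between[of X k F] assms by auto
next
  assume "\<exists>B\<in>{B. B \<subseteq> F \<and> card B = k}. X \<subseteq> B"
  then obtain B where "B \<subseteq> F" "card B = k" "X \<subseteq> B" by blast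
  then show "X \<in> {X. X \<subseteq> F \<and> card X \<le> k}" using card_mono[of B X] assms finite_subset[of B F] by auto
qed

lemma uniform_bases_iff:
  assumes m: "matroid M" and F: "F \<subseteq> fst M" "k \<le> card F"
  shows "snd M = {X. X \<subseteq> F \<and> card X \<le> k} \<longleftrightarrow> bases M = {B. B \<subseteq> F \<and> card B = k}"
proof -
  have f: "finite F" using F matroidD(1)[OF m] finite_subset by blast
  show ?thesis
    by (rule indep_iff_bases[where k = k, OF m uniform_indep_iff[OF f F(2)]]) (use f finite_subset in auto)
qed

lemma iso_uniform_iff:
  assumes m: "matroid M" and k: "k \<le> n"
  shows "iso M (U k n) \<longleftrightarrow> card (fst M) = n \<and> bases M = {B. B \<subseteq> fst M \<and> card B = k}"
proof -
  have "iso M (U k n) \<longleftrightarrow> card (fst M) = n \<and> snd M = {X. X \<subseteq> fst M \<and> card X \<le> k}"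
  proof
    assume "iso M (U k n)"
    then obtain f where f: "bij_betw f (fst M) {0..<n}"
      "\<And>X. X \<subseteq> fst M \<Longrightarrow> X \<in> snd M \<longleftrightarrow> f ` X \<subseteq> {0..<n} \<and> card (f ` X) \<le> k"
      unfolding iso_def U_def by auto
    have "X \<in> snd M \<longleftrightarrow> card X \<le> k" if X: "X \<subseteq> fst M" for X
    proof -
      have "card (f ` X) = card X" using f(1) X by (meson bij_betw_def card_image inj_on_subset)
      moreover have "f ` X \<subseteq> {0..<n}" using f(1) X unfolding bij_betw_def by blast
      ultimately show ?thesis using f(2)[OF X] by simp
    qed
    then show "card (fst M) = n \<and> snd M = {X. X \<subseteq> fst M \<and> card X \<le> k}"
      using matroidD(2)[OF m] bij_betw_same_card[OF f(1)] by auto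
  next
    assume a: "card (fst M) = n \<and> snd M = {X. X \<subseteq> fst M \<and> card X \<le> k}"
    obtain f where f: "bij_betw f (fst M) {0..<n}" using ex_bij_betw_finite_nat[OF matroidD(1)[OF m]] a by blast
    have "X \<in> snd M \<longleftrightarrow> f ` X \<in> snd (U k n)" if X: "X \<subseteq> fst M" for X
    proof -
      have "card (f ` X) = card X" using f(1) X by (meson bij_betw_def card_image inj_on_subset)
      moreover have "f ` X \<subseteq> {0..<n}" using f(1) X unfolding bij_betw_def by blast
      ultimately show ?thesis using a X by (simp add: U_def)
    qed
    then show "iso M (U k n)" unfolding iso_def using f by (intro exI[of _ f]) (simp add: U_def)
  qed
  then show ?thesis using uniform_bases_iff[OF m order_refl, of k] k by auto
qed

text \<open>Here \<open>e\<close> is the preimage of the single element of the right summand: a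
  coloop for \<open>k = 1\<close>, a loop for \<open>k = 0\<close>.\<close>

lemma iso_dsum_iff:
  assumes m: "matroid M"
  shows "iso M (dsum (U 2 4) (U k 1)) \<longleftrightarrow>
    (\<exists>e\<in>fst M. card (fst M) = 5 \<and> snd M = {X. X \<subseteq> fst M \<and> card (X - {e}) \<le> 2 \<and> (e \<in> X \<longrightarrow> 1 \<le> k)})"
proof -
  have D: "Y \<in> snd (dsum (U 2 4) (U k 1)) \<longleftrightarrow> card (Inl -` Y) \<le> 2 \<and> card (Inr -` Y) \<le> k"
    if "Y \<subseteq> {0..<4} <+> {0..<1}" for Y
    using that by (auto simp: dsum_def U_def)
  have key: "card (Inl -` (f ` X)) = card (X - {e}) \<and> card (Inr -` (f ` X)) = (if e \<in> X then 1 else 0)"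
    if f: "bij_betw f (fst M) ({0..<4} <+> {0..<1})" "f e = Inr 0" "e \<in> fst M" and X: "X \<subseteq> fst M"
    for f :: "'a \<Rightarrow> nat + nat" and e X
  proof -
    have inj: "inj_on f (fst M)" and im: "f ` fst M = {0..<4} <+> {0..<1}" using f(1) unfolding bij_betw_def by auto
    have only: "f x \<in> range Inl" if "x \<in> X - {e}" for x
    proof -
      have "f x \<in> {0..<4} <+> {0..<1}" using that X im by blast
      moreover have "f x \<noteq> Inr 0" using inj f(2,3) that X by (metis DiffE inj_onD insertI1 subsetD)
      ultimately show ?thesis by auto
    qed
    have "(Inl ` (Inl -` (f ` X)) :: (nat + nat) set) = f ` (X - {e})"
    proof (intro equalityI subsetI)
      fix y :: "nat + nat" assume "y \<in> Inl ` (Inl -` (f ` X))"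
      then show "y \<in> f ` (X - {e})" using f(2) by force
    next
      fix y :: "nat + nat" assume "y \<in> f ` (X - {e})"
      then obtain x where x: "x \<in> X - {e}" "y = f x" by blast
      obtain z where "f x = Inl z" using only[OF x(1)] by blast
      then show "y \<in> Inl ` (Inl -` (f ` X))" using x by (metis DiffD1 image_eqI vimageI)
    qed
    then have "card (Inl -` (f ` X)) = card (f ` (X - {e}))" by (metis card_image inj_Inl)
    also have "\<dots> = card (X - {e})" using inj X by (meson Diff_subset card_image inj_on_subset subset_trans)
    finally have 1: "card (Inl -` (f ` X)) = card (X - {e})" .
    have "Inr -` (f ` X) = (if e \<in> X then {0} else {})"
    proof (intro equalityI subsetI)
      fix z :: nat assume "z \<in> Inr -` (f ` X)"
      then obtain x where x: "x \<in> X" "f x = Inr z" by auto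
      have "x = e" using only[of x] x by auto
      then show "z \<in> (if e \<in> X then {0} else {})" using x f(2) by simp
    next
      fix z :: nat assume "z \<in> (if e \<in> X then {0} else {})"
      then have "e \<in> X" "z = 0" by (auto split: if_splits)
      then show "z \<in> Inr -` (f ` X)" using f(2) by (metis image_eqI vimageI)
    qed
    then show ?thesis using 1 by simp
  qed
  show ?thesis
  proof
    assume "iso M (dsum (U 2 4) (U k 1))"
    then obtain f where f: "bij_betw f (fst M) ({0..<4} <+> {0..<1})"
      "\<And>X. X \<subseteq> fst M \<Longrightarrow> X \<in> snd M \<longleftrightarrow> f ` X \<in> snd (dsum (U 2 4) (U k 1))"
      unfolding iso_def by (auto simp: dsum_def U_def)
    have im: "f ` fst M = {0..<4} <+> {0..<1}" using f(1) unfolding bij_betw_def by blast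
    then have "Inr 0 \<in> f ` fst M" by auto
    then obtain e where e: "e \<in> fst M" "f e = Inr 0" by auto
    have c: "card (fst M) = 5" using bij_betw_same_card[OF f(1)] by (simp add: card_Plus)
    have "X \<in> snd M \<longleftrightarrow> card (X - {e}) \<le> 2 \<and> (e \<in> X \<longrightarrow> 1 \<le> k)" if X: "X \<subseteq> fst M" for X
    proof -
      have "f ` X \<subseteq> {0..<4} <+> {0..<1}" using im X by blast
      then show ?thesis using f(2)[OF X] D key[OF f(1) e(2,1) X] by auto
    qed
    then show "\<exists>e\<in>fst M. card (fst M) = 5 \<and> snd M = {X. X \<subseteq> fst M \<and> card (X - {e}) \<le> 2 \<and> (e \<in> X \<longrightarrow> 1 \<le> k)}"
      using e c matroidD(2)[OF m] by (intro bexI[of _ e]) auto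
  next
    assume "\<exists>e\<in>fst M. card (fst M) = 5 \<and> snd M = {X. X \<subseteq> fst M \<and> card (X - {e}) \<le> 2 \<and> (e \<in> X \<longrightarrow> 1 \<le> k)}"
    then obtain e where e: "e \<in> fst M" "card (fst M) = 5" "snd M = {X. X \<subseteq> fst M \<and> card (X - {e}) \<le> 2 \<and> (e \<in> X \<longrightarrow> 1 \<le> k)}" by blast
    have "card (fst M - {e}) = 4" using e matroidD(1)[OF m] by simp
    then obtain g where g: "bij_betw g (fst M - {e}) {0..<4::nat}"
      using ex_bij_betw_finite_nat[of "fst M - {e}"] matroidD(1)[OF m] by auto
    define f :: "'a \<Rightarrow> nat + nat" where "f x = (if x = e then Inr 0 else Inl (g x))" for x
    have f: "bij_betw f (fst M) ({0..<4} <+> {0..<1})" "f e = Inr 0"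
    proof -
      have inj: "inj_on f (fst M)" using g unfolding bij_betw_def inj_on_def f_def by auto
      have "f ` fst M = insert (f e) (f ` (fst M - {e}))" using e by auto
      also have "f ` (fst M - {e}) = Inl ` (g ` (fst M - {e}))" unfolding image_image by (rule image_cong) (auto simp: f_def)
      also have "insert (f e) (Inl ` (g ` (fst M - {e}))) = {0..<4} <+> {0..<1}"
        using g unfolding bij_betw_def by (auto simp: f_def)
      finally show "bij_betw f (fst M) ({0..<4} <+> {0..<1})" using inj unfolding bij_betw_def by blast
      show "f e = Inr 0" by (simp add: f_def)
    qed
    have im: "f ` fst M = {0..<4} <+> {0..<1}" using f(1) unfolding bij_betw_def by blast
    have "X \<in> snd M \<longleftrightarrow> f ` X \<in> snd (dsum (U 2 4) (U k 1))" if X: "X \<subseteq> fst M" for X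
    proof -
      have "f ` X \<subseteq> {0..<4} <+> {0..<1}" using im X by blast
      then show ?thesis using D key[OF f e(1) X] e(3) X by auto
    qed
    then show "iso M (dsum (U 2 4) (U k 1))" unfolding iso_def using f(1) by (intro exI[of _ f]) (simp add: dsum_def U_def)
  qed
qed

lemma iso_line_loop_iff:
  assumes m: "matroid M"
  shows "iso M (dsum (U 2 4) (U 0 1)) \<longleftrightarrow>
    (\<exists>e\<in>fst M. card (fst M) = 5 \<and> bases M = {B. B \<subseteq> fst M - {e} \<and> card B = 2})"
proof -
  have claim: "snd M = {X. X \<subseteq> fst M \<and> card (X - {e}) \<le> 2 \<and> (e \<in> X \<longrightarrow> 1 \<le> (0::nat))} \<longleftrightarrow>
      bases M = {B. B \<subseteq> fst M - {e} \<and> card B = 2}" if "e \<in> fst M" "card (fst M) = 5" for e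
  proof -
    have "{X. X \<subseteq> fst M \<and> card (X - {e}) \<le> 2 \<and> (e \<in> X \<longrightarrow> 1 \<le> (0::nat))} = {X. X \<subseteq> fst M - {e} \<and> card X \<le> 2}"
    proof (rule Collect_cong)
      fix X
      show "(X \<subseteq> fst M \<and> card (X - {e}) \<le> 2 \<and> (e \<in> X \<longrightarrow> 1 \<le> (0::nat))) = (X \<subseteq> fst M - {e} \<and> card X \<le> 2)"
        by (cases "e \<in> X") auto
    qed
    then show ?thesis using uniform_bases_iff[OF m, of "fst M - {e}" 2] that matroidD(1)[OF m] by simp
  qed
  show ?thesis unfolding iso_dsum_iff[OF m]
    by (rule bex_cong[OF refl], rule conj_cong[OF refl], rule claim)
qed

lemma iso_line_coloop_iff:
  assumes m: "matroid M"
  shows "iso M (dsum (U 2 4) (U 1 1)) \<longleftrightarrow>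
    (\<exists>e\<in>fst M. card (fst M) = 5 \<and> bases M = {B. B \<subseteq> fst M \<and> e \<in> B \<and> card B = 3})"
proof -
  have claim: "snd M = {X. X \<subseteq> fst M \<and> card (X - {e}) \<le> 2 \<and> (e \<in> X \<longrightarrow> 1 \<le> (1::nat))} \<longleftrightarrow>
      bases M = {B. B \<subseteq> fst M \<and> e \<in> B \<and> card B = 3}" if e: "e \<in> fst M" "card (fst M) = 5" for e
  proof (rule indep_iff_bases[OF m])
    have fE: "finite (fst M)" using matroidD(1)[OF m] .
    fix X
    show "X \<in> {X. X \<subseteq> fst M \<and> card (X - {e}) \<le> 2 \<and> (e \<in> X \<longrightarrow> 1 \<le> (1::nat))} \<longleftrightarrow>
      (\<exists>B\<in>{B. B \<subseteq> fst M \<and> e \<in> B \<and> card B = 3}. X \<subseteq> B)"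
    proof
      assume "X \<in> {X. X \<subseteq> fst M \<and> card (X - {e}) \<le> 2 \<and> (e \<in> X \<longrightarrow> 1 \<le> (1::nat))}"
      then have X: "X \<subseteq> fst M" "card (X - {e}) \<le> 2" by auto
      have "card (insert e X) \<le> 3" using X e card_Suc_Diff1[of "insert e X" e] finite_subset[OF X(1) fE] by simp
      then show "\<exists>B\<in>{B. B \<subseteq> fst M \<and> e \<in> B \<and> card B = 3}. X \<subseteq> B"
        using exists_subset_between[of "insert e X" 3 "fst M"] e X fE by auto
    next
      assume "\<exists>B\<in>{B. B \<subseteq> fst M \<and> e \<in> B \<and> card B = 3}. X \<subseteq> B"
      then obtain B where B: "B \<subseteq> fst M" "e \<in> B" "card B = 3" "X \<subseteq> B" by blast
      have fB: "finite B" using B fE finite_subset by blast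
      have "card (X - {e}) \<le> card (B - {e})" using B fB by (intro card_mono) auto
      then show "X \<in> {X. X \<subseteq> fst M \<and> card (X - {e}) \<le> 2 \<and> (e \<in> X \<longrightarrow> 1 \<le> (1::nat))}" using B fB by auto
    qed
  qed (use matroidD(1)[OF m] finite_subset in auto)
  show ?thesis unfolding iso_dsum_iff[OF m]
    by (rule bex_cong[OF refl], rule conj_cong[OF refl], rule claim)
qed

definition two_triangles :: "'a set \<Rightarrow> 'a set set \<Rightarrow> bool" where
  "two_triangles E \<B> \<longleftrightarrow> (\<exists>X Y. card X = 3 \<and> card Y = 3 \<and> X \<inter> Y = {} \<and> E = X \<union> Y \<and>
     \<B> = {B. B \<subseteq> E \<and> card B = 3 \<and> B \<noteq> X \<and> B \<noteq> Y})"

lemma iso_R6_iff: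
  assumes m: "matroid M"
  shows "iso M R6 \<longleftrightarrow> two_triangles (fst M) (bases M)"
proof -
  have fE: "finite (fst M)" using matroidD(1)[OF m] .
  have "iso M R6 \<longleftrightarrow> (\<exists>X Y. card X = 3 \<and> card Y = 3 \<and> X \<inter> Y = {} \<and> fst M = X \<union> Y \<and>
     snd M = {I. I \<subseteq> fst M \<and> card I \<le> 3 \<and> I \<noteq> X \<and> I \<noteq> Y})"
  proof
    assume "iso M R6"
    then obtain f where f0: "bij_betw f (fst M) (fst R6)" "\<And>X. X \<subseteq> fst M \<Longrightarrow> X \<in> snd M \<longleftrightarrow> f ` X \<in> snd R6"
      unfolding iso_def by blast
    have f: "bij_betw f (fst M) {0..<6}" using f0(1) by (simp add: R6_def)
    have f2: "X \<in> snd M \<longleftrightarrow> f ` X \<subseteq> {0..<6} \<and> card (f ` X) \<le> 3 \<and> f ` X \<noteq> {0,1,2} \<and> f ` X \<noteq> {3,4,5}"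
      if "X \<subseteq> fst M" for X using f0(2)[OF that] unfolding R6_def snd_conv mem_Collect_eq .
    have inj: "inj_on f (fst M)" and im: "f ` fst M = {0..<6}" using f unfolding bij_betw_def by auto
    define X where "X = {x\<in>fst M. f x \<in> {0,1,2}}"
    define Y where "Y = {x\<in>fst M. f x \<in> {3,4,5}}"
    have ss: "X \<subseteq> fst M" "Y \<subseteq> fst M" by (auto simp: X_def Y_def)
    have iX: "f ` X = {0,1,2}" 
    proof -
      have "f ` X = f ` fst M \<inter> {0,1,2}" unfolding X_def by auto
      then show ?thesis using im by auto
    qed
    have iY: "f ` Y = {3,4,5}" 
    proof -
      have "f ` Y = f ` fst M \<inter> {3,4,5}" unfolding Y_def by auto
      then show ?thesis using im by auto
    qed
    have cf: "card (f ` A) = card A" if "A \<subseteq> fst M" for A using inj that by (meson card_image inj_on_subset)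
    have c: "card X = 3" "card Y = 3" using cf[OF ss(1)] cf[OF ss(2)] iX iY by auto
    have d: "X \<inter> Y = {}" by (auto simp: X_def Y_def)
    have "f x \<in> {0,1,2,3,4,5}" if "x \<in> fst M" for x
    proof -
      have "f x \<in> {0..<6}" using im that by blast
      then show ?thesis by auto
    qed
    then have u: "fst M = X \<union> Y" unfolding X_def Y_def by blast
    have "I \<in> snd M \<longleftrightarrow> card I \<le> 3 \<and> I \<noteq> X \<and> I \<noteq> Y" if I: "I \<subseteq> fst M" for I
    proof -
      have "f ` I = {0,1,2} \<longleftrightarrow> I = X" "f ` I = {3,4,5} \<longleftrightarrow> I = Y"
        using inj_on_image_eq_iff[OF inj I ss(1)] inj_on_image_eq_iff[OF inj I ss(2)] iX iY by auto
      moreover have "f ` I \<subseteq> {0..<6}" using im I by blast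
      ultimately show ?thesis using f2[OF I] cf[OF I] by simp
    qed
    then have sM: "snd M = {I. I \<subseteq> fst M \<and> card I \<le> 3 \<and> I \<noteq> X \<and> I \<noteq> Y}" using matroidD(2)[OF m] by blast
    show "\<exists>X Y. card X = 3 \<and> card Y = 3 \<and> X \<inter> Y = {} \<and> fst M = X \<union> Y \<and>
     snd M = {I. I \<subseteq> fst M \<and> card I \<le> 3 \<and> I \<noteq> X \<and> I \<noteq> Y}"
      by (intro exI[of _ X] exI[of _ Y] conjI c d u sM)
  next
    assume "\<exists>X Y. card X = 3 \<and> card Y = 3 \<and> X \<inter> Y = {} \<and> fst M = X \<union> Y \<and>
     snd M = {I. I \<subseteq> fst M \<and> card I \<le> 3 \<and> I \<noteq> X \<and> I \<noteq> Y}"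
    then obtain X Y where xy: "card X = 3" "card Y = 3" "X \<inter> Y = {}" "fst M = X \<union> Y"
      "snd M = {I. I \<subseteq> fst M \<and> card I \<le> 3 \<and> I \<noteq> X \<and> I \<noteq> Y}" by (elim exE conjE)
    have fin: "finite X" "finite Y" using xy(4) fE by simp_all
    obtain g where g: "bij_betw g X {0..<3::nat}" using ex_bij_betw_finite_nat[OF fin(1)] xy(1) by auto
    obtain k where k: "bij_betw k Y {0..<3::nat}" using ex_bij_betw_finite_nat[OF fin(2)] xy(2) by auto
    define f where "f x = (if x \<in> X then g x else k x + (3::nat))" for x
    have iX: "f ` X = {0..<3}" using g unfolding bij_betw_def f_def by auto
    have "f ` Y = (\<lambda>x. k x + 3) ` Y" by (rule image_cong) (use xy(3) in \<open>auto simp: f_def\<close>)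
    also have "\<dots> = (\<lambda>n. n + 3) ` (k ` Y)" by (simp add: image_image)
    also have "\<dots> = {3..<6}" using k unfolding bij_betw_def by (simp add: image_add_atLeastLessThan')
    finally have iY: "f ` Y = {3..<6}" .
    have im: "f ` fst M = {0..<6}" using iX iY xy(4) by (auto simp: image_Un)
    have "card (f ` fst M) = card (fst M)" using im xy(1-4) fin by (simp add: card_Un_disjoint)
    then have inj: "inj_on f (fst M)" using fE by (intro eq_card_imp_inj_on) auto
    have eX: "{0..<3} = {0,1,2::nat}" and eY: "{3..<6} = {3,4,5::nat}" by auto
    have "I \<in> snd M \<longleftrightarrow> f ` I \<in> snd R6" if I: "I \<subseteq> fst M" for I
    proof -
      have "f ` I = {0,1,2} \<longleftrightarrow> I = X" "f ` I = {3,4,5} \<longleftrightarrow> I = Y"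
        using inj_on_image_eq_iff[OF inj I, of X] inj_on_image_eq_iff[OF inj I, of Y] iX iY xy(4) eX eY by auto
      moreover have "card (f ` I) = card I" using inj I by (meson card_image inj_on_subset)
      moreover have "f ` I \<subseteq> {0..<6}" using im I by blast
      ultimately show ?thesis using xy(5) I by (simp add: R6_def)
    qed
    then show "iso M R6" unfolding iso_def using im inj by (intro exI[of _ f]) (simp add: bij_betw_def R6_def)
  qed
  also have "\<dots> \<longleftrightarrow> two_triangles (fst M) (bases M)"
  proof -
    have "snd M = {I. I \<subseteq> fst M \<and> card I \<le> 3 \<and> I \<noteq> X \<and> I \<noteq> Y} \<longleftrightarrow>
      bases M = {B. B \<subseteq> fst M \<and> card B = 3 \<and> B \<noteq> X \<and> B \<noteq> Y}"
      if xy: "card X = 3" "card Y = 3" "X \<inter> Y = {}" "fst M = X \<union> Y" for X Y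
    proof (rule indep_iff_bases[OF m])
      have fin: "finite X" "finite Y" using xy(4) fE by simp_all
      fix I
      show "I \<in> {I. I \<subseteq> fst M \<and> card I \<le> 3 \<and> I \<noteq> X \<and> I \<noteq> Y} \<longleftrightarrow> (\<exists>B\<in>{B. B \<subseteq> fst M \<and> card B = 3 \<and> B \<noteq> X \<and> B \<noteq> Y}. I \<subseteq> B)"
      proof
        assume "I \<in> {I. I \<subseteq> fst M \<and> card I \<le> 3 \<and> I \<noteq> X \<and> I \<noteq> Y}"
        then have I: "I \<subseteq> fst M" "card I \<le> 3" "I \<noteq> X" "I \<noteq> Y" by auto
        show "\<exists>B\<in>{B. B \<subseteq> fst M \<and> card B = 3 \<and> B \<noteq> X \<and> B \<noteq> Y}. I \<subseteq> B"
        proof (cases "card I = 3")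
          case True then show ?thesis using I by blast
        next
          case False
          then have c2: "card I \<le> 2" using I by simp
          have fI: "finite I" using I fE finite_subset by blast
          \<comment> \<open>It suffices to enlarge \<open>I\<close> to at most three elements lying
            in neither triangle: any three-element set containing \<open>J\<close> then differs from
            both.\<close>
          have "\<exists>J. I \<subseteq> J \<and> J \<subseteq> fst M \<and> card J \<le> 3 \<and> \<not> J \<subseteq> X \<and> \<not> J \<subseteq> Y"
          proof -
            have "X \<noteq> {}" "Y \<noteq> {}" using xy(1,2) by auto
            then obtain x y where e: "x \<in> X" "y \<in> Y" by blast
            have nxy: "x \<notin> Y" "y \<notin> X" using e xy(3) by blast+
            have ss: "X \<subseteq> fst M" "Y \<subseteq> fst M" using xy(4) by blast+
            have c3: "card (insert z I) \<le> 3" for z using c2 fI by (simp add: card_insert_if)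
            consider "I = {}" | i where "I \<subseteq> X" "i \<in> I" | i where "I \<subseteq> Y" "i \<in> I" | "\<not> I \<subseteq> X" "\<not> I \<subseteq> Y" by blast
            then show ?thesis
            proof cases
              case 1
              have "card {x,y} \<le> 3" by (simp add: card_insert_if)
              then show ?thesis using 1 e nxy ss by (intro exI[of _ "{x,y}"]) blast
            next
              case 2
              then have "i \<notin> Y" using xy(3) by blast
              then show ?thesis using 2 e nxy ss I(1) c3[of y] by (intro exI[of _ "insert y I"]) blast
            next
              case 3
              then have "i \<notin> X" using xy(3) by blast
              then show ?thesis using 3 e nxy ss I(1) c3[of x] by (intro exI[of _ "insert x I"]) blast
            next
              case 4
              then show ?thesis using I(1,2) by blast
            qed
          qed
          then obtain J where J: "I \<subseteq> J" "J \<subseteq> fst M" "card J \<le> 3" "\<not> J \<subseteq> X" "\<not> J \<subseteq> Y" by blast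
          have "3 \<le> card (fst M)" using xy fin by (simp add: card_Un_disjoint)
          then obtain B where "J \<subseteq> B" "B \<subseteq> fst M" "card B = 3" using exists_subset_between[of J 3 "fst M"] J fE by auto
          then show ?thesis using J by blast
        qed
      next
        assume "\<exists>B\<in>{B. B \<subseteq> fst M \<and> card B = 3 \<and> B \<noteq> X \<and> B \<noteq> Y}. I \<subseteq> B"
        then obtain B where B: "B \<subseteq> fst M" "card B = 3" "B \<noteq> X" "B \<noteq> Y" "I \<subseteq> B" by blast
        have fB: "finite B" using B fE finite_subset by blast
        have "card I \<le> 3" using card_mono[OF fB B(5)] B by simp
        moreover have "I \<noteq> X" "I \<noteq> Y" using card_subset_eq[OF fB B(5)] B xy by auto
        ultimately show "I \<in> {I. I \<subseteq> fst M \<and> card I \<le> 3 \<and> I \<noteq> X \<and> I \<noteq> Y}" using B by blast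
      qed
    qed (use fE finite_subset in auto)
    then show ?thesis unfolding two_triangles_def by (intro iff_exI) (simp cong: conj_cong)
  qed
  finally show ?thesis .
qed

lemma iso_dual:
  assumes m: "matroid M" and n: "matroid N" and i: "iso M N"
  shows "iso (dual M) (dual N)"
proof -
  obtain f where f: "bij_betw f (fst M) (fst N)" "\<And>X. X \<subseteq> fst M \<Longrightarrow> X \<in> snd M \<longleftrightarrow> f ` X \<in> snd N"
    using i unfolding iso_def by blast
  have inj: "inj_on f (fst M)" and im: "f ` fst M = fst N" using f(1) unfolding bij_betw_def by auto
  interpret bm: base_family "fst M" "bases M" by (rule matroid_base_family[OF m])
  interpret bn: base_family "fst N" "bases N" by (rule matroid_base_family[OF n])
  have cf: "card (f ` A) = card A" if "A \<subseteq> fst M" for A using inj that by (meson card_image inj_on_subset)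
  obtain B0 where B0: "B0 \<in> bases M" using bm.ne by blast
  obtain C0 where C0: "C0 \<in> bases N" using bn.ne by blast
  obtain A where A: "A \<subseteq> fst M" "C0 = f ` A" using bn.sub[OF C0] im by (metis subset_image_iff)
  have "f ` B0 \<in> snd N" using f(2)[OF bm.sub[OF B0]] basesD(1)[OF B0] by blast
  from bases_card_eq(1)[OF n this C0] have 1: "card B0 \<le> card C0" using cf[OF bm.sub[OF B0]] by simp
  have "A \<in> snd M" using f(2)[OF A(1)] basesD(1)[OF C0] A by simp
  from bases_card_eq(1)[OF m this B0] have 2: "card C0 \<le> card B0" using cf[OF A(1)] A by simp
  have b: "B \<in> bases M \<longleftrightarrow> f ` B \<in> bases N" if B: "B \<subseteq> fst M" for B
  proof -
    have "B \<in> bases M \<longleftrightarrow> B \<in> snd M \<and> card B = card B0"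
      using bases_card_eq(2)[OF m _ B0] basesD(1) bm.cardB B0 by metis
    moreover have "f ` B \<in> bases N \<longleftrightarrow> f ` B \<in> snd N \<and> card (f ` B) = card C0"
      using bases_card_eq(2)[OF n _ C0] basesD(1) bn.cardB C0 by metis
    ultimately show ?thesis using 1 2 f(2)[OF B] cf[OF B] by auto
  qed
  have s: "X \<in> snd (dual L) \<longleftrightarrow> (\<exists>B\<in>bases L. X \<subseteq> fst L - B)" if l: "matroid L" for X and L :: "'c matroid"
    using matroid_indep_iff[OF dual_facts(1)[OF l], of X] dual_facts(2)[OF l] by (auto simp: dfam_def)
  have "X \<in> snd (dual M) \<longleftrightarrow> f ` X \<in> snd (dual N)" if X: "X \<subseteq> fst M" for X
  proof
    assume "X \<in> snd (dual M)"
    then obtain B where B: "B \<in> bases M" "X \<subseteq> fst M - B" using s[OF m] by blast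
    have "f ` (fst M - B) = fst N - f ` B" using inj_on_image_set_diff[OF inj, of "fst M" B] bm.sub[OF B(1)] im by auto
    then have "f ` X \<subseteq> fst N - f ` B" using B by blast
    then show "f ` X \<in> snd (dual N)" using s[OF n] b[OF bm.sub[OF B(1)]] B by blast
  next
    assume "f ` X \<in> snd (dual N)"
    then obtain C where C: "C \<in> bases N" "f ` X \<subseteq> fst N - C" using s[OF n] by blast
    obtain B where B: "B \<subseteq> fst M" "C = f ` B" using bn.sub[OF C(1)] im by (metis subset_image_iff)
    have "X \<subseteq> fst M - B" using C B X by blast
    then show "X \<in> snd (dual M)" using s[OF m] b[OF B(1)] B C by blast
  qed
  then show ?thesis unfolding iso_def dual_facts(3)[OF m] dual_facts(3)[OF n] using f(1) by blast
qed

lemma iso_dual_iff: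
  assumes "matroid M" "matroid N" shows "iso M (dual N) \<longleftrightarrow> iso (dual M) N"
proof
  assume "iso M (dual N)"
  from iso_dual[OF assms(1) dual_facts(1)[OF assms(2)] this] show "iso (dual M) N" by (simp add: dual_dual[OF assms(2)])
next
  assume "iso (dual M) N"
  from iso_dual[OF dual_facts(1)[OF assms(1)] assms(2) this] show "iso M (dual N)" by (simp add: dual_dual[OF assms(1)])
qed

text \<open>A loopless matroid of rank at most two, with the fibres of \<open>cl\<close> as its
  parallel classes.\<close>

lemma line_matroid:
  assumes fE: "finite E"
  shows "matroid (E, {X. X \<subseteq> E \<and> card X \<le> 2 \<and> inj_on cl X})"
  unfolding matroid_def fst_conv snd_conv
proof (intro conjI ballI allI impI)
  fix I J assume a: "J \<in> {X. X \<subseteq> E \<and> card X \<le> 2 \<and> inj_on cl X} \<and> I \<subseteq> J"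
  then have "finite J" using fE finite_subset by blast
  then have "card I \<le> card J" using a card_mono by blast
  then show "I \<in> {X. X \<subseteq> E \<and> card X \<le> 2 \<and> inj_on cl X}" using a inj_on_subset by auto
next
  fix I J assume a: "I \<in> {X. X \<subseteq> E \<and> card X \<le> 2 \<and> inj_on cl X} \<and> J \<in> {X. X \<subseteq> E \<and> card X \<le> 2 \<and> inj_on cl X} \<and> card I < card J"
  have f: "finite I" "finite J" using a fE finite_subset by blast+
  have "cl ` J \<subseteq> cl ` I \<Longrightarrow> False"
  proof -
    assume "cl ` J \<subseteq> cl ` I"
    then have "card (cl ` J) \<le> card I" using f by (meson card_image_le card_mono finite_imageI order_trans)
    then show False using a by (simp add: card_image)
  qed
  then obtain e where e: "e \<in> J" "cl e \<notin> cl ` I" by blast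
  then have "e \<in> J - I" "inj_on cl (insert e I)" "card (insert e I) \<le> 2" "insert e I \<subseteq> E" using a f by (auto simp: card_insert_if)
  then show "\<exists>e\<in>J - I. insert e I \<in> {X. X \<subseteq> E \<and> card X \<le> 2 \<and> inj_on cl X}" by blast
qed (use fE in auto)

text \<open>The added elements 4, 5, 6 have the residues 0, 1, 2 modulo 4, so the parallel classes
  of \<open>K\<close> are the residue classes.\<close>

lemma K_eq: "K = ({0..<7}, {X. X \<subseteq> {0..<7} \<and> card X \<le> 2 \<and> inj_on (\<lambda>n. n mod 4) X})"
proof -
  have "(\<not> {0,4} \<subseteq> X \<and> \<not> {1,5} \<subseteq> X \<and> \<not> {2,6} \<subseteq> X) \<longleftrightarrow> inj_on (\<lambda>n. n mod 4) X" if X: "X \<subseteq> {0..<7}" for X :: "nat set"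
  proof
    assume a: "\<not> {0,4} \<subseteq> X \<and> \<not> {1,5} \<subseteq> X \<and> \<not> {2,6} \<subseteq> X"
    show "inj_on (\<lambda>n. n mod 4) X"
    proof (rule inj_onI)
      fix x y assume xy: "x \<in> X" "y \<in> X" "x mod 4 = y mod 4"
      have "x \<in> {0,1,2,3,4,5,6}" "y \<in> {0,1,2,3,4,5,6}" using xy X by auto
      then show "x = y" using xy a by auto
    qed
  next
    assume i: "inj_on (\<lambda>n. n mod 4) X"
    show "\<not> {0,4} \<subseteq> X \<and> \<not> {1,5} \<subseteq> X \<and> \<not> {2,6} \<subseteq> X"
      using inj_onD[OF i, of 0 4] inj_onD[OF i, of 1 5] inj_onD[OF i, of 2 6] by auto
  qed
  then show ?thesis unfolding K_def by auto
qed

lemma matroid_K: "matroid K"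
  unfolding K_eq by (rule line_matroid) simp

lemma iso_K_iff:
  assumes m: "matroid M"
  shows "iso M K \<longleftrightarrow> (\<exists>f. bij_betw f (fst M) {0..<7::nat} \<and>
    bases M = {B. B \<subseteq> fst M \<and> card B = 2 \<and> inj_on (\<lambda>x. f x mod 4) B})"
proof -
  have fE: "finite (fst M)" using matroidD(1)[OF m] .
  have eq: "(\<forall>X. X \<subseteq> fst M \<longrightarrow> (X \<in> snd M \<longleftrightarrow> f ` X \<in> snd K)) \<longleftrightarrow>
      bases M = {B. B \<subseteq> fst M \<and> card B = 2 \<and> inj_on (\<lambda>x. f x mod 4) B}" if f: "bij_betw f (fst M) {0..<7}" for f
  proof -
    have inj: "inj_on f (fst M)" and im: "f ` fst M = {0..<7}" using f(1) unfolding bij_betw_def by auto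
    let ?I = "{X. X \<subseteq> fst M \<and> card X \<le> 2 \<and> inj_on (\<lambda>x. f x mod 4) X}"
    let ?B = "{B. B \<subseteq> fst M \<and> card B = 2 \<and> inj_on (\<lambda>x. f x mod 4) B}"
    have k: "f ` X \<in> snd K \<longleftrightarrow> X \<in> ?I" if X: "X \<subseteq> fst M" for X
    proof -
      have "inj_on f X" using inj X inj_on_subset by blast
      then have "inj_on (\<lambda>n. n mod 4) (f ` X) \<longleftrightarrow> inj_on (\<lambda>x. f x mod 4) X"
        using comp_inj_on_iff[of f X "\<lambda>n. n mod 4"] by (simp add: comp_def)
      moreover have "card (f ` X) = card X" using \<open>inj_on f X\<close> card_image by blast
      moreover have "f ` X \<subseteq> {0..<7}" using im X by blast
      ultimately show ?thesis using X unfolding K_eq by simp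
    qed
    have "(\<forall>X. X \<subseteq> fst M \<longrightarrow> (X \<in> snd M \<longleftrightarrow> f ` X \<in> snd K)) \<longleftrightarrow> snd M = ?I"
    proof
      assume "\<forall>X. X \<subseteq> fst M \<longrightarrow> (X \<in> snd M \<longleftrightarrow> f ` X \<in> snd K)"
      then show "snd M = ?I" using k matroidD(2)[OF m] by blast
    qed (use k in blast)
    also have "\<dots> \<longleftrightarrow> bases M = ?B"
    proof (rule indep_iff_bases[OF m])
      fix X
      let ?L = "(fst M, ?I)"
      have ml: "matroid ?L" by (rule line_matroid[OF fE])
      \<comment> \<open>Two elements with different residues show that the rank is two, so the bases
        are the independent pairs.\<close>
      obtain a b where ab: "a \<in> fst M" "b \<in> fst M" "f a = 0" "f b = 1"
      proof -
        have "0 \<in> f ` fst M" "1 \<in> f ` fst M" using im by auto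
        then show thesis using that by (metis imageE)
      qed
      have "a \<noteq> b" using ab by auto
      then have "{a,b} \<in> ?I" "card {a,b} = 2" using ab by auto
      then have s: "{a,b} \<in> snd ?L" by simp
      have bL: "{a,b} \<in> bases ?L"
        unfolding bases_def
      proof (intro CollectI conjI ballI impI s)
        fix J assume J: "J \<in> snd ?L" "{a,b} \<subseteq> J"
        have "finite J" using J fE finite_subset by auto
        moreover have "card J \<le> card {a,b}" using J \<open>card {a,b} = 2\<close> by simp
        ultimately show "J = {a,b}" using card_seteq[of J "{a,b}"] J by auto
      qed
      have "B \<in> bases ?L \<longleftrightarrow> B \<in> ?B" for B
      proof
        assume B: "B \<in> bases ?L"
        have "card B = card {a,b}"
          using bases_card_eq(1)[OF ml basesD(1)[OF B] bL] bases_card_eq(1)[OF ml s B] by simp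
        then show "B \<in> ?B" using basesD(1)[OF B] \<open>card {a,b} = 2\<close> by simp
      next
        assume "B \<in> ?B"
        then show "B \<in> bases ?L" using bases_card_eq(2)[OF ml _ bL, of B] \<open>card {a,b} = 2\<close> by simp
      qed
      then show "X \<in> ?I \<longleftrightarrow> (\<exists>B\<in>?B. X \<subseteq> B)" using matroid_indep_iff[OF ml, of X] by auto
    qed (use fE finite_subset in auto)
    finally show ?thesis .
  qed
  have "fst K = {0..<7}" by (simp add: K_def)
  then show ?thesis unfolding iso_def by (simp add: eq cong: conj_cong)
qed

section \<open>The small matroids are excluded minors\<close>

lemma wit_rank_two:
  assumes c: "\<And>B. B \<in> \<B> \<Longrightarrow> card B = 2" and w: "wit \<B> S T"
  shows "S = {}"
proof -
  obtain a b c d where t: "T = {a,b,c,d}" "distinct [a,b,c,d]" using w card4E unfolding wit_def by metis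
  have ab: "card (insert a (insert b S)) = 2" using c witD[OF w, of a b] t by auto
  then have "finite (insert a (insert b S))" by (metis card.infinite zero_neq_numeral)
  then have f: "finite S" by simp
  have "a \<notin> S" "b \<notin> S" using w t unfolding wit_def by auto
  then have "card S = 0" using ab t f by simp
  then show ?thesis using f by simp
qed

lemma good_of_small_bases:
  assumes "\<And>B. B \<in> \<B> \<Longrightarrow> card B = 1"
  shows "good E \<B>"
proof -
  have "\<not> wit \<B> S T" for S T
  proof
    assume w: "wit \<B> S T"
    obtain a b c d where t: "T = {a,b,c,d}" "distinct [a,b,c,d]" using w card4E unfolding wit_def by metis
    have "card (insert a (insert b S)) = 1" using assms witD[OF w, of a b] t by auto
    then obtain x where "insert a (insert b S) = {x}" using card_1_singletonE by blast
    then have "a = x" "b = x" by auto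
    then show False using t by auto
  qed
  then show ?thesis unfolding good_def by blast
qed

lemma bases_contract_loop:
  assumes m: "matroid M" and e: "\<And>B. B \<in> bases M \<Longrightarrow> e \<notin> B" "e \<in> fst M"
  shows "bases (contract M {e}) = bases M"
proof -
  interpret base_family "fst M" "bases M" by (rule matroid_base_family[OF m])
  note df = dual_facts[OF m]
  have "e \<in> B" if "B \<in> bases (dual M)" for B using that e df by (auto simp: dfam_def)
  then have bd: "bases (delete (dual M) {e}) = {B - {e} |B. B \<in> bases (dual M)}" by (rule bases_delete_coloop[OF df(1)])
  have "bases (contract M {e}) = dfam (fst M - {e}) {B - {e} |B. B \<in> dfam (fst M) (bases M)}"
    unfolding contract_def using dual_facts[OF delete_matroid[OF df(1)]] bd df by simp
  also have "\<dots> = bases M"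
  proof -
    have eq: "fst M - {e} - (fst M - B - {e}) = B" if "B \<in> bases M" for B using sub[OF that] e(1)[OF that] by auto
    show ?thesis
    proof (intro equalityI subsetI)
      fix X assume "X \<in> dfam (fst M - {e}) {B - {e} |B. B \<in> dfam (fst M) (bases M)}"
      then obtain B where "B \<in> bases M" "X = fst M - {e} - (fst M - B - {e})" unfolding dfam_def by blast
      then show "X \<in> bases M" using eq by simp
    next
      fix X assume X: "X \<in> bases M"
      show "X \<in> dfam (fst M - {e}) {B - {e} |B. B \<in> dfam (fst M) (bases M)}"
        unfolding dfam_def using X eq[OF X] by blast
    qed
  qed
  finally show ?thesis .
qed

text \<open>Contracting a nonloop leaves bases of one element, hence no line, and contracting a loop
  gives the same bases as deleting it; so deletions decide.\<close>

lemma excluded_minor_rank_two: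
  assumes m: "matroid M" and c: "\<And>B. B \<in> bases M \<Longrightarrow> card B = 2" and ng: "\<not> good (fst M) (bases M)"
    and del: "\<And>e. e \<in> fst M \<Longrightarrow> good (fst M - {e}) {B \<in> bases M. e \<notin> B}"
    and ex: "\<And>e. e \<in> fst M \<Longrightarrow> \<exists>B\<in>bases M. e \<notin> B"
  shows "excluded_minor_R M"
proof -
  have d: "in_R (delete M {e})" if e: "e \<in> fst M" for e
  proof -
    obtain B where "B \<in> bases M" "B \<inter> {e} = {}" using ex[OF e] by blast
    then have "bases (delete M {e}) = {B \<in> bases M. e \<notin> B}" using bases_delete[OF m] by auto
    then show ?thesis using del[OF e] in_R_iff_good[OF delete_matroid[OF m]] by simp
  qed
  have "in_R (contract M {e})" if e: "e \<in> fst M" for e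
  proof (cases "\<exists>B\<in>bases M. e \<in> B")
    case True
    then obtain B where B: "B \<in> bases M" "e \<in> B" by blast
    have "card (B - {e}) = 1" if "B \<in> bases M" "e \<in> B" for B using c[OF that(1)] that by simp
    then have "good (fst M - {e}) (bases (contract M {e}))"
      unfolding bases_contract[OF m B] by (intro good_of_small_bases) blast
    then show ?thesis using in_R_iff_good[OF contract_matroid[OF m]] contract_fst[OF m] by simp
  next
    case False
    then have b: "bases (contract M {e}) = bases M" using bases_contract_loop[OF m _ e] by blast
    moreover have "{B \<in> bases M. e \<notin> B} = bases M" using False by blast
    ultimately show ?thesis using del[OF e] in_R_iff_good[OF contract_matroid[OF m]] contract_fst[OF m] by simp
  qed
  then show ?thesis using d excluded_minor_iff[OF m] in_R_iff_good[OF m] ng by blast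
qed

lemma wit_pairs:
  assumes w: "wit {B. B \<subseteq> F \<and> card B = 2} S T"
  shows "S = {} \<and> T \<subseteq> F"
proof -
  have S: "S = {}" using wit_rank_two[OF _ w] by simp
  obtain a b c d where t: "T = {a,b,c,d}" "distinct [a,b,c,d]" using w card4E unfolding wit_def by metis
  then show ?thesis using S witD[OF w, of a b] witD[OF w, of c d] by auto
qed

text \<open>On a four-element ground set every pair is free and lies on the only line; three points
  are too few for a line.\<close>

lemma good_pairs:
  assumes f: "finite F" and F: "F = E \<and> card F = 4 \<or> card F = 3"
  shows "good E {B. B \<subseteq> F \<and> card B = 2}"
proof (cases "card F = 3")
  case True
  have "\<not> wit {B. B \<subseteq> F \<and> card B = 2} S T" for S T
  proof
    assume w: "wit {B. B \<subseteq> F \<and> card B = 2} S T"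
    then have "card T = 4" "T \<subseteq> F" using wit_pairs[OF w] unfolding wit_def by auto
    then show False using card_mono[OF f, of T] True by simp
  qed
  then show ?thesis unfolding good_def by blast
next
  case False
  then have F4: "F = E" "card F = 4" using F by auto
  then obtain H where H: "H \<subseteq> F" "card H = 2" using obtain_subset_with_card_n[of 2 F] by auto
  have fH: "finite H" using H f finite_subset by blast
  have "card (insert e (H - {h})) = 2" if "h \<in> H" "e \<notin> H" for h e
    using that H fH by simp
  then have "free_base E {B. B \<subseteq> F \<and> card B = 2} H" using H F4 unfolding free_base_def by auto
  moreover have "through H S T" if w: "wit {B. B \<subseteq> F \<and> card B = 2} S T" for S T
  proof -
    have "S = {}" "T \<subseteq> F" "card T = 4" using wit_pairs[OF w] w unfolding wit_def by auto
    then have "T = F" using card_subset_eq[OF f] F4 by simp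
    then show ?thesis using \<open>S = {}\<close> H by (simp add: through_def)
  qed
  ultimately show ?thesis unfolding good_def by blast
qed

text \<open>Covers both \<open>U\<^sub>2\<^sub>,\<^sub>5\<close>, where \<open>L\<close> is the
  ground set, and \<open>U\<^sub>2\<^sub>,\<^sub>4\<close> with a loop. In the first case the line
  \<open>L - h\<close> misses any candidate containing \<open>h\<close>; in the second a candidate
  is not free, because the loop cannot replace its element \<open>h\<close>.\<close>

lemma excluded_minor_pairs:
  assumes m: "matroid M" and b: "bases M = {B. B \<subseteq> L \<and> card B = 2}" and cE: "card (fst M) = 5"
    and L: "L = fst M \<or> (\<exists>e\<in>fst M. L = fst M - {e})"
  shows "excluded_minor_R M"
proof (rule excluded_minor_rank_two[OF m])
  have fE: "finite (fst M)" using matroidD(1)[OF m] .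
  have fL: "finite L" and LE: "L \<subseteq> fst M" using L fE by auto
  have cL: "L = fst M \<and> card L = 5 \<or> card L = 4" using L cE fE by auto
  show "\<And>B. B \<in> bases M \<Longrightarrow> card B = 2" using b by simp
  have wT: "wit (bases M) {} T" if "T \<subseteq> L" "card T = 4" for T
    unfolding wit_def b using that by auto
  show "\<not> good (fst M) (bases M)"
  proof
    assume g: "good (fst M) (bases M)"
    have "4 \<le> card L" using cL by auto
    then obtain T where T: "T \<subseteq> L" "card T = 4" by (rule obtain_subset_with_card_n)
    obtain H where H: "free_base (fst M) (bases M) H" "\<And>S T. wit (bases M) S T \<Longrightarrow> through H S T"
      using g wT[OF T] unfolding good_def by blast
    have Hb: "H \<subseteq> L" "card H = 2" using H(1) b unfolding free_base_def by auto
    then have "H \<noteq> {}" by auto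
    then obtain h where h: "h \<in> H" by blast
    from cL show False
    proof
      assume "L = fst M \<and> card L = 5"
      then have "card (L - {h}) = 4" using h Hb by auto
      then have "through H {} (L - {h})" using H(2) wT by blast
      then show False using h unfolding through_def by blast
    next
      assume "card L = 4"
      then obtain e where e: "e \<in> fst M" "e \<notin> L" using L cE by auto
      then have "insert e (H - {h}) \<in> bases M" using H(1) h Hb unfolding free_base_def by blast
      then show False using e b by auto
    qed
  qed
  fix e assume e: "e \<in> fst M"
  have eq: "{B \<in> bases M. e \<notin> B} = {B. B \<subseteq> L - {e} \<and> card B = 2}" unfolding b by auto
  have "L - {e} = fst M - {e} \<and> card (L - {e}) = 4 \<or> card (L - {e}) = 3"
  proof -
    have c4: "card (fst M - {e}) = 4" using e cE fE by simp
    show ?thesis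
    proof (cases "L - {e} = fst M - {e}")
      case True then show ?thesis using c4 by simp
    next
      case False
      then have "card L = 4" "e \<in> L" using L cL e by auto
      then show ?thesis by simp
    qed
  qed
  then show "good (fst M - {e}) {B \<in> bases M. e \<notin> B}" unfolding eq using fL by (intro good_pairs) auto
  have "2 \<le> card (L - {e})" using cL fL by (auto simp: card_Diff_singleton_if)
  then obtain B where "B \<subseteq> L - {e}" "card B = 2" by (rule obtain_subset_with_card_n)
  then show "\<exists>B\<in>bases M. e \<notin> B" using b by blast
qed

text \<open>The lines are the transversals of the four parallel classes, and two of them meet in a
  single element, so no base lies on all. Deleting the one-element class leaves no line; deleting
  \<open>e\<close> from a pair leaves a second one-element class, and the two single elements form a
  free base on every line.\<close>

lemma excluded_minor_K:
  assumes m: "matroid M" and i: "iso M K"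
  shows "excluded_minor_R M"
proof -
  have fE: "finite (fst M)" using matroidD(1)[OF m] .
  obtain f where f: "bij_betw f (fst M) {0..<7::nat}"
    and b: "bases M = {B. B \<subseteq> fst M \<and> card B = 2 \<and> inj_on (\<lambda>x. f x mod 4) B}" using i iso_K_iff[OF m] by blast
  have inj: "inj_on f (fst M)" and im: "f ` fst M = {0..<7}" using f unfolding bij_betw_def by auto
  define g where "g = inv_into (fst M) f"
  have g: "g n \<in> fst M" "f (g n) = n" if "n < 7" for n
    using that im inv_into_into[of n f "fst M"] f_inv_into_f[of n f "fst M"] unfolding g_def by auto
  have gf: "x = g n" if "x \<in> fst M" "f x = n" for x n using inj that g[of n] im unfolding g_def by (metis inv_into_f_f)
  have f7: "f x < 7" if "x \<in> fst M" for x using im that by auto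
  have pair: "{x,y} \<in> bases M \<longleftrightarrow> f x mod 4 \<noteq> f y mod 4" if "x \<in> fst M" "y \<in> fst M" "x \<noteq> y" for x y
    unfolding b using that by (auto simp: inj_on_def)
  have c2: "card B = 2" if "B \<in> bases M" for B using that b by simp
  have wS: "S = {}" if "wit (bases M) S T" for S T using wit_rank_two[OF c2 that] .
  have wI: "wit (bases M) {} T" if th: "T \<subseteq> fst M" "card T = 4" "inj_on (\<lambda>x. f x mod 4) T" for T
  proof -
    have "{x,y} \<in> bases M" if xy: "x \<in> T" "y \<in> T" "x \<noteq> y" for x y
    proof -
      have "f x mod 4 \<noteq> f y mod 4" using inj_onD[OF th(3) _ xy(1,2)] xy(3) by blast
      then show ?thesis using pair[of x y] xy th(1) by blast
    qed
    then show ?thesis unfolding wit_def using th(2) by simp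
  qed
  have wD: "(\<lambda>x. f x mod 4) ` T = {0,1,2,3}" if w: "wit (bases M) {} T" for T
  proof -
    have TE: "T \<subseteq> fst M" "card T = 4" using w base_family.wit_sub[OF matroid_base_family[OF m] w] unfolding wit_def by auto
    have "inj_on (\<lambda>x. f x mod 4) T"
    proof (rule inj_onI, rule ccontr)
      fix x y assume xy: "x \<in> T" "y \<in> T" "f x mod 4 = f y mod 4" "x \<noteq> y"
      then have "{x,y} \<in> bases M" using witD[OF w] by blast
      then show False using pair[of x y] xy TE by auto
    qed
    then have "card ((\<lambda>x. f x mod 4) ` T) = card {0,1,2,3::nat}" using card_image TE by fastforce
    moreover have "(\<lambda>x. f x mod 4) ` T \<subseteq> {0,1,2,3}"
    proof
      fix n assume "n \<in> (\<lambda>x. f x mod 4) ` T"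
      then have "n < 4" by auto
      then show "n \<in> {0,1,2,3}" by auto
    qed
    ultimately show ?thesis by (intro card_subset_eq) auto
  qed
  have gd: "g i \<noteq> g j" if "i < 7" "j < 7" "i \<noteq> j" for i j using g that by metis
  have inj4: "inj_on (\<lambda>x. f x mod 4) (g ` N)" "card (g ` N) = card N" "g ` N \<subseteq> fst M"
    if N: "N \<subseteq> {0..<7}" "inj_on (\<lambda>n. n mod 4) N" for N
  proof -
    show s: "g ` N \<subseteq> fst M" using g N by auto
    have "inj_on g N" using gd N unfolding inj_on_def by (metis atLeastLessThan_iff subsetD)
    then show "card (g ` N) = card N" by (rule card_image)
    have "f (g n) = n" if "n \<in> N" for n using g(2) N that by auto
    then show "inj_on (\<lambda>x. f x mod 4) (g ` N)" using N(2) unfolding inj_on_def by auto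
  qed
  show ?thesis
  proof (rule excluded_minor_rank_two[OF m c2])
    have "wit (bases M) {} (g ` {0,1,2,3})" using inj4[of "{0,1,2,3}"] by (intro wI) (auto simp: inj_on_def)
    moreover have "wit (bases M) {} (g ` {4,5,6,3})" using inj4[of "{4,5,6,3}"] by (intro wI) (auto simp: inj_on_def)
    ultimately have two: "\<exists>T1 T2. wit (bases M) {} T1 \<and> wit (bases M) {} T2 \<and> T1 \<inter> T2 \<subseteq> {g 3}"
      using gd[of 0 4] gd[of 0 5] gd[of 0 6] gd[of 1 4] gd[of 1 5] gd[of 1 6] gd[of 2 4] gd[of 2 5] gd[of 2 6]
        gd[of 0 3] gd[of 1 3] gd[of 2 3]
      by (intro exI[of _ "g ` {0,1,2,3}"] exI[of _ "g ` {4,5,6,3}"]) auto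
    show "\<not> good (fst M) (bases M)"
    proof
      assume gd: "good (fst M) (bases M)"
      obtain T1 T2 where T: "wit (bases M) {} T1" "wit (bases M) {} T2" "T1 \<inter> T2 \<subseteq> {g 3}" using two by blast
      obtain H where H: "free_base (fst M) (bases M) H" "\<And>S T. wit (bases M) S T \<Longrightarrow> through H S T"
        using gd T(1) unfolding good_def by blast
      have "H \<subseteq> {g 3}" using H(2)[OF T(1)] H(2)[OF T(2)] T(3) unfolding through_def by blast
      then have "card H \<le> 1" using card_mono[of "{g 3}" H] by simp
      moreover have "card H = 2" using H(1) c2 unfolding free_base_def by blast
      ultimately show False by simp
    qed
    fix e assume e: "e \<in> fst M"
    let ?B = "{B \<in> bases M. e \<notin> B}"
    interpret base_family "fst M" "bases M" by (rule matroid_base_family[OF m])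
    have w0: "S = {} \<and> wit (bases M) {} T \<and> e \<notin> T" if "wit ?B S T" for S T
      using that wit_avoid[of e S T] wS by blast
    show "good (fst M - {e}) ?B"
    proof (cases "f e = 3")
      case True
      have "\<not> wit ?B S T" for S T
      proof
        assume "wit ?B S T"
        then have w: "wit (bases M) {} T" "e \<notin> T" using w0 by auto
        have "3 \<in> (\<lambda>x. f x mod 4) ` T" using wD[OF w(1)] by simp
        then obtain x where x: "x \<in> T" "f x mod 4 = 3" by auto
        have xE: "x \<in> fst M" using x wit_sub[OF w(1)] by blast
        have "f x = 3" using f7[OF xE] x(2) by presburger
        then have "x = e" using inj_onD[OF inj _ xE e] True by simp
        then show False using x w by simp
      qed
      then show ?thesis unfolding good_def by blast
    next
      case False
      \<comment> \<open>The number of the element parallel to \<open>e\<close>.\<close>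
      define k where "k = (if f e < 3 then f e + 4 else f e - 4)"
      have fe: "f e < 7" using f7[OF e] .
      have fe6: "f e \<in> {0,1,2,4,5,6}" using fe False by auto
      have k: "k < 7" "k mod 4 = f e mod 4" "k \<noteq> f e" "k \<noteq> 3" "k mod 4 \<noteq> 3"
        using fe6 unfolding k_def by auto
      have only: "n = k \<or> n = f e" if "n < 7" "n mod 4 = k mod 4" for n
      proof -
        have "n \<in> {0,1,2,3,4,5,6}" using that by auto
        then show ?thesis using that fe6 unfolding k_def by auto
      qed
      let ?a = "g 3" and ?b = "g k"
      have ab: "?a \<noteq> ?b" "?a \<in> fst M" "?b \<in> fst M" "f ?a = 3" "f ?b = k" using gd[of 3 k] g[of 3] g[OF k(1)] k by auto
      have ne: "?a \<noteq> e" "?b \<noteq> e" using ab k False by auto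
      have hb: "{?a,?b} \<in> bases M" using pair[OF ab(2,3,1)] ab k by simp
      have pa: "{x,?a} \<in> bases M" "{x,?b} \<in> bases M" if x: "x \<in> fst M" "x \<noteq> e" "x \<noteq> ?a" "x \<noteq> ?b" for x
      proof -
        have n: "f x \<noteq> 3" "f x \<noteq> k" "f x \<noteq> f e" using gf[OF x(1)] x inj_onD[OF inj _ x(1) e] by auto
        have l: "f x < 7" using f7[OF x(1)] .
        have n3: "f x mod 4 \<noteq> 3" using l n(1) by presburger
        have n4: "f x mod 4 \<noteq> k mod 4" using only[OF l] n by blast
        show "{x,?a} \<in> bases M" using pair[OF x(1) ab(2) x(3)] n3 ab(4) by simp
        show "{x,?b} \<in> bases M" using pair[OF x(1) ab(3) x(4)] n4 ab(5) by simp
      qed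
      have "free_base (fst M - {e}) ?B {?a,?b}" unfolding free_base_def
      proof (intro conjI ballI)
        show "{?a,?b} \<in> ?B" using hb ne by auto
        fix h x assume h: "h \<in> {?a,?b}" and x: "x \<in> fst M - {e} - {?a,?b}"
        have x4: "x \<in> fst M" "x \<noteq> e" "x \<noteq> ?a" "x \<noteq> ?b" using x by blast+
        have "insert x ({?a,?b} - {h}) = {x,?b} \<or> insert x ({?a,?b} - {h}) = {x,?a}" using h ab(1) by (auto simp: insert_Diff_if)
        moreover have "{x,?a} \<in> ?B" "{x,?b} \<in> ?B" using pa[OF x4] x4(2) ne by simp_all
        ultimately show "insert x ({?a,?b} - {h}) \<in> ?B" by metis
      qed
      moreover have "through {?a,?b} S T" if wt: "wit ?B S T" for S T
      proof -
        have w: "S = {}" "wit (bases M) {} T" "e \<notin> T" using w0[OF wt] by auto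
        have TE: "T \<subseteq> fst M" using wit_sub[OF w(2)] by blast
        have "k mod 4 < 4" by simp
        then have "k mod 4 \<in> {0,1,2,3}" by auto
        then have "3 \<in> (\<lambda>x. f x mod 4) ` T" "k mod 4 \<in> (\<lambda>x. f x mod 4) ` T" unfolding wD[OF w(2)] by simp_all
        then obtain x y where xy: "x \<in> T" "f x mod 4 = 3" "y \<in> T" "f y mod 4 = k mod 4" by auto
        have "f x < 7" using f7[of x] xy(1) TE by blast
        then have "f x = 3" using xy(2) by presburger
        then have "x = ?a" using gf xy TE by blast
        have "f y = k \<or> f y = f e" using only[OF f7, of y] xy TE by blast
        moreover have "f y \<noteq> f e" using inj_onD[OF inj _ _ e, of y] xy TE w by blast
        ultimately have "y = ?b" using gf xy TE by blast
        then show ?thesis using \<open>x = ?a\<close> xy w by (simp add: through_def)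
      qed
      ultimately show ?thesis unfolding good_def by blast
    qed
    have "{g 0, g 1} \<in> bases M" "{g 2, g 3} \<in> bases M"
      using pair[of "g 0" "g 1"] pair[of "g 2" "g 3"] g[of 0] g[of 1] g[of 2] g[of 3] gd[of 0 1] gd[of 2 3] by auto
    moreover have "{g 0, g 1} \<inter> {g 2, g 3} = {}" using gd[of 0 2] gd[of 0 3] gd[of 1 2] gd[of 1 3] by auto
    ultimately show "\<exists>B\<in>bases M. e \<notin> B" by blast
  qed
qed

text \<open>The lines over single points of \<open>X\<close> force a common base to contain
  \<open>X\<close>, hence to equal this nonbasis. The type is self-dual, so only deletions remain,
  and by symmetry \<open>e\<close> may be taken in \<open>X\<close>.\<close>

lemma excluded_minor_R6:
  assumes m: "matroid M" and t: "two_triangles (fst M) (bases M)"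
  shows "excluded_minor_R M"
proof -
  interpret base_family "fst M" "bases M" by (rule matroid_base_family[OF m])
  obtain X Y where xy: "card X = 3" "card Y = 3" "X \<inter> Y = {}" "fst M = X \<union> Y"
    and b: "bases M = {B. B \<subseteq> fst M \<and> card B = 3 \<and> B \<noteq> X \<and> B \<noteq> Y}" using t unfolding two_triangles_def by (elim exE conjE)
  have fin: "finite X" "finite Y" using xy(4) fin by simp_all
  have c6: "card (fst M) = 6" using xy fin by (simp add: card_Un_disjoint)
  show ?thesis
  proof (rule excluded_minor_of_self_dual_property[where P = two_triangles, OF m t])
    have "dfam (fst M) (bases M) = {B. B \<subseteq> fst M \<and> card B = 3 \<and> B \<noteq> X \<and> B \<noteq> Y}"
    proof (intro equalityI subsetI)
      fix B assume "B \<in> dfam (fst M) (bases M)"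
      then obtain C where C: "C \<subseteq> fst M" "card C = 3" "C \<noteq> X" "C \<noteq> Y" "B = fst M - C" using b unfolding dfam_def by blast
      have "card B = 3" using C c6 finite_subset[OF C(1)] base_family.fin[OF base_family_axioms] by (simp add: card_Diff_subset)
      moreover have "B \<noteq> X" "B \<noteq> Y" using C xy(3,4) by auto
      ultimately show "B \<in> {B. B \<subseteq> fst M \<and> card B = 3 \<and> B \<noteq> X \<and> B \<noteq> Y}" using C by blast
    next
      fix B assume "B \<in> {B. B \<subseteq> fst M \<and> card B = 3 \<and> B \<noteq> X \<and> B \<noteq> Y}"
      then have B: "B \<subseteq> fst M" "card B = 3" "B \<noteq> X" "B \<noteq> Y" by auto
      have "card (fst M - B) = 3" using B c6 finite_subset[OF B(1)] base_family.fin[OF base_family_axioms] by (simp add: card_Diff_subset)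
      moreover have "fst M - B \<noteq> X" "fst M - B \<noteq> Y" using B xy(3,4) by auto
      ultimately have "fst M - B \<in> bases M" unfolding b by blast
      then show "B \<in> dfam (fst M) (bases M)" using dual_mem[OF B(1)] by blast
    qed
    then show "two_triangles (fst M) (dfam (fst M) (bases M))" unfolding two_triangles_def
      by (intro exI[of _ X] exI[of _ Y] conjI xy)
    show "\<not> good (fst M) (bases M)"
    proof
      assume g: "good (fst M) (bases M)"
      obtain x1 x2 x3 where X: "X = {x1,x2,x3}" "distinct [x1,x2,x3]" using card3E[OF xy(1)] .
      have w: "wit (bases M) {p} (insert q Y)" if pq: "p \<in> X" "q \<in> X" "p \<noteq> q" for p q
      proof -
        have n: "p \<notin> Y" "q \<notin> Y" using pq xy(3) by auto
        have "insert u (insert v {p}) \<in> bases M" if uv: "u \<in> insert q Y" "v \<in> insert q Y" "u \<noteq> v" for u v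
        proof -
          have d: "u \<noteq> p" "v \<noteq> p" using uv n pq by auto
          then have "card (insert u (insert v {p})) = 3" using uv by simp
          moreover have "u \<in> Y \<or> v \<in> Y" using uv by auto
          then have "insert u (insert v {p}) \<noteq> X" using xy(3) by blast
          moreover have "insert u (insert v {p}) \<noteq> Y" using n by blast
          moreover have "insert u (insert v {p}) \<subseteq> fst M" using uv pq xy(4) by blast
          ultimately show ?thesis unfolding b by blast
        qed
        moreover have "card (insert q Y) = 4" "{p} \<inter> insert q Y = {}" using n fin xy pq by auto
        ultimately show ?thesis unfolding wit_def by blast
      qed
      have w1: "wit (bases M) {x1} (insert x2 Y)" using w X by auto
      obtain H where H: "free_base (fst M) (bases M) H" "\<And>S T. wit (bases M) S T \<Longrightarrow> through H S T"
        using g w1 unfolding good_def by blast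
      have "X \<subseteq> H" using H(2)[OF w[of x1 x2]] H(2)[OF w[of x2 x1]] H(2)[OF w[of x3 x1]] X unfolding through_def by auto
      moreover have HB: "H \<in> bases M" using H(1) unfolding free_base_def by blast
      then have "card H = 3" "H \<noteq> X" using b by auto
      ultimately show False using card_subset_eq[OF finB[OF HB]] xy(1) by metis
    qed
    fix \<B> e assume fam: "base_family (fst M) \<B>" and P: "two_triangles (fst M) \<B>" and e: "e \<in> fst M"
    obtain X Y where xy: "card X = 3" "card Y = 3" "X \<inter> Y = {}" "fst M = X \<union> Y" "e \<in> X"
      and b: "\<B> = {B. B \<subseteq> fst M \<and> card B = 3 \<and> B \<noteq> X \<and> B \<noteq> Y}"
    proof -
      obtain X Y where xy: "card X = 3" "card Y = 3" "X \<inter> Y = {}" "fst M = X \<union> Y"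
        and b: "\<B> = {B. B \<subseteq> fst M \<and> card B = 3 \<and> B \<noteq> X \<and> B \<noteq> Y}" using P unfolding two_triangles_def by (elim exE conjE)
      show thesis
      proof (cases "e \<in> X")
        case True then show thesis using that[OF xy _ b] by blast
      next
        case False
        then have "e \<in> Y" using e xy(4) by blast
        moreover have "Y \<inter> X = {}" "fst M = Y \<union> X" using xy(3,4) by auto
        moreover have "\<B> = {B. B \<subseteq> fst M \<and> card B = 3 \<and> B \<noteq> Y \<and> B \<noteq> X}" unfolding b by (rule Collect_cong) blast
        ultimately show thesis using that[OF xy(2,1)] by blast
      qed
    qed
    have fin: "finite X" "finite Y" using xy(4) base_family.fin[OF fam] by simp_all
    have "card (X - {e}) = 2" using xy fin by simp
    then obtain p q where pq: "X - {e} = {p,q}" "p \<noteq> q" using card_2_iff by metis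
    have X: "X = {e,p,q}" "e \<noteq> p" "e \<noteq> q" using pq xy(5) by auto
    obtain y1 y2 y3 where Y: "Y = {y1,y2,y3}" "distinct [y1,y2,y3]" using card3E[OF xy(2)] .
    have nY: "p \<notin> Y" "q \<notin> Y" "e \<notin> Y" using X xy(3) by auto
    \<comment> \<open>The two points left of the broken triangle with any point of the other one. A
      three-element set avoiding \<open>e\<close> and meeting \<open>{p, q}\<close> is neither
      triangle, so all neighbours are bases.\<close>
    let ?H = "{p,q,y1}"
    have yX: "y1 \<notin> X" using Y xy(3) by auto
    have cand: "B \<in> \<B>" if "B \<subseteq> fst M" "card B = 3" "e \<notin> B" "p \<in> B \<or> q \<in> B" for B
      using that nY xy(5) unfolding b by blast
    have H: "?H \<in> \<B>" by (rule cand) (use X Y yX pq xy(4) nY in auto)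
    have fr: "insert x (?H - {h}) \<in> {B \<in> \<B>. e \<notin> B}" if h: "h \<in> ?H" and x: "x \<in> fst M - {e} - ?H" for h x
    proof -
      have cH: "card ?H = 3" using X Y yX pq by auto
      then have "card (insert x (?H - {h})) = 3" using h x by (metis DiffD2 card.remove card_insert_disjoint finite.emptyI finite.insertI finite_Diff insert_Diff insert_iff)
      moreover have "insert x (?H - {h}) \<subseteq> fst M" using x X Y xy(4) by auto
      moreover have "e \<notin> insert x (?H - {h})" using x X nY Y by auto
      moreover have "p \<in> insert x (?H - {h}) \<or> q \<in> insert x (?H - {h})" using pq(2) by blast
      ultimately show ?thesis using cand by blast
    qed
    have eH: "e \<notin> ?H" using X nY Y by auto
    have free: "free_base (fst M - {e}) {B \<in> \<B>. e \<notin> B} ?H" unfolding free_base_def using fr H eH by blast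
    have thr: "through ?H S T" if "wit {B \<in> \<B>. e \<notin> B} S T" for S T
    proof -
      have w: "wit \<B> S T" "e \<notin> S \<union> T" using that base_family.wit_avoid[OF fam] by blast+
      have st: "S \<subseteq> fst M" "T \<subseteq> fst M" "S \<inter> T = {}" "card T = 4" "finite S" "finite T"
        using base_family.wit_sub[OF fam w(1)] base_family.wit_card[OF fam w(1)] w(1) unfolding wit_def by auto
      have rk3: "base_family.rk \<B> = 3" using base_family.cardB[OF fam H] X Y yX pq by auto
      have "card S + 2 = 3" using base_family.wit_card(1)[OF fam w(1)] rk3 by simp
      then have "card S = 1" by simp
      then obtain s where s: "S = {s}" using card_1_singletonE by blast
      have "card (S \<union> T) = 5" using st s by auto
      moreover have "S \<union> T \<subseteq> fst M - {e}" using st w(2) by auto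
      moreover have "card (fst M - {e}) = 5" using c6 e base_family.fin[OF fam] by simp
      ultimately have ST: "S \<union> T = fst M - {e}" using base_family.fin[OF fam] by (intro card_subset_eq) auto
      \<comment> \<open>If \<open>s\<close> were in \<open>Y\<close>, the other two points of
        \<open>Y\<close> would belong to the line and complete \<open>S\<close> to \<open>Y\<close>,
        which is no base.\<close>
      have "s \<notin> Y"
      proof
        assume sY: "s \<in> Y"
        have "card (Y - {s}) = 2" using xy fin sY by simp
        then obtain u v where uv: "Y - {s} = {u,v}" "u \<noteq> v" using card_2_iff by metis
        have "u \<in> S \<union> T" "v \<in> S \<union> T" unfolding ST using uv xy(4) nY by auto
        then have "u \<in> T" "v \<in> T" using s uv by auto
        then have "insert u (insert v S) \<in> \<B>" using witD[OF w(1)] uv by blast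
        moreover have "insert u (insert v S) = Y" using uv s sY by auto
        ultimately show False using b by simp
      qed
      then have "s \<in> {p,q}" using s st(1) w(2) xy(4) X by auto
      then have "S \<subseteq> ?H" using s by auto
      moreover have "?H \<subseteq> S \<union> T" unfolding ST using X Y xy(4) eH by auto
      ultimately show ?thesis by (simp add: through_def)
    qed
    have "good (fst M - {e}) {B \<in> \<B>. e \<notin> B}" unfolding good_def using free thr by blast
    moreover have "\<exists>B\<in>\<B>. e \<notin> B" by (intro bexI[of _ ?H] eH H)
    ultimately show "good (fst M - {e}) {B \<in> \<B>. e \<notin> B} \<and> (\<exists>B\<in>\<B>. e \<notin> B)" by simp
  qed
qed

section \<open>The characterization\<close>

text \<open>Each pattern fills the whole ground set by minimality, so it can only occur when
  \<open>M\<close> itself is one of the three excluded matroids. The patterns with contracted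
  elements are obtained from the dual.\<close>

lemma no_rank_two_pattern:
  assumes em: "excluded_minor_R M"
    and n25: "\<not> iso M (U 2 5)" and nl: "\<not> iso M (dsum (U 2 4) (U 0 1))" and nK: "\<not> iso M K"
  shows "\<And>S T r. wit (bases M) S T \<Longrightarrow> r \<in> fst M - S - T \<Longrightarrow> \<exists>t\<in>T. insert r (insert t S) \<notin> bases M"
    and "\<And>S T r. wit (bases M) S T \<Longrightarrow> r \<in> fst M - S - T \<Longrightarrow> \<exists>t\<in>T. insert r (insert t S) \<in> bases M"
    and "\<And>S T r1 r2 r3 t1 t2 t3. wit (bases M) S T \<Longrightarrow> {r1,r2,r3} \<subseteq> fst M - S - T \<Longrightarrow> {t1,t2,t3} \<subseteq> T \<Longrightarrow>
      distinct [t1,t2,t3] \<Longrightarrow> insert r1 (insert t1 S) \<notin> bases M \<Longrightarrow> insert r2 (insert t2 S) \<notin> bases M \<Longrightarrow>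
      insert r3 (insert t3 S) \<notin> bases M \<Longrightarrow> False"
proof -
  have m: "matroid M" using em by (simp add: excluded_minor_R_def)
  interpret minor_minimal "fst M" "bases M" by (rule excluded_minor_minimal[OF em])
  have c2: "card B = 2" if "wit (bases M) {} T" "B \<in> bases M" for B T
    using wit_card(1)[OF that(1)] cardB[OF that(2)] by simp
  show 1: "\<exists>t\<in>T. insert r (insert t S) \<notin> bases M" if w: "wit (bases M) S T" and r: "r \<in> fst M - S - T" for S T r
  proof (rule ccontr)
    assume "\<not> ?thesis"
    then have all: "\<And>t. t \<in> T \<Longrightarrow> insert r (insert t S) \<in> bases M" by blast
    have e: "S = {}" "fst M = insert r T" using five_point_line[OF w r all] by auto
    have cT: "card T = 4" "finite T" using w wit_card[OF w] unfolding wit_def by auto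
    have cE: "card (fst M) = 5" using e cT r by simp
    have "B \<in> bases M" if B: "B \<subseteq> fst M" "card B = 2" for B
    proof -
      obtain x y where xy: "B = {x,y}" "x \<noteq> y" using B card_2_iff by metis
      consider "x \<in> T" "y \<in> T" | "x = r" "y \<in> T" | "y = r" "x \<in> T" using xy B e by auto
      then show ?thesis
      proof cases
        case 1 then show ?thesis using witD[OF w 1 xy(2)] xy e by simp
      next
        case 2 then show ?thesis using all[of y] xy e by simp
      next
        case 3 then show ?thesis using all[of x] xy e by (simp add: insert_commute)
      qed
    qed
    then have "bases M = {B. B \<subseteq> fst M \<and> card B = 2}" using c2 w e sub by blast
    then show False using n25 iso_uniform_iff[OF m, of 2 5] cE by simp
  qed
  show 2: "\<exists>t\<in>T. insert r (insert t S) \<in> bases M" if w: "wit (bases M) S T" and r: "r \<in> fst M - S - T" for S T r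
  proof (rule ccontr)
    assume "\<not> ?thesis"
    then have all: "\<And>t. t \<in> T \<Longrightarrow> insert r (insert t S) \<notin> bases M" by blast
    have e: "S = {}" "fst M = insert r T" using line_and_loop[OF w r all] by auto
    have cT: "card T = 4" "finite T" using w wit_card[OF w] unfolding wit_def by auto
    have cE: "card (fst M) = 5" using e cT r by simp
    have rT: "fst M - {r} = T" using e r by auto
    have "B \<in> bases M \<longleftrightarrow> B \<subseteq> T \<and> card B = 2" for B
    proof
      assume B: "B \<in> bases M"
      have cB: "card B = 2" using c2 w e B by blast
      then obtain x y where xy: "B = {x,y}" "x \<noteq> y" using card_2_iff by metis
      have "r \<notin> B"
      proof
        assume "r \<in> B"
        then obtain t where t: "B = {r,t}" "t \<noteq> r" using xy by auto
        then have "t \<in> T" using sub[OF B] e by auto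
        then show False using all[of t] t B e by simp
      qed
      then show "B \<subseteq> T \<and> card B = 2" using sub[OF B] e cB by auto
    next
      assume B: "B \<subseteq> T \<and> card B = 2"
      then obtain x y where xy: "B = {x,y}" "x \<noteq> y" using card_2_iff by metis
      then show "B \<in> bases M" using witD[OF w, of x y] B e by simp
    qed
    then have "bases M = {B. B \<subseteq> fst M - {r} \<and> card B = 2}" unfolding rT by blast
    then show False using nl iso_line_loop_iff[OF m] cE r by blast
  qed
  fix S T r1 r2 r3 t1 t2 t3
  assume w: "wit (bases M) S T" and r: "{r1,r2,r3} \<subseteq> fst M - S - T" and t: "{t1,t2,t3} \<subseteq> T" "distinct [t1,t2,t3]"
    and n: "insert r1 (insert t1 S) \<notin> bases M" "insert r2 (insert t2 S) \<notin> bases M" "insert r3 (insert t3 S) \<notin> bases M"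
  have cT: "card T = 4" "finite T" using w wit_card[OF w] unfolding wit_def by auto
  have "card (T - {t1,t2,t3}) = 1" using cT t by (simp add: card_Diff_subset)
  then obtain t4 where t4: "T - {t1,t2,t3} = {t4}" using card_1_singletonE by blast
  have T: "T = {t1,t2,t3,t4}" and d: "distinct [t1,t2,t3,t4]" using t t4 by auto
  have lab: "insert x (insert u S) \<in> bases M \<longleftrightarrow> u \<noteq> v"
    if "x \<in> fst M - S - T" "v \<in> T" "insert x (insert v S) \<notin> bases M" "u \<in> T" for x u v
    using unique_label[OF w 1[OF w that(1)] 2[OF w that(1)]] that by blast
  have E: "S = {} \<and> fst M = {t1,t2,t3,t4,r1,r2,r3} \<and> distinct [t1,t2,t3,t4,r1,r2,r3] \<and>
    insert r1 (insert r2 S) \<in> bases M \<and> insert r1 (insert r3 S) \<in> bases M \<and> insert r2 (insert r3 S) \<in> bases M"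
  proof (rule three_parallel_pairs)
    show "wit (bases M) S {t1,t2,t3,t4}" "{r1,r2,r3} \<subseteq> fst M - S - {t1,t2,t3,t4}" "distinct [t1,t2,t3,t4]"
      using w r d T by simp_all
    show "\<And>u. u \<in> {t1,t2,t3,t4} \<Longrightarrow> insert r1 (insert u S) \<in> bases M \<longleftrightarrow> u \<noteq> t1" using lab[of r1 t1] r t n T by blast
    show "\<And>u. u \<in> {t1,t2,t3,t4} \<Longrightarrow> insert r2 (insert u S) \<in> bases M \<longleftrightarrow> u \<noteq> t2" using lab[of r2 t2] r t n T by blast
    show "\<And>u. u \<in> {t1,t2,t3,t4} \<Longrightarrow> insert r3 (insert u S) \<in> bases M \<longleftrightarrow> u \<noteq> t3" using lab[of r3 t3] r t n T by blast
  qed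
  then have S: "S = {}" and Ee: "fst M = {t1,t2,t3,t4,r1,r2,r3}" and dd: "distinct [t1,t2,t3,t4,r1,r2,r3]"
    and rr: "{r1,r2} \<in> bases M" "{r1,r3} \<in> bases M" "{r2,r3} \<in> bases M" by auto
  have tt: "{x,y} \<in> bases M" if "x \<in> T" "y \<in> T" "x \<noteq> y" for x y using witD[OF w that] S by simp
  have rt: "{x,u} \<in> bases M \<longleftrightarrow> u \<noteq> v" if "x \<in> fst M - S - T" "v \<in> T" "insert x (insert v S) \<notin> bases M" "u \<in> T" for x u v
    using lab[OF that] S by simp
  have rtt: "{r1,u} \<in> bases M \<longleftrightarrow> u \<noteq> t1" "{r2,u} \<in> bases M \<longleftrightarrow> u \<noteq> t2" "{r3,u} \<in> bases M \<longleftrightarrow> u \<noteq> t3" if "u \<in> T" for u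
    using rt[OF _ _ n(1) that] rt[OF _ _ n(2) that] rt[OF _ _ n(3) that] r t by auto
  \<comment> \<open>Each \<open>r\<close> gets the number of its parallel partner plus four, so that
    parallel elements agree modulo 4 as in \<open>K_eq\<close>.\<close>
  define f :: "'a \<Rightarrow> nat" where "f x = (if x = t1 then 0 else if x = t2 then 1 else if x = t3 then 2 else if x = t4 then 3
    else if x = r1 then 4 else if x = r2 then 5 else 6)" for x
  have fv: "f t1 = 0" "f t2 = 1" "f t3 = 2" "f t4 = 3" "f r1 = 4" "f r2 = 5" "f r3 = 6" using dd by (auto simp: f_def)
  have "f ` fst M = {0,1,2,3,4,5,6}" unfolding Ee using fv by auto
  then have im: "f ` fst M = {0..<7}" by auto
  have "card (fst M) = 7" using Ee dd by simp
  then have "inj_on f (fst M)" using im by (intro eq_card_imp_inj_on) (auto simp: fin)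
  then have bij: "bij_betw f (fst M) {0..<7}" using im by (simp add: bij_betw_def)
  have pr: "{x,y} \<in> bases M \<longleftrightarrow> f x mod 4 \<noteq> f y mod 4" if xy: "x \<in> fst M" "y \<in> fst M" "x \<noteq> y" for x y
  proof -
    have TT: "f u mod 4 \<noteq> f v mod 4" if "u \<in> T" "v \<in> T" "u \<noteq> v" for u v using that fv unfolding T by auto
    have RT: "{u,v} \<in> bases M \<longleftrightarrow> f u mod 4 \<noteq> f v mod 4" if u: "u \<in> {r1,r2,r3}" and v: "v \<in> T" for u v
    proof -
      consider "v = t1" | "v = t2" | "v = t3" | "v = t4" using v T by blast
      then have "(f r1 mod 4 \<noteq> f v mod 4 \<longleftrightarrow> v \<noteq> t1) \<and> (f r2 mod 4 \<noteq> f v mod 4 \<longleftrightarrow> v \<noteq> t2) \<and> (f r3 mod 4 \<noteq> f v mod 4 \<longleftrightarrow> v \<noteq> t3)"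
      proof cases
        case 1
        show ?thesis using d unfolding 1 fv by simp
      next
        case 2
        show ?thesis using d unfolding 2 fv by auto
      next
        case 3
        show ?thesis using d unfolding 3 fv by auto
      next
        case 4
        show ?thesis using d unfolding 4 fv by auto
      qed
      then show ?thesis using u rtt[OF v] by blast
    qed
    have RR: "{u,v} \<in> bases M \<and> f u mod 4 \<noteq> f v mod 4" if "u \<in> {r1,r2,r3}" "v \<in> {r1,r2,r3}" "u \<noteq> v" for u v
    proof -
      have sw: "{v,u} \<in> bases M" if "{u,v} \<in> bases M" for u v using that by (simp add: insert_commute)
      show ?thesis using that rr sw[OF rr(1)] sw[OF rr(2)] sw[OF rr(3)] by (auto simp: fv)
    qed
    consider "x \<in> T" "y \<in> T" | "x \<in> {r1,r2,r3}" "y \<in> T" | "y \<in> {r1,r2,r3}" "x \<in> T" | "x \<in> {r1,r2,r3}" "y \<in> {r1,r2,r3}"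
      using xy(1,2) unfolding Ee T by blast
    then show ?thesis
    proof cases
      case 1
      then show ?thesis using tt[OF 1 xy(3)] TT[OF 1 xy(3)] by blast
    next
      case 2
      then show ?thesis by (rule RT)
    next
      case 3
      have "{x,y} = {y,x}" by auto
      then show ?thesis using RT[OF 3] by metis
    next
      case 4
      then show ?thesis using RR[OF 4 xy(3)] by blast
    qed
  qed
  have "B \<in> bases M \<longleftrightarrow> B \<subseteq> fst M \<and> card B = 2 \<and> inj_on (\<lambda>x. f x mod 4) B" for B
  proof (cases "B \<subseteq> fst M \<and> card B = 2")
    case True
    then obtain x y where xy: "B = {x,y}" "x \<noteq> y" using card_2_iff by metis
    have "inj_on (\<lambda>x. f x mod 4) {x,y} \<longleftrightarrow> f x mod 4 \<noteq> f y mod 4" using xy(2) by (auto simp: inj_on_def)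
    moreover have "{x,y} \<in> bases M \<longleftrightarrow> f x mod 4 \<noteq> f y mod 4" using pr[of x y] True xy by blast
    ultimately show ?thesis using True xy(1) by simp
  next
    case False
    then show ?thesis using c2 w S sub by blast
  qed
  then have "bases M = {B. B \<subseteq> fst M \<and> card B = 2 \<and> inj_on (\<lambda>x. f x mod 4) B}" by blast
  then have "iso M K" using iso_K_iff[OF m] bij by blast
  then show False using nK by blast
qed

lemma complement_image:
  "dfam E {B. B \<subseteq> E \<and> P B} = {B. B \<subseteq> E \<and> P (E - B)}"
proof (intro equalityI subsetI)
  fix X assume "X \<in> dfam E {B. B \<subseteq> E \<and> P B}"
  then obtain B where "B \<subseteq> E" "P B" "X = E - B" unfolding dfam_def by blast
  moreover then have "E - X = B" by blast
  ultimately show "X \<in> {B. B \<subseteq> E \<and> P (E - B)}" by simp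
next
  fix X assume X: "X \<in> {B. B \<subseteq> E \<and> P (E - B)}"
  then have "X = E - (E - X)" by blast
  then show "X \<in> dfam E {B. B \<subseteq> E \<and> P B}" unfolding dfam_def using X by blast
qed

lemma iso_dual_U25:
  assumes m: "matroid M" shows "iso (dual M) (U 2 5) \<longleftrightarrow> iso M (U 3 5)"
proof -
  note df = dual_facts[OF m]
  interpret base_family "fst M" "bases M" by (rule matroid_base_family[OF m])
  have c: "card (fst M - B) = 5 - card B" if "B \<subseteq> fst M" "card (fst M) = 5" for B
    using that fin finite_subset by (metis card_Diff_subset)
  have le: "card B \<le> 5" if "B \<subseteq> fst M" "card (fst M) = 5" for B using card_mono[OF fin that(1)] that(2) by simp
  have e: "dfam (fst M) {B. B \<subseteq> fst M \<and> card B = 2} = {B. B \<subseteq> fst M \<and> card B = 3}"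
    "dfam (fst M) {B. B \<subseteq> fst M \<and> card B = 3} = {B. B \<subseteq> fst M \<and> card B = 2}" if "card (fst M) = 5"
    unfolding complement_image using c le that by force+
  have k: "dfam (fst M) (bases M) = {B. B \<subseteq> fst M \<and> card B = 2} \<longleftrightarrow> bases M = {B. B \<subseteq> fst M \<and> card B = 3}" if c5: "card (fst M) = 5"
  proof
    assume "dfam (fst M) (bases M) = {B. B \<subseteq> fst M \<and> card B = 2}"
    from arg_cong[OF this, of "dfam (fst M)"] show "bases M = {B. B \<subseteq> fst M \<and> card B = 3}" by (simp only: dfam_dfam e(1)[OF c5])
  next
    assume "bases M = {B. B \<subseteq> fst M \<and> card B = 3}"
    then show "dfam (fst M) (bases M) = {B. B \<subseteq> fst M \<and> card B = 2}" by (simp only: e(2)[OF c5])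
  qed
  have "iso (dual M) (U 2 5) \<longleftrightarrow> card (fst M) = 5 \<and> dfam (fst M) (bases M) = {B. B \<subseteq> fst M \<and> card B = 2}"
    using iso_uniform_iff[OF df(1), of 2 5] unfolding df by simp
  also have "\<dots> \<longleftrightarrow> card (fst M) = 5 \<and> bases M = {B. B \<subseteq> fst M \<and> card B = 3}" by (rule conj_cong[OF refl], rule k)
  also have "\<dots> \<longleftrightarrow> iso M (U 3 5)" using iso_uniform_iff[OF m, of 3 5] by simp
  finally show ?thesis .
qed

lemma iso_dual_line_loop:
  assumes m: "matroid M" shows "iso (dual M) (dsum (U 2 4) (U 0 1)) \<longleftrightarrow> iso M (dsum (U 2 4) (U 1 1))"
proof -
  note df = dual_facts[OF m]
  interpret base_family "fst M" "bases M" by (rule matroid_base_family[OF m])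
  have c: "card (fst M - B) = 5 - card B" if "B \<subseteq> fst M" "card (fst M) = 5" for B
    using that fin finite_subset by (metis card_Diff_subset)
  have le: "card B \<le> 5" if "B \<subseteq> fst M" "card (fst M) = 5" for B using card_mono[OF fin that(1)] that(2) by simp
  have k: "dfam (fst M) (bases M) = {B. B \<subseteq> fst M - {e} \<and> card B = 2} \<longleftrightarrow> bases M = {B. B \<subseteq> fst M \<and> e \<in> B \<and> card B = 3}"
    if e: "e \<in> fst M" and c5: "card (fst M) = 5" for e
  proof -
    have a: "{B. B \<subseteq> fst M - {e} \<and> card B = 2} = {B. B \<subseteq> fst M \<and> (e \<notin> B \<and> card B = 2)}" by auto
    have f1: "dfam (fst M) {B. B \<subseteq> fst M \<and> (e \<notin> B \<and> card B = 2)} = {B. B \<subseteq> fst M \<and> (e \<in> B \<and> card B = 3)}"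
      unfolding complement_image using c le c5 e by force
    have f2: "dfam (fst M) {B. B \<subseteq> fst M \<and> (e \<in> B \<and> card B = 3)} = {B. B \<subseteq> fst M \<and> (e \<notin> B \<and> card B = 2)}"
      unfolding complement_image using c le c5 e by force
    show ?thesis unfolding a
    proof
      assume "dfam (fst M) (bases M) = {B. B \<subseteq> fst M \<and> (e \<notin> B \<and> card B = 2)}"
      from arg_cong[OF this, of "dfam (fst M)"] show "bases M = {B. B \<subseteq> fst M \<and> e \<in> B \<and> card B = 3}" by (simp only: dfam_dfam f1)
    next
      assume "bases M = {B. B \<subseteq> fst M \<and> e \<in> B \<and> card B = 3}"
      then show "dfam (fst M) (bases M) = {B. B \<subseteq> fst M \<and> (e \<notin> B \<and> card B = 2)}" by (simp only: f2)
    qed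
  qed
  show ?thesis unfolding iso_line_loop_iff[OF df(1)] iso_line_coloop_iff[OF m] df
    by (rule bex_cong[OF refl], rule conj_cong[OF refl], rule k)
qed

lemma excluded_minor_classification:
  assumes em: "excluded_minor_R M"
    and n: "\<not> iso M (U 2 5)" "\<not> iso M (U 3 5)" "\<not> iso M K" "\<not> iso M (dual K)" "\<not> iso M R6"
      "\<not> iso M (dsum (U 2 4) (U 1 1))" "\<not> iso M (dsum (U 2 4) (U 0 1))"
  shows "in_D M"
proof -
  have m: "matroid M" using em by (simp add: excluded_minor_R_def)
  note df = dual_facts[OF m]
  interpret minor_minimal "fst M" "bases M" by (rule excluded_minor_minimal[OF em])
  note p = no_rank_two_pattern[OF em n(1,7,3)]
  \<comment> \<open>The other three excluded types are the duals of the first three, so the pattern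
    lemma applies to \<open>dual M\<close> as well.\<close>
  have "\<not> iso (dual M) (U 2 5)" "\<not> iso (dual M) (dsum (U 2 4) (U 0 1))" "\<not> iso (dual M) K"
    using n iso_dual_U25[OF m] iso_dual_line_loop[OF m] iso_dual_iff[OF m matroid_K] by auto
  note q = no_rank_two_pattern[OF excluded_minor_dual[OF em] this, unfolded df]
  have dw: "wit (dfam (fst M) (bases M)) (fst M - S - T) T" "s \<in> fst M - (fst M - S - T) - T"
    "\<And>t. t \<in> T \<Longrightarrow> insert s (insert t (fst M - S - T)) \<in> dfam (fst M) (bases M) \<longleftrightarrow> (S - {s}) \<union> (T - {t}) \<in> bases M"
    if w: "wit (bases M) S T" and s: "s \<in> S" for S T s
  proof -
    have st: "S \<subseteq> fst M" "T \<subseteq> fst M" "S \<inter> T = {}" using wit_sub[OF w] w unfolding wit_def by blast+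
    show "wit (dfam (fst M) (bases M)) (fst M - S - T) T" by (rule wit_dual[OF w])
    have e: "fst M - (fst M - S - T) - T = S" using st by auto
    show s': "s \<in> fst M - (fst M - S - T) - T" using s e by simp
    show "insert s (insert t (fst M - S - T)) \<in> dfam (fst M) (bases M) \<longleftrightarrow> (S - {s}) \<union> (T - {t}) \<in> bases M" if "t \<in> T" for t
      using dual_add[of "fst M - S - T" T s t] e s' that st by auto
  qed
  interpret nsm: no_small_minor "fst M" "bases M"
  proof
    show "\<And>S T r. wit (bases M) S T \<Longrightarrow> r \<in> fst M - S - T \<Longrightarrow> \<exists>t\<in>T. insert r (insert t S) \<notin> bases M" by (rule p(1))
    show "\<And>S T r. wit (bases M) S T \<Longrightarrow> r \<in> fst M - S - T \<Longrightarrow> \<exists>t\<in>T. insert r (insert t S) \<in> bases M" by (rule p(2))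
    show "\<exists>t\<in>T. S - {s} \<union> (T - {t}) \<notin> bases M" if "wit (bases M) S T" "s \<in> S" for S T s
      using q(1)[OF dw(1,2)[OF that]] dw(3)[OF that] by blast
    show "\<exists>t\<in>T. S - {s} \<union> (T - {t}) \<in> bases M" if "wit (bases M) S T" "s \<in> S" for S T s
      using q(2)[OF dw(1,2)[OF that]] dw(3)[OF that] by blast
    show False if "wit (bases M) S T" "{r1,r2,r3} \<subseteq> fst M - S - T" "{t1,t2,t3} \<subseteq> T" "distinct [t1,t2,t3]"
      "insert r1 (insert t1 S) \<notin> bases M" "insert r2 (insert t2 S) \<notin> bases M" "insert r3 (insert t3 S) \<notin> bases M"
      for S T r1 r2 r3 t1 t2 t3 using p(3)[OF that] .
    show False if w: "wit (bases M) S T" and s: "{s1,s2,s3} \<subseteq> S" and t: "{t1,t2,t3} \<subseteq> T" "distinct [t1,t2,t3]"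
      and no: "S - {s1} \<union> (T - {t1}) \<notin> bases M" "S - {s2} \<union> (T - {t2}) \<notin> bases M" "S - {s3} \<union> (T - {t3}) \<notin> bases M"
      for S T s1 s2 s3 t1 t2 t3
    proof -
      have si: "s1 \<in> S" "s2 \<in> S" "s3 \<in> S" using s by auto
      have ti: "t1 \<in> T" "t2 \<in> T" "t3 \<in> T" using t by auto
      show False
        by (rule q(3)[OF dw(1)[OF w si(1)] _ t])
          (use dw(2)[OF w] si no dw(3)[OF w si(1) ti(1)] dw(3)[OF w si(2) ti(2)] dw(3)[OF w si(3) ti(3)] in auto)
    qed
    show False if c: "card X = 3" "card Y = 3" "X \<inter> Y = {}" "Z \<inter> (X \<union> Y) = {}" "Z \<union> X \<notin> bases M" "Z \<union> Y \<notin> bases M"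
      and p1: "\<And>p q w. p \<in> X \<Longrightarrow> q \<in> X \<Longrightarrow> w \<in> Y \<Longrightarrow> p \<noteq> q \<Longrightarrow> insert p (insert q (insert w Z)) \<in> bases M"
      and p2: "\<And>p q w. p \<in> X \<Longrightarrow> q \<in> Y \<Longrightarrow> w \<in> Y \<Longrightarrow> q \<noteq> w \<Longrightarrow> insert p (insert q (insert w Z)) \<in> bases M" for X Y Z
    proof -
      have Z: "Z = {}" "fst M = X \<union> Y" using two_disjoint_triangles[OF c(1-5) p1 p2] by auto
      obtain x1 x2 x3 where X: "X = {x1,x2,x3}" "distinct [x1,x2,x3]" using card3E[OF c(1)] .
      obtain y1 y2 y3 where Y: "Y = {y1,y2,y3}" "distinct [y1,y2,y3]" using card3E[OF c(2)] .
      have "{x1,x2,y1} \<in> bases M" using p1[of x1 x2 y1] X Y Z(1) by auto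
      moreover have "card {x1,x2,y1} = 3" using X Y c(3) by auto
      ultimately have c3: "card B = 3" if "B \<in> bases M" for B using cardB that by metis
      have conv: "B \<in> bases M" if B: "B \<subseteq> fst M" "card B = 3" "B \<noteq> X" "B \<noteq> Y" for B
      proof -
        obtain a b d where abd: "B = {a,b,d}" "distinct [a,b,d]" using card3E[OF B(2)] .
        have fX: "finite X" "finite Y" using X Y by auto
        have nX: "\<not> B \<subseteq> X" using card_subset_eq[OF fX(1)] B(2,3) c(1) by metis
        have nY: "\<not> B \<subseteq> Y" using card_subset_eq[OF fX(2)] B(2,4) c(2) by metis
        have in1: "{u,v,z} \<in> bases M" if "u \<in> X" "v \<in> X" "z \<in> Y" "u \<noteq> v" for u v z using p1[OF that] Z(1) by simp
        have in2: "{u,v,z} \<in> bases M" if "u \<in> X" "v \<in> Y" "z \<in> Y" "v \<noteq> z" for u v z using p2[OF that] Z(1) by simp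
        have ne: "a \<noteq> b" "a \<noteq> d" "b \<noteq> d" using abd by auto
        have mem: "a \<in> X \<or> a \<in> Y" "b \<in> X \<or> b \<in> Y" "d \<in> X \<or> d \<in> Y" using B(1) abd Z(2) by auto
        consider "a \<in> X" "b \<in> X" "d \<in> Y" | "a \<in> X" "d \<in> X" "b \<in> Y" | "b \<in> X" "d \<in> X" "a \<in> Y"
          | "a \<in> X" "b \<in> Y" "d \<in> Y" | "b \<in> X" "a \<in> Y" "d \<in> Y" | "d \<in> X" "a \<in> Y" "b \<in> Y"
          using mem nX nY unfolding abd(1) by blast
        then show ?thesis unfolding abd(1)
        proof cases
          case 1 then show "{a,b,d} \<in> bases M" using in1 ne by blast
        next
          case 2
          then have "{a,d,b} \<in> bases M" using in1 ne by blast
          then show "{a,b,d} \<in> bases M" by (simp add: insert_commute)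
        next
          case 3
          then have "{b,d,a} \<in> bases M" using in1 ne by blast
          then show "{a,b,d} \<in> bases M" by (simp add: insert_commute)
        next
          case 4 then show "{a,b,d} \<in> bases M" using in2 ne by blast
        next
          case 5
          then have "{b,a,d} \<in> bases M" using in2 ne by blast
          then show "{a,b,d} \<in> bases M" by (simp add: insert_commute)
        next
          case 6
          then have "{d,a,b} \<in> bases M" using in2 ne by blast
          then show "{a,b,d} \<in> bases M" by (simp add: insert_commute)
        qed
      qed
      have bb: "bases M = {B. B \<subseteq> fst M \<and> card B = 3 \<and> B \<noteq> X \<and> B \<noteq> Y}"
      proof (intro equalityI subsetI)
        fix B assume B: "B \<in> bases M"
        have "B \<noteq> X" "B \<noteq> Y" using B c(5,6) Z(1) by auto
        then show "B \<in> {B. B \<subseteq> fst M \<and> card B = 3 \<and> B \<noteq> X \<and> B \<noteq> Y}" using c3[OF B] sub[OF B] by simp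
      next
        fix B assume "B \<in> {B. B \<subseteq> fst M \<and> card B = 3 \<and> B \<noteq> X \<and> B \<noteq> Y}"
        then show "B \<in> bases M" using conv by simp
      qed
      have "two_triangles (fst M) (bases M)" unfolding two_triangles_def by (intro exI[of _ X] exI[of _ Y] conjI c(1-3) Z(2) bb)
      then show False using n(5) iso_R6_iff[OF m] by blast
    qed
  qed
  interpret mb: minimal_bad "fst M" "bases M"
    by (rule minimal_bad.intro[OF nsm.no_small_minor_axioms minor_minimal_axioms])
  obtain H where HH: "free_base (fst M) (bases M) H \<and> free_base (fst M) (bases M) (fst M - H) \<and>
     (\<forall>S T. wit (bases M) S T \<longrightarrow> through H S T \<or> through (fst M - H) S T) \<and>
     (\<exists>S T. wit (bases M) S T \<and> through H S T \<and> S \<noteq> {})"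
    using mb.complementary_free_bases by (rule exE)
  note H = HH[THEN conjunct1] HH[THEN conjunct2, THEN conjunct1] HH[THEN conjunct2, THEN conjunct2, THEN conjunct1]
  obtain S T where w: "wit (bases M) S T" "S \<noteq> {}" using HH by blast
  have HB: "H \<in> bases M" using H unfolding free_base_def by blast
  \<comment> \<open>A nonempty contracted set means rank at least three, the bound required by
    \<open>doubly_relaxed\<close>.\<close>
  have "card S \<noteq> 0" using w wit_card(2)[OF w(1)] by simp
  then have "3 \<le> card H" using wit_card(1)[OF w(1)] cardB[OF HB] by simp
  then have "doubly_relaxed (fst M) (bases M)" unfolding doubly_relaxed_def using H by blast
  then show ?thesis using in_D_iff[OF m] by blast
qed

theorem theorem1p2:
  fixes M :: "'a matroid"
  assumes "matroid M"
  shows "excluded_minor_R M \<longleftrightarrow>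
    (iso M (U 2 5) \<or> iso M (U 3 5) \<or> iso M K \<or> iso M (dual K) \<or> iso M R6 \<or>
     iso M (dsum (U 2 4) (U 1 1)) \<or> iso M (dsum (U 2 4) (U 0 1)) \<or> in_D M)"
proof -
  have m: "matroid M" by fact
  note df = dual_facts[OF m]
  have u: "excluded_minor_R N" if "matroid N" "iso N (U 2 5)" for N :: "'a matroid"
  proof -
    have "card (fst N) = 5" "bases N = {B. B \<subseteq> fst N \<and> card B = 2}" using iso_uniform_iff[OF that(1), of 2 5] that(2) by simp_all
    then show ?thesis by (intro excluded_minor_pairs[OF that(1), of "fst N"]) simp_all
  qed
  have l: "excluded_minor_R N" if mN: "matroid N" and iN: "iso N (dsum (U 2 4) (U 0 1))" for N :: "'a matroid"
  proof -
    obtain e where "e \<in> fst N" "card (fst N) = 5" "bases N = {B. B \<subseteq> fst N - {e} \<and> card B = 2}"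
      using iso_line_loop_iff[OF mN] iN by blast
    then show ?thesis by (intro excluded_minor_pairs[OF mN, of "fst N - {e}"]) auto
  qed
  have d: "excluded_minor_R M" if "excluded_minor_R (dual M)"
    using excluded_minor_dual[OF that] dual_dual[OF m] by simp
  show ?thesis
  proof
    assume "excluded_minor_R M"
    then show "iso M (U 2 5) \<or> iso M (U 3 5) \<or> iso M K \<or> iso M (dual K) \<or> iso M R6 \<or>
     iso M (dsum (U 2 4) (U 1 1)) \<or> iso M (dsum (U 2 4) (U 0 1)) \<or> in_D M"
      using excluded_minor_classification[of M] by argo
  next
    assume "iso M (U 2 5) \<or> iso M (U 3 5) \<or> iso M K \<or> iso M (dual K) \<or> iso M R6 \<or>
     iso M (dsum (U 2 4) (U 1 1)) \<or> iso M (dsum (U 2 4) (U 0 1)) \<or> in_D M"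
    then show "excluded_minor_R M"
    proof (elim disjE)
      assume "iso M (U 3 5)"
      then show ?thesis using d u[OF df(1)] iso_dual_U25[OF m] by simp
    next
      assume "iso M (dual K)"
      then show ?thesis using d excluded_minor_K[OF df(1)] iso_dual_iff[OF m matroid_K] by simp
    next
      assume "iso M R6"
      then show ?thesis using excluded_minor_R6[OF m] iso_R6_iff[OF m] by simp
    next
      assume "iso M (dsum (U 2 4) (U 1 1))"
      then show ?thesis using d l[OF df(1)] iso_dual_line_loop[OF m] by simp
    qed (auto intro: u[OF m] l[OF m] excluded_minor_K[OF m] in_D_excluded[OF m])
  qed
qed

end
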